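(* Let $G\cong\dfrac{G^0\times\Delta}{N}$ be a compact Lie FC group (presented as described in the context), and let $\alpha:G\times G\to G$, $\alpha(x,y)=xyx^{-1}y^{-1}$, be the commutator map. Then for every $g_0\in G$, $$\mu^2\big(\alpha^{-1}(g_0)\big)=\frac{|N|}{|\Delta|}\lim_{t\to\infty}\left(\frac{1}{|Irr(G^0)_t|}\sum_{\chi\in Irr(G)_t}\frac{\chi(g_0)}{\chi(1)}\right).$$
   Context: A group is an FC group if each of its conjugacy classes is finite. $\mu$ is the normalised Haar measure on $G$ and $\mu^2$ the corresponding (product) measure on $G\times G$. Presentation of $G$: $G^0$ is the identity component of $G$; it is a torus, central in $G$. $\Delta$ is a finite group, $N$ is a finite group identified with a (normal) subgroup of $G^0$ and with a normal subgroup of $\Delta$, and $N$ is embedded in $G^0\times\Delta$ by $n\mapsto(n,n^{-1})$ under these identifications, the image being a central subgroup of $G^0\times\Delta$. The isomorphism $G\cong (G^0\times\Delta)/N$ is compatible with the inclusion of $G^0$ in $G$. Characters: identify $G^0$ with $(S^1)^k$, $k=\dim G$. For an integer $t\ge0$, $Irr(G^0)_t$ is the set of characters $(e^{i\theta_1},\dots,e^{i\theta_k})\mapsto\prod_j e^{im_j\theta_j}$ with $m_j\in\mathbb{Z}$ and $|m_j|\le t$ for all $j$. $Irr(G^0\times\Delta)_t$ is the set of characters $(x,a)\mapsto \psi(x)\eta(a)$ with $\psi\in Irr(G^0)_t$ and $\eta$ an irreducible complex character of $\Delta$. $Irr(G)_t$ is the set of irreducible characters of $G$ whose pull-back along the quotient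 map $G^0\times\Delta\to G$ lies in $Irr(G^0\times\Delta)_t$. *)

theory Defs
  imports
    "HOL-Analysis.Analysis"
    "HOL-Algebra.Algebra"
    "Jordan_Normal_Form.Matrix"
    "Jordan_Normal_Form.VS_Connect"
begin

section \<open>Smooth manifolds and Lie groups\<close>

text \<open>
  \<open>C_k\<close> functions on a relatively open subset \<open>U\<close> of \<open>\<real>\<^sup>n\<close>. The library space
  \<open>Euclidean_space n\<close> consists of the sequences that vanish from index \<open>n\<close> on. Here \<open>n = 0\<close> is
  allowed, which a finite index type would exclude. The \<open>i\<close>-th partial derivative is \<open>g i\<close>.
\<close>

primrec Ck_on :: "nat \<Rightarrow> nat \<Rightarrow> (nat \<Rightarrow> real) set \<Rightarrow> ((nat \<Rightarrow> real) \<Rightarrow> real) \<Rightarrow> bool" where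
  "Ck_on n 0 U f \<longleftrightarrow> continuous_map (subtopology (Euclidean_space n) U) euclideanreal f"
| "Ck_on n (Suc k) U f \<longleftrightarrow>
     continuous_map (subtopology (Euclidean_space n) U) euclideanreal f \<and>
     (\<exists>g. \<forall>i<n. Ck_on n k U (g i) \<and>
        (\<forall>x\<in>U. ((\<lambda>s. f (x(i := x i + s))) has_real_derivative g i x) (at 0)))"

definition smooth_on :: "nat \<Rightarrow> nat \<Rightarrow> (nat \<Rightarrow> real) set \<Rightarrow> ((nat \<Rightarrow> real) \<Rightarrow> nat \<Rightarrow> real) \<Rightarrow> bool" where
  "smooth_on n m U f \<longleftrightarrow> (\<forall>j<m. \<forall>k. Ck_on n k U (\<lambda>x. f x j))"

type_synonym 'a chart = "'a set \<times> ('a \<Rightarrow> nat \<Rightarrow> real)"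

definition is_chart :: "'a topology \<Rightarrow> nat \<Rightarrow> 'a chart \<Rightarrow> bool" where
  "is_chart T n = (\<lambda>(U, c). openin T U \<and>
     (\<exists>V. openin (Euclidean_space n) V \<and>
          homeomorphic_map (subtopology T U) (subtopology (Euclidean_space n) V) c))"

definition smooth_atlas :: "'a topology \<Rightarrow> nat \<Rightarrow> 'a chart set \<Rightarrow> bool" where
  "smooth_atlas T n A \<longleftrightarrow>
     (\<forall>C\<in>A. is_chart T n C) \<and> (\<Union>(U, c)\<in>A. U) = topspace T \<and>
     (\<forall>(U, c)\<in>A. \<forall>(V, d)\<in>A. smooth_on n n (c ` (U \<inter> V)) (d \<circ> inv_into U c))"

definition smooth_map ::
  "'a topology \<Rightarrow> nat \<Rightarrow> 'a chart set \<Rightarrow> 'b topology \<Rightarrow> nat \<Rightarrow> 'b chart set \<Rightarrow> ('a \<Rightarrow> 'b) \<Rightarrow> bool" where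
  "smooth_map S m A T n B f \<longleftrightarrow> continuous_map S T f \<and>
     (\<forall>(U, c)\<in>A. \<forall>(V, d)\<in>B.
        smooth_on m n (c ` {x \<in> U. f x \<in> V}) (d \<circ> f \<circ> inv_into U c))"

definition prod_atlas :: "nat \<Rightarrow> 'a chart set \<Rightarrow> 'b chart set \<Rightarrow> ('a \<times> 'b) chart set" where
  "prod_atlas m A B =
     {(U \<times> V, \<lambda>(x, y) i. if i < m then c x i else d y (i - m)) | U c V d. (U, c) \<in> A \<and> (V, d) \<in> B}"

definition lie_group :: "('a, 'm) monoid_scheme \<Rightarrow> 'a topology \<Rightarrow> nat \<Rightarrow> bool" where
  "lie_group G T n \<longleftrightarrow>
     Group.group G \<and> topspace T = carrier G \<and> Hausdorff_space T \<and> second_countable T \<and>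
     (\<exists>A. smooth_atlas T n A \<and>
          smooth_map (prod_topology T T) (n + n) (prod_atlas n A A) T n A (\<lambda>(x, y). x \<otimes>\<^bsub>G\<^esub> y) \<and>
          smooth_map T n A T n A (\<lambda>x. inv\<^bsub>G\<^esub> x))"

definition identity_component :: "('a, 'm) monoid_scheme \<Rightarrow> 'a topology \<Rightarrow> 'a set" where
  "identity_component G T = connected_component_of_set T \<one>\<^bsub>G\<^esub>"

definition id_comp_group :: "('a, 'm) monoid_scheme \<Rightarrow> 'a topology \<Rightarrow> ('a, 'm) monoid_scheme" where
  "id_comp_group G T = G\<lparr>carrier := identity_component G T\<rparr>"

definition FC_group :: "('a, 'm) monoid_scheme \<Rightarrow> bool" where
  "FC_group G \<longleftrightarrow> Group.group G \<and>
     (\<forall>x\<in>carrier G. finite ((\<lambda>g. g \<otimes>\<^bsub>G\<^esub> x \<otimes>\<^bsub>G\<^esub> inv\<^bsub>G\<^esub> g) ` carrier G))"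

definition central_subgroup :: "'a set \<Rightarrow> ('a, 'm) monoid_scheme \<Rightarrow> bool" where
  "central_subgroup K G \<longleftrightarrow> subgroup K G \<and> (\<forall>x\<in>K. \<forall>y\<in>carrier G. x \<otimes>\<^bsub>G\<^esub> y = y \<otimes>\<^bsub>G\<^esub> x)"

definition commutator_map :: "('a, 'm) monoid_scheme \<Rightarrow> 'a \<times> 'a \<Rightarrow> 'a" where
  "commutator_map G = (\<lambda>(x, y). x \<otimes>\<^bsub>G\<^esub> y \<otimes>\<^bsub>G\<^esub> inv\<^bsub>G\<^esub> x \<otimes>\<^bsub>G\<^esub> inv\<^bsub>G\<^esub> y)"

definition circle_group :: "complex monoid" where
  "circle_group = \<lparr>carrier = sphere 0 1, mult = (*), one = 1\<rparr>"

definition torus_group :: "nat \<Rightarrow> (nat \<Rightarrow> complex) monoid" where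
  "torus_group k = product_group {..<k} (\<lambda>_. circle_group)"

definition torus_topology :: "nat \<Rightarrow> (nat \<Rightarrow> complex) topology" where
  "torus_topology k = product_topology (\<lambda>_. top_of_set (sphere 0 1)) {..<k}"

definition quotient_group_topology ::
  "('a, 'm) monoid_scheme \<Rightarrow> 'a topology \<Rightarrow> 'a set \<Rightarrow> 'a set topology" where
  "quotient_group_topology H S K = topology (\<lambda>\<U>. \<U> \<subseteq> rcosets\<^bsub>H\<^esub> K \<and> openin S (\<Union>\<U>))"

lemma openin_quotient_group_topology:
  assumes "Group.group H" "subgroup K H"
  shows "openin (quotient_group_topology H S K) \<U> \<longleftrightarrow> \<U> \<subseteq> rcosets\<^bsub>H\<^esub> K \<and> openin S (\<Union>\<U>)"
proof -
  interpret Group.group H by fact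
  let ?P = "\<lambda>\<U>. \<U> \<subseteq> rcosets\<^bsub>H\<^esub> K \<and> openin S (\<Union>\<U>)"
  have "?P (\<U> \<inter> \<V>)" if "?P \<U>" "?P \<V>" for \<U> \<V>
  proof -
    have "\<Union>(\<U> \<inter> \<V>) = \<Union>\<U> \<inter> \<Union>\<V>"
    proof (rule equalityI; rule subsetI)
      fix x assume "x \<in> \<Union>\<U> \<inter> \<Union>\<V>"
      then obtain A B where A: "A \<in> \<U>" "x \<in> A" and B: "B \<in> \<V>" "x \<in> B"
        by blast
      with that have "A \<in> rcosets\<^bsub>H\<^esub> K" "B \<in> rcosets\<^bsub>H\<^esub> K"
        by auto
      with A B have "A = B"
        using pairwiseD[OF rcos_disjoint[OF assms(2)], of A B] by (auto simp: disjnt_iff)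
      with A B show "x \<in> \<Union>(\<U> \<inter> \<V>)"
        by auto
    qed auto
    moreover have "openin S (\<Union>\<U> \<inter> \<Union>\<V>)"
      using that by (intro openin_Int) auto
    ultimately show ?thesis using that by auto
  qed
  moreover have "?P (\<Union>\<K>)" if "\<forall>\<U>\<in>\<K>. ?P \<U>" for \<K>
  proof -
    have "\<Union>(\<Union>\<K>) = \<Union>(Union ` \<K>)" by blast
    moreover have "openin S (\<Union>(Union ` \<K>))"
      using that by (intro openin_Union) auto
    ultimately show ?thesis using that by auto
  qed
  ultimately have "istopology ?P"
    unfolding istopology_def by (intro conjI allI impI) simp_all
  then show ?thesis
    unfolding quotient_group_topology_def by (simp add: topology_inverse')
qed

section \<open>Haar measure\<close>

text \<open>For compact groups only: inner regularity on all Borel sets is required because the total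
  mass is finite, and left invariance implies right invariance.\<close>

definition normalised_haar_measure :: "('a, 'm) monoid_scheme \<Rightarrow> 'a topology \<Rightarrow> 'a measure \<Rightarrow> bool" where
  "normalised_haar_measure G T \<mu> \<longleftrightarrow>
     sets \<mu> = sets (sigma (topspace T) {U. openin T U}) \<and>
     emeasure \<mu> (topspace T) = 1 \<and>
     (\<forall>g\<in>carrier G. \<forall>A\<in>sets \<mu>. emeasure \<mu> (g <#\<^bsub>G\<^esub> A) = emeasure \<mu> A) \<and>
     (\<forall>A\<in>sets \<mu>. emeasure \<mu> A = (INF U\<in>{U. openin T U \<and> A \<subseteq> U}. emeasure \<mu> U) \<and>
                  emeasure \<mu> A = (SUP C\<in>{C. compactin T C \<and> C \<subseteq> A}. emeasure \<mu> C))"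

section \<open>Representations and characters\<close>

definition general_linear_group :: "nat \<Rightarrow> complex mat monoid" where
  "general_linear_group n = units_of (ring_mat TYPE(complex) n ())"

definition matrix_rep ::
  "('a, 'm) monoid_scheme \<Rightarrow> 'a topology \<Rightarrow> nat \<Rightarrow> ('a \<Rightarrow> complex mat) \<Rightarrow> bool" where
  "matrix_rep G T n \<rho> \<longleftrightarrow> \<rho> \<in> hom G (general_linear_group n) \<and>
     (\<forall>i<n. \<forall>j<n. continuous_map T euclidean (\<lambda>g. \<rho> g $$ (i, j)))"

definition irreducible_rep ::
  "('a, 'm) monoid_scheme \<Rightarrow> 'a topology \<Rightarrow> nat \<Rightarrow> ('a \<Rightarrow> complex mat) \<Rightarrow> bool" where
  "irreducible_rep G T n \<rho> \<longleftrightarrow> matrix_rep G T n \<rho> \<and> n > 0 \<and>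
     (\<forall>W. VectorSpace.subspace class_ring W (module_vec TYPE(complex) n) \<and>
          (\<forall>g\<in>carrier G. \<forall>w\<in>W. \<rho> g *\<^sub>v w \<in> W) \<longrightarrow> W = {0\<^sub>v n} \<or> W = carrier_vec n)"

text \<open>
  Characters are represented by functions that are \<open>undefined\<close> off the carrier, so that a set of
  characters has the right cardinality.
\<close>

definition irr_characters :: "('a, 'm) monoid_scheme \<Rightarrow> 'a topology \<Rightarrow> ('a \<Rightarrow> complex) set" where
  "irr_characters G T =
     {(\<lambda>g\<in>carrier G. \<Sum>i<n. \<rho> g $$ (i, i)) | n \<rho>. irreducible_rep G T n \<rho>}"

text \<open>
  In the following definitions \<open>G0\<close> is the identity component as a group, identified with
  the \<open>k\<close>-dimensional torus by \<open>\<phi>\<close>, and \<open>q\<close> is the quotient map from \<open>G0 \<times>\<times> \<Delta>\<close> to \<open>G\<close>.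
\<close>

definition irr_torus_upto ::
  "('a, 'm) monoid_scheme \<Rightarrow> nat \<Rightarrow> ('a \<Rightarrow> nat \<Rightarrow> complex) \<Rightarrow> nat \<Rightarrow> ('a \<Rightarrow> complex) set" where
  "irr_torus_upto G0 k \<phi> t =
     {(\<lambda>x\<in>carrier G0. \<Prod>j<k. \<phi> x j powi m j) | m :: nat \<Rightarrow> int. \<forall>j<k. \<bar>m j\<bar> \<le> int t}"

definition irr_prod_upto ::
  "('a, 'm) monoid_scheme \<Rightarrow> nat \<Rightarrow> ('a \<Rightarrow> nat \<Rightarrow> complex) \<Rightarrow> ('b, 'l) monoid_scheme \<Rightarrow> nat
     \<Rightarrow> ('a \<times> 'b \<Rightarrow> complex) set" where
  "irr_prod_upto G0 k \<phi> \<Delta> t =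
     {(\<lambda>(x, a)\<in>carrier (G0 \<times>\<times> \<Delta>). \<psi> x * \<eta> a) | \<psi> \<eta>.
        \<psi> \<in> irr_torus_upto G0 k \<phi> t \<and> \<eta> \<in> irr_characters \<Delta> (discrete_topology (carrier \<Delta>))}"

definition irr_upto ::
  "('a, 'm) monoid_scheme \<Rightarrow> 'a topology \<Rightarrow> nat \<Rightarrow> ('a \<Rightarrow> nat \<Rightarrow> complex) \<Rightarrow> ('b, 'l) monoid_scheme
     \<Rightarrow> ('a \<times> 'b \<Rightarrow> 'a) \<Rightarrow> nat \<Rightarrow> ('a \<Rightarrow> complex) set" where
  "irr_upto G T k \<phi> \<Delta> q t =
     {ch \<in> irr_characters G T.
        (\<lambda>p\<in>carrier (id_comp_group G T \<times>\<times> \<Delta>). ch (q p)) \<in> irr_prod_upto (id_comp_group G T) k \<phi> \<Delta> t}"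

section \<open>Presentations\<close>

text \<open>The image of \<open>N\<close> under \<open>n \<mapsto> (n, n\<^sup>-\<^sup>1)\<close>, where \<open>\<iota>\<close> and \<open>\<kappa>\<close> are the embeddings identifying
  \<open>N\<close> with subgroups of the identity component and of \<open>\<Delta>\<close>.\<close>

definition antidiagonal ::
  "('n, 'l) monoid_scheme \<Rightarrow> ('b, 'm) monoid_scheme \<Rightarrow> ('n \<Rightarrow> 'a) \<Rightarrow> ('n \<Rightarrow> 'b) \<Rightarrow> ('a \<times> 'b) set" where
  "antidiagonal N \<Delta> \<iota> \<kappa> = (\<lambda>n. (\<iota> n, inv\<^bsub>\<Delta>\<^esub> (\<kappa> n))) ` carrier N"

definition presentation ::
  "('a, 'm) monoid_scheme \<Rightarrow> 'a topology \<Rightarrow> nat \<Rightarrow> ('a \<Rightarrow> nat \<Rightarrow> complex) \<Rightarrow> ('b, 'l) monoid_scheme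
     \<Rightarrow> ('n, 'r) monoid_scheme \<Rightarrow> ('n \<Rightarrow> 'a) \<Rightarrow> ('n \<Rightarrow> 'b) \<Rightarrow> (('a \<times> 'b) set \<Rightarrow> 'a) \<Rightarrow> bool" where
  "presentation G T k \<phi> \<Delta> N \<iota> \<kappa> \<Phi> \<longleftrightarrow>
     (let G0 = id_comp_group G T;
          T0 = subtopology T (carrier G0);
          H = G0 \<times>\<times> \<Delta>;
          K = antidiagonal N \<Delta> \<iota> \<kappa>
      in central_subgroup (carrier G0) G \<and>
         \<phi> \<in> iso G0 (torus_group k) \<and> homeomorphic_map T0 (torus_topology k) \<phi> \<and>
         Group.group \<Delta> \<and> finite (carrier \<Delta>) \<and>
         Group.group N \<and> finite (carrier N) \<and>
         \<iota> \<in> mon N G0 \<and> \<iota> ` carrier N \<lhd> G0 \<and>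
         \<kappa> \<in> mon N \<Delta> \<and> \<kappa> ` carrier N \<lhd> \<Delta> \<and>
         central_subgroup K H \<and>
         \<Phi> \<in> iso (H Mod K) G \<and>
         homeomorphic_map
           (quotient_group_topology H (prod_topology T0 (discrete_topology (carrier \<Delta>))) K) T \<Phi> \<and>
         (\<forall>x\<in>carrier G0. \<Phi> (K #>\<^bsub>H\<^esub> (x, \<one>\<^bsub>\<Delta>\<^esub>)) = x))"

definition presentation_map ::
  "('a, 'm) monoid_scheme \<Rightarrow> 'a topology \<Rightarrow> ('b, 'l) monoid_scheme
     \<Rightarrow> ('n, 'r) monoid_scheme \<Rightarrow> ('n \<Rightarrow> 'a) \<Rightarrow> ('n \<Rightarrow> 'b) \<Rightarrow> (('a \<times> 'b) set \<Rightarrow> 'a) \<Rightarrow> 'a \<times> 'b \<Rightarrow> 'a" where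
  "presentation_map G T \<Delta> N \<iota> \<kappa> \<Phi> p =
     \<Phi> (antidiagonal N \<Delta> \<iota> \<kappa> #>\<^bsub>id_comp_group G T \<times>\<times> \<Delta>\<^esub> p)"

end

theory Submission
  imports Defs "Jordan_Normal_Form.Spectral_Radius" "HOL-Probability.Probability_Measure"
begin

unbundle no vec_syntax

text \<open>
  Write \<open>G\<^sub>0\<close> for the identity component and \<open>\<delta>\<close> for the homomorphism \<open>\<Delta> \<rightarrow> G\<close> that comes with the
  presentation. Every element of \<open>G\<close> is a product \<open>x \<delta>(a)\<close> with \<open>x\<close> in \<open>G\<^sub>0\<close>, and the pair \<open>(x, a)\<close> is
  unique up to \<open>(x, a) \<mapsto> (\<iota>(n) x, \<kappa>(n)\<^sup>-\<^sup>1 a)\<close> (\<open>factorisation_eq_iff\<close>). As \<open>G\<^sub>0\<close> is central, the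
  commutator of \<open>x \<delta>(a)\<close> and \<open>y \<delta>(b)\<close> is \<open>\<delta>([a, b])\<close>. Both sides of the formula therefore reduce to
  the finite group \<open>\<Delta>\<close>.

  For the left-hand side, the commutator map is constant on products of cosets of \<open>G\<^sub>0\<close>. These cosets
  are open, and by invariance they all have measure \<open>|N| / |\<Delta>|\<close>. Hence the fibre over \<open>g\<^sub>0\<close> has measure
  \<open>|\<Delta>|\<^sup>-\<^sup>2\<close> times the number of pairs \<open>(a, b)\<close> with \<open>\<delta>([a, b]) = g\<^sub>0\<close> (\<open>measure_commutator_fibre\<close>).

  For the right-hand side, the irreducible characters of \<open>G\<close> that are counted up to \<open>t\<close> correspond to the
  pairs of a torus character \<open>\<psi>\<close> with weights bounded by \<open>t\<close> and an irreducible character \<open>\<eta>\<close> of \<open>\<Delta>\<close> such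
  that \<open>\<psi>(\<iota>(n)) \<eta>(\<kappa>(n)\<^sup>-\<^sup>1) = \<eta>(1)\<close> for all \<open>n\<close> in \<open>N\<close> (\<open>irr_upto_iff\<close>). By Schur's lemma
  \<open>n \<mapsto> \<psi>(\<iota>(n)) \<eta>(\<kappa>(n)\<^sup>-\<^sup>1) / \<eta>(1)\<close> is a homomorphism from \<open>N\<close> to the nonzero complex numbers, so its
  average over \<open>N\<close> is the indicator of this condition. For \<open>g\<^sub>0 = x \<delta>(a)\<close> the character sum thereby
  becomes \<open>|N|\<^sup>-\<^sup>1\<close> times a sum over \<open>n\<close> of the products of \<open>\<Sum>\<^sub>\<psi> \<psi>(\<iota>(n) x)\<close> and
  \<open>\<Sum>\<^sub>\<eta> \<eta>(\<kappa>(n)\<^sup>-\<^sup>1 a) / \<eta>(1)\<close> (\<open>character_sum_factorised\<close>). The average of the first factor over the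
  torus characters tends to \<open>1\<close> if \<open>\<iota>(n) x = 1\<close> and to \<open>0\<close> otherwise, because the sum over
  \<open>|m| \<le> t\<close> of \<open>z\<^sup>m\<close> stays bounded for \<open>z \<noteq> 1\<close>. The second factor is, by the formula of Frobenius, the
  number of pairs with \<open>[a', b'] = \<kappa>(n)\<^sup>-\<^sup>1 a\<close> divided by \<open>|\<Delta>|\<close>. At most one \<open>n\<close> satisfies
  \<open>\<iota>(n) x = 1\<close>, and for it \<open>\<delta>(\<kappa>(n)\<^sup>-\<^sup>1 a) = g\<^sub>0\<close>, so the two sides agree.

  The formula of Frobenius (\<open>frobenius_commutator_formula\<close>) rests on Schur's lemma and on the relation
  \<open>\<Sum>\<^sub>\<eta> \<eta>(1) \<eta>(g) = |\<Delta>| [g = 1]\<close>. The latter comes from the regular representation, whose trace is a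
  sum of irreducible characters because every matrix representation with an invariant subspace is block
  triangular in a suitable basis.
\<close>

section \<open>Matrix representations and traces\<close>

text \<open>The dimension is an argument, as in the definition of characters.\<close>

definition mtrace :: "nat \<Rightarrow> complex mat \<Rightarrow> complex" where
  "mtrace n A = (\<Sum>i<n. A $$ (i, i))"

text \<open>Subspaces of the coordinate space, written elementwise so that kernels and images can be verified on
vectors.\<close>

definition linear_subspace :: "nat \<Rightarrow> complex Matrix.vec set \<Rightarrow> bool" where
  "linear_subspace n W \<longleftrightarrow> W \<subseteq> carrier_vec n \<and> 0\<^sub>v n \<in> W \<and>
     (\<forall>v\<in>W. \<forall>w\<in>W. v + w \<in> W) \<and> (\<forall>c. \<forall>v\<in>W. c \<cdot>\<^sub>v v \<in> W)"

text \<open>Irreducibility as a purely algebraic notion: the topology enters a representation only through the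
continuity of its matrix entries.\<close>

definition irreducible_hom :: "('a, 'm) monoid_scheme \<Rightarrow> nat \<Rightarrow> ('a \<Rightarrow> complex mat) \<Rightarrow> bool" where
  "irreducible_hom G n \<rho> \<longleftrightarrow> \<rho> \<in> hom G (general_linear_group n) \<and> n > 0 \<and>
     (\<forall>W. linear_subspace n W \<and> (\<forall>g\<in>carrier G. \<forall>w\<in>W. \<rho> g *\<^sub>v w \<in> W) \<longrightarrow>
          W = {0\<^sub>v n} \<or> W = carrier_vec n)"

lemma linear_subspace_iff:
  "VectorSpace.subspace class_ring W (module_vec TYPE(complex) n) \<longleftrightarrow> linear_subspace n W"
  unfolding VectorSpace.subspace_def LinearCombinations.submodule_def linear_subspace_def
  using vec_vs[where 'a=complex, of n] vec_module[where 'a=complex, of n]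
  by (auto simp: module_vec_simps class_ring_simps)

lemma irreducible_rep_iff:
  "irreducible_rep G T n \<rho> \<longleftrightarrow> matrix_rep G T n \<rho> \<and> irreducible_hom G n \<rho>"
proof (cases "matrix_rep G T n \<rho>")
  case True
  then have "\<rho> \<in> hom G (general_linear_group n)" by (simp add: matrix_rep_def)
  with True show ?thesis
    by (simp add: irreducible_rep_def irreducible_hom_def linear_subspace_iff)
qed (simp add: irreducible_rep_def)

text \<open>The values are invertible as soon as they multiply correctly, since \<open>\<rho> (g\<^sup>-\<^sup>1)\<close> inverts \<open>\<rho> g\<close>.\<close>

lemma hom_GL_iff:
  assumes "Group.group G"
  shows "\<rho> \<in> hom G (general_linear_group n) \<longleftrightarrow>
    (\<forall>g\<in>carrier G. \<rho> g \<in> carrier_mat n n) \<and> \<rho> \<one>\<^bsub>G\<^esub> = 1\<^sub>m n \<and>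
    (\<forall>g\<in>carrier G. \<forall>h\<in>carrier G. \<rho> (g \<otimes>\<^bsub>G\<^esub> h) = \<rho> g * \<rho> h)" (is "?L = ?R")
proof -
  interpret G: Group.group G by fact
  interpret R: ring "ring_mat TYPE(complex) n ()" by (rule ring_mat)
  interpret GL: Group.group "general_linear_group n"
    unfolding general_linear_group_def by (rule R.units_group)
  show ?thesis
  proof
    assume L: ?L
    interpret h: group_hom G "general_linear_group n" \<rho>
      using L by unfold_locales
    show ?R
      using h.hom_closed h.hom_one h.hom_mult
      by (auto simp: general_linear_group_def units_of_def Units_def ring_mat_simps)
  next
    assume R: ?R
    have "\<rho> g \<in> Units (ring_mat TYPE(complex) n ())" if g: "g \<in> carrier G" for g
    proof -
      have "\<rho> (inv\<^bsub>G\<^esub> g) * \<rho> g = 1\<^sub>m n" "\<rho> g * \<rho> (inv\<^bsub>G\<^esub> g) = 1\<^sub>m n"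
        using R g G.inv_closed[OF g] G.l_inv[OF g] G.r_inv[OF g] by metis+
      then show ?thesis
        using R g G.inv_closed[OF g] by (auto simp: Units_def ring_mat_simps)
    qed
    then show ?L
      using R by (auto simp: hom_def general_linear_group_def units_of_def ring_mat_simps)
  qed
qed

lemma mult_mat_entry:
  assumes "A \<in> carrier_mat m n" "B \<in> carrier_mat n k" "i < m" "j < k"
  shows "(A * B) $$ (i, j) = (\<Sum>l<n. A $$ (i, l) * B $$ (l, j))"
  using assms by (auto simp: scalar_prod_def lessThan_atLeast0 intro!: sum.cong)

lemma mult_mat_unit_vec:
  fixes M :: "complex mat"
  assumes "M \<in> carrier_mat m n" "j < n"
  shows "M *\<^sub>v unit_vec n j = col M j"
proof (rule eq_vecI)
  fix i assume "i < dim_vec (col M j)"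
  then have i: "i < m" using assms by simp
  then have "(M *\<^sub>v unit_vec n j) $ i = row M i \<bullet> unit_vec n j" using assms by simp
  also have "\<dots> = col M j $ i" using assms i by simp
  finally show "(M *\<^sub>v unit_vec n j) $ i = col M j $ i" .
qed (use assms in auto)

lemma mtrace_mult_comm:
  assumes "A \<in> carrier_mat m n" "B \<in> carrier_mat n m"
  shows "mtrace m (A * B) = mtrace n (B * A)"
proof -
  have "mtrace m (A * B) = (\<Sum>i<m. \<Sum>l<n. A $$ (i, l) * B $$ (l, i))"
    unfolding mtrace_def by (intro sum.cong refl mult_mat_entry[OF assms]) auto
  also have "\<dots> = (\<Sum>l<n. \<Sum>i<m. B $$ (l, i) * A $$ (i, l))"
    by (subst sum.swap) (simp add: mult.commute)
  also have "\<dots> = mtrace n (B * A)"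
    unfolding mtrace_def by (intro sum.cong refl mult_mat_entry[OF assms(2,1), symmetric]) auto
  finally show ?thesis .
qed

lemma linear_subspace_kernel:
  assumes M: "M \<in> carrier_mat m n"
  shows "linear_subspace n {v \<in> carrier_vec n. M *\<^sub>v v = 0\<^sub>v m}"
  using M unfolding linear_subspace_def
  by (auto simp: mult_add_distrib_mat_vec mult_mat_vec)

lemma linear_subspace_image:
  assumes M: "M \<in> carrier_mat m n"
  shows "linear_subspace m ((\<lambda>v. M *\<^sub>v v) ` carrier_vec n)"
proof -
  have 0: "0\<^sub>v m = M *\<^sub>v 0\<^sub>v n" using M by auto
  have add: "M *\<^sub>v v + M *\<^sub>v w = M *\<^sub>v (v + w)"
    if "v \<in> carrier_vec n" "w \<in> carrier_vec n" for v w
    using that M by (simp add: mult_add_distrib_mat_vec)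
  have smult: "c \<cdot>\<^sub>v (M *\<^sub>v v) = M *\<^sub>v (c \<cdot>\<^sub>v v)" if "v \<in> carrier_vec n" for c v
    using that M by (simp add: mult_mat_vec)
  show ?thesis
    unfolding linear_subspace_def
  proof (intro conjI ballI allI)
    show "(\<lambda>v. M *\<^sub>v v) ` carrier_vec n \<subseteq> carrier_vec m" using M by auto
    show "0\<^sub>v m \<in> (\<lambda>v. M *\<^sub>v v) ` carrier_vec n" by (intro image_eqI[where x = "0\<^sub>v n"] 0) simp
  next
    fix x y assume "x \<in> (\<lambda>v. M *\<^sub>v v) ` carrier_vec n" "y \<in> (\<lambda>v. M *\<^sub>v v) ` carrier_vec n"
    then obtain v w where "x = M *\<^sub>v v" "y = M *\<^sub>v w" and vw: "v \<in> carrier_vec n" "w \<in> carrier_vec n"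
      by auto
    then have "x + y = M *\<^sub>v (v + w)" by (simp only: add)
    then show "x + y \<in> (\<lambda>v. M *\<^sub>v v) ` carrier_vec n"
      by (rule image_eqI) (simp add: vw)
  next
    fix c x assume "x \<in> (\<lambda>v. M *\<^sub>v v) ` carrier_vec n"
    then obtain v where "x = M *\<^sub>v v" and v: "v \<in> carrier_vec n" by auto
    then have "c \<cdot>\<^sub>v x = M *\<^sub>v (c \<cdot>\<^sub>v v)" by (simp only: smult)
    then show "c \<cdot>\<^sub>v x \<in> (\<lambda>v. M *\<^sub>v v) ` carrier_vec n"
      by (rule image_eqI) (simp add: v)
  qed
qed

lemma mat_eq_zeroI:
  fixes M :: "complex mat"
  assumes M: "M \<in> carrier_mat m n" and 0: "\<And>v. v \<in> carrier_vec n \<Longrightarrow> M *\<^sub>v v = 0\<^sub>v m"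
  shows "M = 0\<^sub>m m n"
proof (rule eq_matI)
  fix i j assume "i < dim_row (0\<^sub>m m n)" "j < dim_col (0\<^sub>m m n)"
  then have ij: "i < m" "j < n" by auto
  have "M $$ (i, j) = col M j $ i" using ij M by auto
  also have "col M j = M *\<^sub>v unit_vec n j" using ij M by (simp add: mult_mat_unit_vec)
  also have "\<dots> $ i = 0" using 0[of "unit_vec n j"] ij by simp
  finally show "M $$ (i, j) = 0\<^sub>m m n $$ (i, j)" using ij by simp
qed (use M in auto)

section \<open>Schur's lemma and orthogonality\<close>

text \<open>The kernel and the image of an intertwiner are invariant, so a nonzero intertwiner \<open>M\<close> between
irreducible representations is bijective. Its inverse \<open>B\<close> has preimages of the unit vectors as columns,
and \<open>\<sigma> g = M * \<rho> g * B\<close> has the trace of \<open>\<rho> g\<close> because traces of rectangular products are cyclic.\<close>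

lemma schur_intertwiner_trace_eq:
  assumes G: "Group.group G"
    and \<rho>: "irreducible_hom G n \<rho>" and \<sigma>: "irreducible_hom G m \<sigma>"
    and M: "M \<in> carrier_mat m n" and comm: "\<And>g. g \<in> carrier G \<Longrightarrow> \<sigma> g * M = M * \<rho> g"
    and nz: "M \<noteq> 0\<^sub>m m n" and g: "g \<in> carrier G"
  shows "mtrace n (\<rho> g) = mtrace m (\<sigma> g)"
proof -
  have \<rho>h: "\<rho> \<in> hom G (general_linear_group n)" and \<sigma>h: "\<sigma> \<in> hom G (general_linear_group m)"
    using \<rho> \<sigma> by (auto simp: irreducible_hom_def)
  have \<rho>c: "\<rho> h \<in> carrier_mat n n" and \<sigma>c: "\<sigma> h \<in> carrier_mat m m" if "h \<in> carrier G" for h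
    using \<rho>h \<sigma>h that by (auto simp: hom_GL_iff[OF G])
  have swap: "\<sigma> h *\<^sub>v (M *\<^sub>v v) = M *\<^sub>v (\<rho> h *\<^sub>v v)" if "h \<in> carrier G" "v \<in> carrier_vec n" for h v
    using that \<rho>c[of h] \<sigma>c[of h] M comm[of h] by (metis assoc_mult_mat_vec)
  define K where "K = {v \<in> carrier_vec n. M *\<^sub>v v = 0\<^sub>v m}"
  define I where "I = (\<lambda>v. M *\<^sub>v v) ` carrier_vec n"
  have "\<forall>h\<in>carrier G. \<forall>w\<in>K. \<rho> h *\<^sub>v w \<in> K"
  proof (intro ballI)
    fix h w assume h: "h \<in> carrier G" and w: "w \<in> K"
    have "M *\<^sub>v (\<rho> h *\<^sub>v w) = \<sigma> h *\<^sub>v 0\<^sub>v m" using swap[OF h, of w] w by (simp add: K_def)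
    also have "\<dots> = 0\<^sub>v m" using \<sigma>c[OF h] by auto
    finally show "\<rho> h *\<^sub>v w \<in> K" using w \<rho>c[OF h] by (auto simp: K_def)
  qed
  then have "K = {0\<^sub>v n} \<or> K = carrier_vec n"
    using \<rho> linear_subspace_kernel[OF M] unfolding irreducible_hom_def K_def by blast
  moreover have "K \<noteq> carrier_vec n"
    using nz mat_eq_zeroI[OF M] by (auto simp: K_def)
  ultimately have K: "K = {0\<^sub>v n}" by blast
  have "\<forall>h\<in>carrier G. \<forall>w\<in>I. \<sigma> h *\<^sub>v w \<in> I"
    using swap \<rho>c by (auto simp: I_def image_iff) (metis mult_mat_vec_carrier)
  then have "I = {0\<^sub>v m} \<or> I = carrier_vec m"
    using \<sigma> linear_subspace_image[OF M] unfolding irreducible_hom_def I_def by blast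
  moreover have "I \<noteq> {0\<^sub>v m}"
    using nz mat_eq_zeroI[OF M] by (auto simp: I_def)
  ultimately have I: "I = carrier_vec m" by blast
  have "\<forall>j\<in>{..<m}. \<exists>v. v \<in> carrier_vec n \<and> M *\<^sub>v v = unit_vec m j"
    using I unfolding I_def by (metis imageE unit_vec_carrier)
  then obtain b where b: "\<And>j. j < m \<Longrightarrow> b j \<in> carrier_vec n \<and> M *\<^sub>v b j = unit_vec m j"
    by (metis lessThan_iff)
  define B where "B = Matrix.mat n m (\<lambda>(i, j). b j $ i)"
  have B: "B \<in> carrier_mat n m" by (simp add: B_def)
  have colB: "col B j = b j" if "j < m" for j
    using b[OF that] that by (auto simp: B_def intro!: eq_vecI)
  have MB: "M * B = 1\<^sub>m m"
  proof (rule mat_col_eqI)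
    fix j assume "j < dim_col (1\<^sub>m m)"
    then have j: "j < m" by simp
    have "col (M * B) j = M *\<^sub>v b j" using j col_mult2[OF M B j] colB by simp
    also have "\<dots> = col (1\<^sub>m m) j" using b[OF j] j by simp
    finally show "col (M * B) j = col (1\<^sub>m m) j" .
  qed (use M B in auto)
  have BMv: "(B * M) *\<^sub>v v = v" if v: "v \<in> carrier_vec n" for v
  proof -
    have BMv: "B *\<^sub>v (M *\<^sub>v v) \<in> carrier_vec n" using B M v by auto
    have "M *\<^sub>v (B *\<^sub>v (M *\<^sub>v v)) = (M * B) *\<^sub>v (M *\<^sub>v v)"
      using M B v by (simp add: assoc_mult_mat_vec)
    also have "\<dots> = M *\<^sub>v v" using MB M v by simp
    finally have "M *\<^sub>v (B *\<^sub>v (M *\<^sub>v v) - v) = 0\<^sub>v m"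
      using M v BMv by (simp add: mult_minus_distrib_mat_vec)
    then have "B *\<^sub>v (M *\<^sub>v v) - v \<in> K" using BMv v by (auto simp: K_def)
    then have "B *\<^sub>v (M *\<^sub>v v) - v = 0\<^sub>v n" using K by blast
    then have "(B *\<^sub>v (M *\<^sub>v v) - v) $ i = 0" if "i < n" for i
      using that by simp
    then have "B *\<^sub>v (M *\<^sub>v v) = v"
      using BMv v B M by (intro eq_vecI) auto
    then show ?thesis using B M v by (simp add: assoc_mult_mat_vec)
  qed
  have BM: "B * M = 1\<^sub>m n"
  proof (rule mat_col_eqI)
    fix j assume "j < dim_col (1\<^sub>m n)"
    then have j: "j < n" by simp
    have "col (B * M) j = (B * M) *\<^sub>v unit_vec n j"
      using j B M by (intro mult_mat_unit_vec[symmetric]) auto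
    also have "\<dots> = col (1\<^sub>m n) j" using BMv[of "unit_vec n j"] j by simp
    finally show "col (B * M) j = col (1\<^sub>m n) j" .
  qed (use M B in auto)
  have \<rho>g: "\<rho> g \<in> carrier_mat n n" and \<sigma>g: "\<sigma> g \<in> carrier_mat m m" using \<rho>c \<sigma>c g by auto
  have "\<sigma> g = \<sigma> g * (M * B)" using MB \<sigma>g by simp
  also have "\<dots> = M * \<rho> g * B" using comm[OF g] assoc_mult_mat[OF \<sigma>g M B] by simp
  also have "\<dots> = M * (\<rho> g * B)" using assoc_mult_mat[OF M \<rho>g B] by simp
  finally have "mtrace m (\<sigma> g) = mtrace n (\<rho> g * B * M)"
    using mtrace_mult_comm[OF M, of "\<rho> g * B"] \<rho>g B by simp
  also have "\<rho> g * B * M = \<rho> g" using assoc_mult_mat[OF \<rho>g B M] BM \<rho>g by simp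
  finally show ?thesis by simp
qed

text \<open>A complex matrix has an eigenvalue \<open>c\<close>. Its eigenspace is nonzero, and invariant if the matrix commutes
with the representation, so it is the whole space.\<close>

lemma schur_scalar:
  assumes G: "Group.group G" and \<rho>: "irreducible_hom G n \<rho>"
    and M: "M \<in> carrier_mat n n" and comm: "\<And>g. g \<in> carrier G \<Longrightarrow> \<rho> g * M = M * \<rho> g"
  obtains c where "M = c \<cdot>\<^sub>m 1\<^sub>m n"
proof -
  have \<rho>h: "\<rho> \<in> hom G (general_linear_group n)" and n: "n > 0"
    using \<rho> by (auto simp: irreducible_hom_def)
  have \<rho>c: "\<rho> h \<in> carrier_mat n n" if "h \<in> carrier G" for h
    using \<rho>h that by (auto simp: hom_GL_iff[OF G])
  obtain c v where v: "v \<in> carrier_vec n" "v \<noteq> 0\<^sub>v n" "M *\<^sub>v v = c \<cdot>\<^sub>v v"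
    using spectrum_non_empty[OF M n] M
    by (auto simp: spectrum_def eigenvalue_def eigenvector_def)
  define D where "D = M - c \<cdot>\<^sub>m 1\<^sub>m n"
  have D: "D \<in> carrier_mat n n" using M by (auto simp: D_def)
  have Dv: "D *\<^sub>v w = M *\<^sub>v w - c \<cdot>\<^sub>v w" if "w \<in> carrier_vec n" for w
    using that M by (auto simp: D_def minus_mult_distrib_mat_vec)
  define K where "K = {w \<in> carrier_vec n. D *\<^sub>v w = 0\<^sub>v n}"
  have "\<forall>g\<in>carrier G. \<forall>w\<in>K. \<rho> g *\<^sub>v w \<in> K"
  proof (intro ballI)
    fix h w assume h: "h \<in> carrier G" and w: "w \<in> K"
    have wc: "w \<in> carrier_vec n" using w by (simp add: K_def)
    have "\<rho> h * (c \<cdot>\<^sub>m 1\<^sub>m n) = c \<cdot>\<^sub>m \<rho> h"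
      using \<rho>c[OF h] mult_smult_distrib[of "\<rho> h" n n "1\<^sub>m n" n c] by simp
    moreover have "c \<cdot>\<^sub>m 1\<^sub>m n * \<rho> h = c \<cdot>\<^sub>m \<rho> h"
      using \<rho>c[OF h] mult_smult_assoc_mat[of "1\<^sub>m n" n n "\<rho> h" n c] by simp
    ultimately have "\<rho> h * D = D * \<rho> h"
      unfolding D_def using comm[OF h] \<rho>c[OF h] M
      by (simp add: mult_minus_distrib_mat minus_mult_distrib_mat)
    then have "D *\<^sub>v (\<rho> h *\<^sub>v w) = \<rho> h *\<^sub>v (D *\<^sub>v w)"
      using D \<rho>c[OF h] wc by (metis assoc_mult_mat_vec)
    also have "\<dots> = 0\<^sub>v n" using w \<rho>c[OF h] by (auto simp: K_def)
    finally show "\<rho> h *\<^sub>v w \<in> K" using wc \<rho>c[OF h] by (auto simp: K_def)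
  qed
  then have "K = {0\<^sub>v n} \<or> K = carrier_vec n"
    using \<rho> linear_subspace_kernel[OF D] unfolding irreducible_hom_def K_def by blast
  moreover have "v \<in> K" using v by (simp add: K_def Dv)
  ultimately have "K = carrier_vec n" using v by blast
  then have "D = 0\<^sub>m n n" using mat_eq_zeroI[OF D] by (auto simp: K_def)
  have "M = c \<cdot>\<^sub>m 1\<^sub>m n"
  proof (rule eq_matI)
    fix i j assume "i < dim_row (c \<cdot>\<^sub>m 1\<^sub>m n)" "j < dim_col (c \<cdot>\<^sub>m 1\<^sub>m n)"
    then have ij: "i < n" "j < n" by auto
    have "D $$ (i, j) = 0" using \<open>D = 0\<^sub>m n n\<close> ij by simp
    then show "M $$ (i, j) = (c \<cdot>\<^sub>m 1\<^sub>m n) $$ (i, j)"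
      using ij M by (simp add: D_def)
  qed (use M in auto)
  then show ?thesis by (rule that)
qed

text \<open>Up to the factor \<open>|G|\<close>, the average of \<open>A\<close> over the action of \<open>G\<close> on rectangular matrices.\<close>

definition intertwiner_sum ::
  "('a, 'm) monoid_scheme \<Rightarrow> nat \<Rightarrow> ('a \<Rightarrow> complex mat) \<Rightarrow> nat \<Rightarrow> ('a \<Rightarrow> complex mat) \<Rightarrow> complex mat \<Rightarrow> complex mat" where
  "intertwiner_sum G m \<sigma> n \<rho> A =
     Matrix.mat m n (\<lambda>(i, j). \<Sum>g\<in>carrier G. (\<sigma> g * A * \<rho> (inv\<^bsub>G\<^esub> g)) $$ (i, j))"

lemma intertwiner_sum_commutes:
  assumes G: "Group.group G"
    and \<rho>: "\<rho> \<in> hom G (general_linear_group n)" and \<sigma>: "\<sigma> \<in> hom G (general_linear_group m)"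
    and A: "A \<in> carrier_mat m n" and h: "h \<in> carrier G"
  shows "\<sigma> h * intertwiner_sum G m \<sigma> n \<rho> A = intertwiner_sum G m \<sigma> n \<rho> A * \<rho> h"
proof -
  interpret G: Group.group G by fact
  have \<rho>c: "\<rho> g \<in> carrier_mat n n" and \<sigma>c: "\<sigma> g \<in> carrier_mat m m" if "g \<in> carrier G" for g
    using \<rho> \<sigma> that by (auto simp: hom_GL_iff[OF G])
  have \<rho>m: "\<rho> (g \<otimes>\<^bsub>G\<^esub> g') = \<rho> g * \<rho> g'" and \<sigma>m: "\<sigma> (g \<otimes>\<^bsub>G\<^esub> g') = \<sigma> g * \<sigma> g'"
    if "g \<in> carrier G" "g' \<in> carrier G" for g g'
    using \<rho> \<sigma> that by (auto simp: hom_GL_iff[OF G])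
  let ?S = "intertwiner_sum G m \<sigma> n \<rho> A"
  define F where "F g = \<sigma> g * A * \<rho> (inv\<^bsub>G\<^esub> g)" for g
  have F: "F g \<in> carrier_mat m n" if "g \<in> carrier G" for g
    using \<rho>c[of "inv\<^bsub>G\<^esub> g"] \<sigma>c[OF that] A that by (auto simp: F_def)
  have S: "?S \<in> carrier_mat m n" by (simp add: intertwiner_sum_def)
  have Sij: "?S $$ (i, j) = (\<Sum>g\<in>carrier G. F g $$ (i, j))" if "i < m" "j < n" for i j
    using that by (simp add: intertwiner_sum_def F_def)
  \<comment> \<open>Translating the summation index by \<open>h\<close> moves \<open>\<sigma> h\<close> on the left to \<open>\<rho> h\<close> on the right.\<close>
  have shift: "\<sigma> h * F g = F (h \<otimes>\<^bsub>G\<^esub> g) * \<rho> h" if g: "g \<in> carrier G" for g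
  proof -
    have 1: "\<rho> (inv\<^bsub>G\<^esub> (h \<otimes>\<^bsub>G\<^esub> g)) * \<rho> h = \<rho> (inv\<^bsub>G\<^esub> g)"
      using g h by (simp add: \<rho>m[symmetric] G.inv_mult_group G.m_assoc)
    have c: "\<rho> (inv\<^bsub>G\<^esub> (h \<otimes>\<^bsub>G\<^esub> g)) \<in> carrier_mat n n" "\<rho> (inv\<^bsub>G\<^esub> g) \<in> carrier_mat n n"
      "\<rho> h \<in> carrier_mat n n" "\<sigma> h \<in> carrier_mat m m" "\<sigma> g \<in> carrier_mat m m"
      using g h \<rho>c \<sigma>c by auto
    have "F (h \<otimes>\<^bsub>G\<^esub> g) * \<rho> h = \<sigma> h * \<sigma> g * A * (\<rho> (inv\<^bsub>G\<^esub> (h \<otimes>\<^bsub>G\<^esub> g)) * \<rho> h)"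
      unfolding F_def \<sigma>m[OF h g] using c A
      by (intro assoc_mult_mat[of _ m n _ n _ n]) auto
    also have "\<dots> = \<sigma> h * (\<sigma> g * A) * \<rho> (inv\<^bsub>G\<^esub> g)"
      using c A 1 by (simp add: assoc_mult_mat[of _ m m _ m _ n])
    also have "\<dots> = \<sigma> h * F g"
      unfolding F_def using c A by (intro assoc_mult_mat[of _ m m _ n _ n]) auto
    finally show ?thesis by simp
  qed
  show ?thesis
  proof (rule eq_matI)
    fix i j assume "i < dim_row (?S * \<rho> h)" "j < dim_col (?S * \<rho> h)"
    then have ij: "i < m" "j < n" using S \<rho>c[OF h] by auto
    have "(\<sigma> h * ?S) $$ (i, j) = (\<Sum>l<m. \<sigma> h $$ (i, l) * (\<Sum>g\<in>carrier G. F g $$ (l, j)))"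
      using mult_mat_entry[OF \<sigma>c[OF h] S ij] Sij ij by (auto intro!: sum.cong)
    also have "\<dots> = (\<Sum>g\<in>carrier G. \<Sum>l<m. \<sigma> h $$ (i, l) * F g $$ (l, j))"
      by (simp add: sum_distrib_left sum.swap[of _ "carrier G"])
    also have "\<dots> = (\<Sum>g\<in>carrier G. (\<sigma> h * F g) $$ (i, j))"
      using mult_mat_entry[OF \<sigma>c[OF h] F ij] by (auto intro!: sum.cong)
    also have "\<dots> = (\<Sum>g\<in>carrier G. (F (h \<otimes>\<^bsub>G\<^esub> g) * \<rho> h) $$ (i, j))"
      using shift by (auto intro!: sum.cong)
    also have "\<dots> = (\<Sum>g\<in>carrier G. (F g * \<rho> h) $$ (i, j))"
      by (rule sum.reindex_bij_witness[of _ "\<lambda>g. inv\<^bsub>G\<^esub> h \<otimes>\<^bsub>G\<^esub> g" "\<lambda>g. h \<otimes>\<^bsub>G\<^esub> g"])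
        (use h in \<open>auto simp: G.m_assoc[symmetric]\<close>)
    also have "\<dots> = (\<Sum>g\<in>carrier G. \<Sum>l<n. F g $$ (i, l) * \<rho> h $$ (l, j))"
      using mult_mat_entry[OF F \<rho>c[OF h] ij] by (auto intro!: sum.cong)
    also have "\<dots> = (\<Sum>l<n. (\<Sum>g\<in>carrier G. F g $$ (i, l)) * \<rho> h $$ (l, j))"
      by (simp add: sum_distrib_right sum.swap[of _ "carrier G"])
    also have "\<dots> = (?S * \<rho> h) $$ (i, j)"
      using mult_mat_entry[OF S \<rho>c[OF h] ij] Sij ij by (auto intro!: sum.cong)
    finally show "(\<sigma> h * ?S) $$ (i, j) = (?S * \<rho> h) $$ (i, j)" .
  qed (use S \<rho>c[OF h] \<sigma>c[OF h] in auto)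
qed

text \<open>For a matrix unit in the place of \<open>A\<close> the entries are sums of products of two matrix coefficients, which
is how Schur's lemma yields orthogonality relations.\<close>

lemma intertwiner_sum_unit_entry:
  assumes G: "Group.group G"
    and \<rho>: "\<rho> \<in> hom G (general_linear_group n)" and \<sigma>: "\<sigma> \<in> hom G (general_linear_group m)"
    and ij: "i < m" "j < n" and kl: "k < m" "l < n"
  shows "intertwiner_sum G m \<sigma> n \<rho> (Matrix.mat m n (\<lambda>p. if p = (k, l) then 1 else 0)) $$ (i, j) =
    (\<Sum>g\<in>carrier G. \<sigma> g $$ (i, k) * \<rho> (inv\<^bsub>G\<^esub> g) $$ (l, j))"
proof -
  interpret G: Group.group G by fact
  let ?E = "Matrix.mat m n (\<lambda>p. if p = (k, l) then 1 else 0) :: complex mat"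
  have "(\<sigma> g * ?E * \<rho> (inv\<^bsub>G\<^esub> g)) $$ (i, j) = \<sigma> g $$ (i, k) * \<rho> (inv\<^bsub>G\<^esub> g) $$ (l, j)"
    if g: "g \<in> carrier G" for g
  proof -
    have c: "\<rho> (inv\<^bsub>G\<^esub> g) \<in> carrier_mat n n" "\<sigma> g \<in> carrier_mat m m"
      using g \<rho> \<sigma> by (auto simp: hom_GL_iff[OF G])
    have E: "?E \<in> carrier_mat m n" by simp
    have "(\<sigma> g * ?E) $$ (i, b) = (if b = l then \<sigma> g $$ (i, k) else 0)" if "b < n" for b
    proof -
      have "(\<sigma> g * ?E) $$ (i, b) = (\<Sum>a<m. \<sigma> g $$ (i, a) * ?E $$ (a, b))"
        by (rule mult_mat_entry[OF c(2) E ij(1) that])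
      also have "\<dots> = (\<Sum>a<m. if a = k then (if b = l then \<sigma> g $$ (i, k) else 0) else 0)"
        using that by (intro sum.cong) auto
      also have "\<dots> = (if b = l then \<sigma> g $$ (i, k) else 0)" using kl by simp
      finally show ?thesis .
    qed
    then have 1: "(\<Sum>b<n. (\<sigma> g * ?E) $$ (i, b) * \<rho> (inv\<^bsub>G\<^esub> g) $$ (b, j)) =
        (\<Sum>b<n. if b = l then \<sigma> g $$ (i, k) * \<rho> (inv\<^bsub>G\<^esub> g) $$ (l, j) else 0)"
      by (intro sum.cong) auto
    have "(\<sigma> g * ?E * \<rho> (inv\<^bsub>G\<^esub> g)) $$ (i, j) =
        (\<Sum>b<n. (\<sigma> g * ?E) $$ (i, b) * \<rho> (inv\<^bsub>G\<^esub> g) $$ (b, j))"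
      using mult_carrier_mat[OF c(2) E] c(1) ij by (intro mult_mat_entry)
    also have "\<dots> = \<sigma> g $$ (i, k) * \<rho> (inv\<^bsub>G\<^esub> g) $$ (l, j)"
      unfolding 1 using kl by simp
    finally show ?thesis .
  qed
  then show ?thesis using ij by (simp add: intertwiner_sum_def)
qed

lemma schur_orthogonality_distinct:
  assumes G: "Group.group G"
    and \<rho>: "irreducible_hom G n \<rho>" and \<sigma>: "irreducible_hom G m \<sigma>"
    and ne: "h \<in> carrier G" "mtrace n (\<rho> h) \<noteq> mtrace m (\<sigma> h)"
    and "i < m" "j < n" "k < m" "l < n"
  shows "(\<Sum>g\<in>carrier G. \<sigma> g $$ (i, k) * \<rho> (inv\<^bsub>G\<^esub> g) $$ (l, j)) = 0"
proof -
  have hom: "\<rho> \<in> hom G (general_linear_group n)" "\<sigma> \<in> hom G (general_linear_group m)"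
    using \<rho> \<sigma> by (auto simp: irreducible_hom_def)
  let ?E = "Matrix.mat m n (\<lambda>p. if p = (k, l) then 1 else 0) :: complex mat"
  have E: "?E \<in> carrier_mat m n" by simp
  have "intertwiner_sum G m \<sigma> n \<rho> ?E = 0\<^sub>m m n"
    using schur_intertwiner_trace_eq[OF G \<rho> \<sigma> _ intertwiner_sum_commutes[OF G hom E] _ ne(1)] ne(2)
    by (auto simp: intertwiner_sum_def)
  then show ?thesis
    using intertwiner_sum_unit_entry[OF G hom, of i j k l] assms(6-) by simp
qed

lemma mtrace_smult_one: "mtrace n (c \<cdot>\<^sub>m 1\<^sub>m n) = c * of_nat n"
  by (simp add: mtrace_def)

lemma schur_orthogonality_same:
  assumes G: "Group.group G" and \<rho>: "irreducible_hom G n \<rho>"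
    and ij: "i < n" "j < n" and kl: "k < n" "l < n"
  shows "(\<Sum>g\<in>carrier G. \<rho> g $$ (i, k) * \<rho> (inv\<^bsub>G\<^esub> g) $$ (l, j)) =
    (if i = j \<and> k = l then of_nat (order G) / of_nat n else 0)"
proof -
  interpret G: Group.group G by fact
  have hom: "\<rho> \<in> hom G (general_linear_group n)" and n: "n > 0"
    using \<rho> by (auto simp: irreducible_hom_def)
  let ?E = "Matrix.mat n n (\<lambda>p. if p = (k, l) then 1 else 0) :: complex mat"
  have E: "?E \<in> carrier_mat n n" by simp
  let ?S = "intertwiner_sum G n \<rho> n \<rho> ?E"
  have S: "?S \<in> carrier_mat n n" by (simp add: intertwiner_sum_def)
  obtain c where c: "?S = c \<cdot>\<^sub>m 1\<^sub>m n"
    by (rule schur_scalar[OF G \<rho> S intertwiner_sum_commutes[OF G hom hom E]])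
  \<comment> \<open>The scalar is found by comparing traces: conjugates of \<open>?E\<close> have the trace of \<open>?E\<close>.\<close>
  have "c * of_nat n = mtrace n ?S" by (simp add: c mtrace_smult_one)
  also have "\<dots> = (\<Sum>i<n. \<Sum>g\<in>carrier G. \<rho> g $$ (i, k) * \<rho> (inv\<^bsub>G\<^esub> g) $$ (l, i))"
    unfolding mtrace_def
    by (intro sum.cong refl intertwiner_sum_unit_entry[OF G hom hom]) (use kl in auto)
  also have "\<dots> = (\<Sum>g\<in>carrier G. \<Sum>i<n. \<rho> (inv\<^bsub>G\<^esub> g) $$ (l, i) * \<rho> g $$ (i, k))"
    by (simp add: sum.swap[of _ "carrier G"] mult.commute)
  also have "\<dots> = (\<Sum>g\<in>carrier G. (\<rho> (inv\<^bsub>G\<^esub> g) * \<rho> g) $$ (l, k))"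
    using hom kl by (intro sum.cong refl mult_mat_entry[symmetric]) (auto simp: hom_GL_iff[OF G])
  also have "\<dots> = (\<Sum>g\<in>carrier G. if k = l then 1 else 0)"
  proof (intro sum.cong refl)
    fix g assume g: "g \<in> carrier G"
    have "\<rho> (inv\<^bsub>G\<^esub> g) * \<rho> g = 1\<^sub>m n"
      using hom g G.l_inv[OF g] G.inv_closed[OF g] unfolding hom_GL_iff[OF G] by metis
    then show "(\<rho> (inv\<^bsub>G\<^esub> g) * \<rho> g) $$ (l, k) = (if k = l then 1 else 0)" using kl by simp
  qed
  also have "\<dots> = (if k = l then of_nat (order G) else 0)" by (simp add: order_def)
  finally have "c = (if k = l then of_nat (order G) / of_nat n else 0)"
    using n by (auto simp: field_simps)
  then show ?thesis
    unfolding intertwiner_sum_unit_entry[OF G hom hom ij kl, symmetric] c using ij by simp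
qed

text \<open>Obtained by tracing the first of the two matrix coefficients. The second one stays a coefficient, so that
whole matrices such as \<open>\<Sum>g. \<eta> g \<cdot> \<rho> (g\<^sup>-\<^sup>1)\<close> can be evaluated.\<close>

lemma trace_orthogonality:
  assumes G: "Group.group G"
    and \<rho>: "irreducible_hom G n \<rho>" and \<sigma>: "irreducible_hom G m \<sigma>" and lj: "l < n" "j < n"
  shows "(\<Sum>g\<in>carrier G. mtrace m (\<sigma> g) * \<rho> (inv\<^bsub>G\<^esub> g) $$ (l, j)) =
    (if l = j \<and> (\<forall>g\<in>carrier G. mtrace m (\<sigma> g) = mtrace n (\<rho> g))
     then of_nat (order G) / of_nat n else 0)"
proof (cases "\<forall>g\<in>carrier G. mtrace m (\<sigma> g) = mtrace n (\<rho> g)")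
  case True
  then have "(\<Sum>g\<in>carrier G. mtrace m (\<sigma> g) * \<rho> (inv\<^bsub>G\<^esub> g) $$ (l, j)) =
      (\<Sum>g\<in>carrier G. mtrace n (\<rho> g) * \<rho> (inv\<^bsub>G\<^esub> g) $$ (l, j))"
    by (intro sum.cong) auto
  also have "\<dots> = (\<Sum>i<n. \<Sum>g\<in>carrier G. \<rho> g $$ (i, i) * \<rho> (inv\<^bsub>G\<^esub> g) $$ (l, j))"
    by (simp add: mtrace_def sum_distrib_right sum.swap[of _ "carrier G"])
  also have "\<dots> = (\<Sum>i<n. if i = j then (if l = j then of_nat (order G) / of_nat n else 0) else 0)"
    using schur_orthogonality_same[OF G \<rho>] lj by (intro sum.cong) auto
  also have "\<dots> = (if l = j then of_nat (order G) / of_nat n else 0)" using lj by simp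
  finally show ?thesis using True by simp
next
  case False
  then obtain h where h: "h \<in> carrier G" "mtrace n (\<rho> h) \<noteq> mtrace m (\<sigma> h)" by metis
  have "(\<Sum>g\<in>carrier G. mtrace m (\<sigma> g) * \<rho> (inv\<^bsub>G\<^esub> g) $$ (l, j)) =
      (\<Sum>i<m. \<Sum>g\<in>carrier G. \<sigma> g $$ (i, i) * \<rho> (inv\<^bsub>G\<^esub> g) $$ (l, j))"
    by (simp add: mtrace_def sum_distrib_right sum.swap[of _ "carrier G"])
  also have "\<dots> = 0"
    using schur_orthogonality_distinct[OF G \<rho> \<sigma> h] lj by simp
  finally show ?thesis using False by auto
qed

section \<open>Characters as sums of irreducible characters\<close>

text \<open>The first matrix is the identity with its column \<open>i\<close> replaced by \<open>u\<close>. The inverse has the same shape.\<close>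

lemma shear_inverse:
  fixes u :: "nat \<Rightarrow> complex"
  assumes i: "i < n" and u: "u i \<noteq> 0"
  defines "w \<equiv> \<lambda>a. if a = i then 1 / u i else - u a / u i"
  shows "Matrix.mat n n (\<lambda>(a, b). if b = i then u a else if a = b then 1 else 0) *
         Matrix.mat n n (\<lambda>(a, b). if b = i then w a else if a = b then 1 else 0) = 1\<^sub>m n"
    (is "?E * ?F = _")
proof (rule eq_matI)
  fix a b assume "a < dim_row (1\<^sub>m n)" "b < dim_col (1\<^sub>m n)"
  then have ab: "a < n" "b < n" by auto
  have "(?E * ?F) $$ (a, b) = (\<Sum>l<n. ?E $$ (a, l) * ?F $$ (l, b))"
    by (rule mult_mat_entry) (use ab in auto)
  also have "\<dots> = (\<Sum>l<n. (if l = i then u a else if a = l then 1 else 0) *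
                       (if b = i then w l else if l = b then 1 else 0))"
    using ab by (intro sum.cong) auto
  also have "\<dots> = (if a = b then 1 else 0)"
  proof (cases "b = i")
    case False
    then have "(\<Sum>l<n. (if l = i then u a else if a = l then 1 else 0) *
                       (if b = i then w l else if l = b then 1 else 0)) =
        (\<Sum>l<n. if l = b then (if a = b then 1 else 0) else 0)"
      by (intro sum.cong) auto
    then show ?thesis using ab by simp
  next
    case True
    have "(\<Sum>l<n. (if l = i then u a else if a = l then 1 else 0) * w l) =
        (\<Sum>l<n. (if l = i then u a * w i else 0) + (if l = a then (if a = i then 0 else w a) else 0))"
      by (intro sum.cong) auto
    also have "\<dots> = u a * w i + (if a = i then 0 else w a)"
      using i ab by (simp add: sum.distrib)
    also have "\<dots> = (if a = b then 1 else 0)"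
      using u True by (auto simp: w_def)
    finally show ?thesis using True by simp
  qed
  finally show "(?E * ?F) $$ (a, b) = 1\<^sub>m n $$ (a, b)" using ab by simp
qed auto

text \<open>The columns of \<open>P\<close> form a basis, and the columns with index in \<open>I\<close> span \<open>W\<close>: the coordinates \<open>Q *\<^sub>v w\<close>
of a vector of \<open>W\<close> vanish outside \<open>I\<close>. Take \<open>I\<close> maximal such that some invertible matrix has its columns
with index in \<open>I\<close> in \<open>W\<close>. If \<open>w \<in> W\<close> had a nonzero coordinate \<open>i \<notin> I\<close>, then \<open>w\<close> could replace column
\<open>i\<close>, and \<open>insert i I\<close> would do as well.\<close>

lemma adapted_basis:
  assumes W: "linear_subspace n W"
  obtains P Q I where "P \<in> carrier_mat n n" "Q \<in> carrier_mat n n" "P * Q = 1\<^sub>m n" "Q * P = 1\<^sub>m n"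
    "I \<subseteq> {..<n}" "\<And>i. i \<in> I \<Longrightarrow> col P i \<in> W"
    "\<And>w i. w \<in> W \<Longrightarrow> i < n \<Longrightarrow> i \<notin> I \<Longrightarrow> (Q *\<^sub>v w) $ i = 0"
proof -
  define good where "good I \<longleftrightarrow> (\<exists>P Q. P \<in> carrier_mat n n \<and> Q \<in> carrier_mat n n \<and>
    P * Q = 1\<^sub>m n \<and> Q * P = 1\<^sub>m n \<and> (\<forall>i\<in>I. col P i \<in> W))" for I
  have "good {}" unfolding good_def by (intro exI[of _ "1\<^sub>m n"]) auto
  then have ne: "{I. I \<subseteq> {..<n} \<and> good I} \<noteq> {}" by auto
  have fin: "finite {I. I \<subseteq> {..<n} \<and> good I}" by (rule finite_subset[of _ "Pow {..<n}"]) auto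
  obtain I where I: "I \<subseteq> {..<n}" "good I"
    and max: "\<And>J. J \<subseteq> {..<n} \<Longrightarrow> good J \<Longrightarrow> I \<subseteq> J \<Longrightarrow> I = J"
    using finite_has_maximal[OF fin ne] by auto
  obtain P Q where PQ: "P \<in> carrier_mat n n" "Q \<in> carrier_mat n n" "P * Q = 1\<^sub>m n" "Q * P = 1\<^sub>m n"
    and col: "\<And>i. i \<in> I \<Longrightarrow> col P i \<in> W"
    using I(2) unfolding good_def by blast
  have "(Q *\<^sub>v w) $ i = 0" if w: "w \<in> W" and i: "i < n" "i \<notin> I" for w i
  proof (rule ccontr)
    assume nz: "(Q *\<^sub>v w) $ i \<noteq> 0"
    have wc: "w \<in> carrier_vec n" using w W by (auto simp: linear_subspace_def)
    define u where "u a = (Q *\<^sub>v w) $ a" for a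
    define v where "v a = (if a = i then 1 / u i else - u a / u i)" for a
    define E where "E = Matrix.mat n n (\<lambda>(a, b). if b = i then u a else if a = b then 1 else 0)"
    define F where "F = Matrix.mat n n (\<lambda>(a, b). if b = i then v a else if a = b then 1 else 0)"
    have Ec: "E \<in> carrier_mat n n" and Fc: "F \<in> carrier_mat n n" by (auto simp: E_def F_def)
    have ui: "u i \<noteq> 0" using nz by (simp add: u_def)
    then have vi: "v i \<noteq> 0" by (simp add: v_def)
    have EF: "E * F = 1\<^sub>m n"
      using shear_inverse[OF i(1), of u] ui unfolding E_def F_def v_def by simp
    \<comment> \<open>The formula for the inverse shear is an involution.\<close>
    have inv: "(if a = i then 1 / v i else - v a / v i) = u a" for a
      using ui by (auto simp: v_def)
    have FE: "F * E = 1\<^sub>m n"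
      using shear_inverse[OF i(1), of v] vi unfolding E_def F_def inv by simp
    have "P * E * (F * Q) = P * (E * F) * Q"
      using PQ Ec Fc by (simp add: assoc_mult_mat[of _ n n _ n _ n])
    then have 1: "P * E * (F * Q) = 1\<^sub>m n" using EF PQ by simp
    have "Q * (P * E) = E"
      using PQ Ec by (simp add: assoc_mult_mat[of Q n n P n E n, symmetric])
    then have 2: "F * Q * (P * E) = 1\<^sub>m n"
      using FE PQ Ec Fc by (simp add: assoc_mult_mat[of F n n Q n "P * E" n])
    have "col (P * E) j \<in> W" if j: "j \<in> insert i I" for j
    proof (cases "j = i")
      case True
      have "col E i = Q *\<^sub>v w"
        using i wc PQ(2) by (intro eq_vecI) (auto simp: E_def u_def)
      then have "col (P * E) i = P *\<^sub>v (Q *\<^sub>v w)"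
        using col_mult2[OF PQ(1) Ec i(1)] by simp
      also have "\<dots> = w" using PQ wc by (simp add: assoc_mult_mat_vec[symmetric])
      finally show ?thesis using w True by simp
    next
      case False
      then have "j \<in> I" "j < n" using j I by auto
      have "col E j = unit_vec n j"
        using False \<open>j < n\<close> by (intro eq_vecI) (auto simp: E_def)
      then have "col (P * E) j = P *\<^sub>v unit_vec n j"
        using col_mult2[OF PQ(1) Ec \<open>j < n\<close>] by simp
      also have "\<dots> = col P j" using PQ \<open>j < n\<close> by (simp add: mult_mat_unit_vec)
      finally show ?thesis using col[OF \<open>j \<in> I\<close>] by simp
    qed
    then have "good (insert i I)"
      unfolding good_def using 1 2 PQ Ec Fc
      by (intro exI[of _ "P * E"] exI[of _ "F * Q"]) auto
    then show False using max[of "insert i I"] I i by auto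
  qed
  then show ?thesis using that PQ I col by blast
qed

lemma linear_subspace_full:
  assumes W: "linear_subspace n W" and P: "P \<in> carrier_mat n n" "Q \<in> carrier_mat n n" "P * Q = 1\<^sub>m n"
    and cols: "\<And>i. i < n \<Longrightarrow> col P i \<in> W"
  shows "W = carrier_vec n"
proof -
  have Wc: "W \<subseteq> carrier_vec n" and W0: "0\<^sub>v n \<in> W"
    and Wadd: "\<And>v w. v \<in> W \<Longrightarrow> w \<in> W \<Longrightarrow> v + w \<in> W" and Wsm: "\<And>c v. v \<in> W \<Longrightarrow> c \<cdot>\<^sub>v v \<in> W"
    using W by (auto simp: linear_subspace_def)
  have "v \<in> W" if v: "v \<in> carrier_vec n" for v
  proof -
    define u where "u = Q *\<^sub>v v"
    have u: "u \<in> carrier_vec n" using v P by (simp add: u_def)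
    have "P *\<^sub>v Matrix.vec n (\<lambda>j. if j < k then u $ j else 0) \<in> W" if "k \<le> n" for k
      using that
    proof (induction k)
      case 0
      have "P *\<^sub>v Matrix.vec n (\<lambda>j. if j < 0 then u $ j else 0) = 0\<^sub>v n"
        using P by (intro eq_vecI) (auto simp: scalar_prod_def)
      then show ?case using W0 by simp
    next
      case (Suc k)
      have k: "k < n" using Suc by simp
      have "Matrix.vec n (\<lambda>j. if j < Suc k then u $ j else 0) =
          Matrix.vec n (\<lambda>j. if j < k then u $ j else 0) + (u $ k) \<cdot>\<^sub>v unit_vec n k"
        using k by (intro eq_vecI) (auto simp: less_Suc_eq)
      then have "P *\<^sub>v Matrix.vec n (\<lambda>j. if j < Suc k then u $ j else 0) =
          P *\<^sub>v Matrix.vec n (\<lambda>j. if j < k then u $ j else 0) + (u $ k) \<cdot>\<^sub>v col P k"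
        using P k by (simp add: mult_add_distrib_mat_vec[of _ n n] mult_mat_vec[of _ n n] mult_mat_unit_vec)
      then show ?case using Wadd Wsm cols[OF k] Suc by simp
    qed
    from this[of n] have "P *\<^sub>v Matrix.vec n (\<lambda>j. if j < n then u $ j else 0) \<in> W" by simp
    also have "Matrix.vec n (\<lambda>j. if j < n then u $ j else 0) = u"
      using u by (intro eq_vecI) auto
    also have "P *\<^sub>v u = v" unfolding u_def using P v by (simp add: assoc_mult_mat_vec[symmetric])
    finally show ?thesis .
  qed
  then show ?thesis using Wc by blast
qed

text \<open>The hypothesis on \<open>J\<close> says that no entry of a product with indices in \<open>J\<close> receives a contribution from an
intermediate index outside \<open>J\<close>. In a block triangular representation both diagonal blocks have this
property.\<close>

lemma hom_GL_diagonal_block: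
  assumes G: "Group.group G" and R: "R \<in> hom G (general_linear_group n)" and J: "J \<subseteq> {..<n}"
    and block: "\<And>g h i j k. g \<in> carrier G \<Longrightarrow> h \<in> carrier G \<Longrightarrow> i \<in> J \<Longrightarrow> j \<in> J \<Longrightarrow> k < n \<Longrightarrow> k \<notin> J \<Longrightarrow>
      R g $$ (i, k) * R h $$ (k, j) = 0"
  obtains S where "S \<in> hom G (general_linear_group (card J))"
    "\<And>g. g \<in> carrier G \<Longrightarrow> mtrace (card J) (S g) = (\<Sum>i\<in>J. R g $$ (i, i))"
proof -
  have fin: "finite J" using J finite_subset by auto
  obtain e where e: "bij_betw e {..<card J} J"
    using ex_bij_betw_nat_finite[OF fin] by (auto simp: lessThan_atLeast0)
  have eJ: "e i \<in> J" "e i < n" if "i < card J" for i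
    using e that J by (auto simp: bij_betw_def)
  have einj: "e i = e j \<longleftrightarrow> i = j" if "i < card J" "j < card J" for i j
    using e that by (auto simp: bij_betw_def inj_on_def)
  have Rc: "R g \<in> carrier_mat n n" if "g \<in> carrier G" for g
    using R that by (auto simp: hom_GL_iff[OF G])
  define S where "S g = Matrix.mat (card J) (card J) (\<lambda>(i, j). R g $$ (e i, e j))" for g
  have "S \<in> hom G (general_linear_group (card J))"
    unfolding hom_GL_iff[OF G]
  proof (intro conjI ballI)
    show "S \<one>\<^bsub>G\<^esub> = 1\<^sub>m (card J)"
      using R eJ einj by (intro eq_matI) (auto simp: S_def hom_GL_iff[OF G])
  next
    fix g h assume g: "g \<in> carrier G" and h: "h \<in> carrier G"
    show "S (g \<otimes>\<^bsub>G\<^esub> h) = S g * S h"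
    proof (rule eq_matI)
      fix i j assume "i < dim_row (S g * S h)" "j < dim_col (S g * S h)"
      then have ij: "i < card J" "j < card J" by (auto simp: S_def)
      have "S (g \<otimes>\<^bsub>G\<^esub> h) $$ (i, j) = (R g * R h) $$ (e i, e j)"
        using R g h ij by (simp add: S_def hom_GL_iff[OF G])
      also have "\<dots> = (\<Sum>k<n. R g $$ (e i, k) * R h $$ (k, e j))"
        by (rule mult_mat_entry) (use Rc g h eJ ij in auto)
      also have "\<dots> = (\<Sum>k\<in>J. R g $$ (e i, k) * R h $$ (k, e j))"
        by (rule sum.mono_neutral_right) (use J block[OF g h] eJ ij in auto)
      also have "\<dots> = (\<Sum>k<card J. R g $$ (e i, e k) * R h $$ (e k, e j))"
        by (rule sum.reindex_bij_betw[OF e, symmetric])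
      also have "\<dots> = (\<Sum>k<card J. S g $$ (i, k) * S h $$ (k, j))"
        using ij by (intro sum.cong) (auto simp: S_def)
      also have "\<dots> = (S g * S h) $$ (i, j)"
        by (rule mult_mat_entry[symmetric]) (use ij in \<open>auto simp: S_def\<close>)
      finally show "S (g \<otimes>\<^bsub>G\<^esub> h) $$ (i, j) = (S g * S h) $$ (i, j)" .
    qed (auto simp: S_def)
  qed (auto simp: S_def)
  moreover have "mtrace (card J) (S g) = (\<Sum>i\<in>J. R g $$ (i, i))" for g
  proof -
    have "mtrace (card J) (S g) = (\<Sum>i<card J. R g $$ (e i, e i))"
      unfolding mtrace_def by (intro sum.cong) (auto simp: S_def)
    also have "\<dots> = (\<Sum>i\<in>J. R g $$ (i, i))" by (rule sum.reindex_bij_betw[OF e])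
    finally show ?thesis .
  qed
  ultimately show ?thesis using that by blast
qed

text \<open>In a basis adapted to \<open>W\<close> the representation is block triangular. The diagonal blocks are the actions on
\<open>W\<close> and on the quotient by \<open>W\<close>, and the trace is the sum of their traces.\<close>

lemma reducible_trace_splits:
  assumes G: "Group.group G" and \<rho>: "\<rho> \<in> hom G (general_linear_group n)"
    and W: "linear_subspace n W" and inv: "\<And>g w. g \<in> carrier G \<Longrightarrow> w \<in> W \<Longrightarrow> \<rho> g *\<^sub>v w \<in> W"
    and proper: "W \<noteq> {0\<^sub>v n}" "W \<noteq> carrier_vec n"
  obtains n1 \<rho>1 n2 \<rho>2 where "n1 < n" "\<rho>1 \<in> hom G (general_linear_group n1)"
    "n2 < n" "\<rho>2 \<in> hom G (general_linear_group n2)"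
    "\<And>g. g \<in> carrier G \<Longrightarrow> mtrace n (\<rho> g) = mtrace n1 (\<rho>1 g) + mtrace n2 (\<rho>2 g)"
proof -
  obtain P Q I where PQ: "P \<in> carrier_mat n n" "Q \<in> carrier_mat n n" "P * Q = 1\<^sub>m n" "Q * P = 1\<^sub>m n"
    and I: "I \<subseteq> {..<n}" and col: "\<And>i. i \<in> I \<Longrightarrow> col P i \<in> W"
    and zero: "\<And>w i. w \<in> W \<Longrightarrow> i < n \<Longrightarrow> i \<notin> I \<Longrightarrow> (Q *\<^sub>v w) $ i = 0"
    using adapted_basis[OF W] by blast
  have Wc: "W \<subseteq> carrier_vec n" "0\<^sub>v n \<in> W" using W by (auto simp: linear_subspace_def)
  have "I \<noteq> {..<n}"
    using linear_subspace_full[OF W PQ(1-3)] col proper(2) by blast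
  have "I \<noteq> {}"
  proof
    assume "I = {}"
    have "w = 0\<^sub>v n" if w: "w \<in> W" for w
    proof -
      have wc: "w \<in> carrier_vec n" using w Wc by blast
      have "Q *\<^sub>v w = 0\<^sub>v n"
        using zero[OF w] \<open>I = {}\<close> PQ wc by (intro eq_vecI) auto
      then have "P *\<^sub>v (Q *\<^sub>v w) = 0\<^sub>v n" using PQ by auto
      then show ?thesis using PQ wc by (simp add: assoc_mult_mat_vec[symmetric])
    qed
    then show False using proper(1) Wc by blast
  qed
  define J where "J = {..<n} - I"
  have fin: "finite I" using I finite_subset by auto
  have J: "J \<subseteq> {..<n}" "finite J" by (auto simp: J_def)
  have "card I < n" "card J < n"
    using \<open>I \<noteq> {..<n}\<close> \<open>I \<noteq> {}\<close> I psubset_card_mono[of "{..<n}" I] psubset_card_mono[of "{..<n}" J]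
    by (auto simp: J_def)
  have \<rho>c: "\<rho> g \<in> carrier_mat n n" if "g \<in> carrier G" for g
    using \<rho> that by (auto simp: hom_GL_iff[OF G])
  define R where "R g = Q * \<rho> g * P" for g
  have R: "R \<in> hom G (general_linear_group n)"
    unfolding hom_GL_iff[OF G]
  proof (intro conjI ballI)
    show "R g \<in> carrier_mat n n" if "g \<in> carrier G" for g
      using \<rho>c[OF that] PQ by (auto simp: R_def)
    show "R \<one>\<^bsub>G\<^esub> = 1\<^sub>m n" using \<rho> PQ by (simp add: R_def hom_GL_iff[OF G])
  next
    fix g h assume gh: "g \<in> carrier G" "h \<in> carrier G"
    note c = \<rho>c[OF gh(1)] \<rho>c[OF gh(2)] PQ(1,2)
    have "R g * R h = Q * \<rho> g * (P * Q) * \<rho> h * P"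
      unfolding R_def using c by (simp add: assoc_mult_mat[of _ n n _ n _ n])
    also have "\<dots> = Q * (\<rho> g * \<rho> h) * P"
      using c PQ(3) by (simp add: assoc_mult_mat[of _ n n _ n _ n])
    finally show "R (g \<otimes>\<^bsub>G\<^esub> h) = R g * R h"
      using \<rho> gh by (simp add: R_def hom_GL_iff[OF G])
  qed
  have low: "R g $$ (i, j) = 0" if g: "g \<in> carrier G" and i: "i < n" "i \<notin> I" and j: "j \<in> I" for g i j
  proof -
    have jn: "j < n" using j I by auto
    have Pj: "col P j \<in> carrier_vec n" using col[OF j] Wc by blast
    have "col (R g) j = (Q * \<rho> g) *\<^sub>v col P j"
      unfolding R_def using \<rho>c[OF g] PQ jn by (intro col_mult2[of _ n n]) auto
    also have "\<dots> = Q *\<^sub>v (\<rho> g *\<^sub>v col P j)"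
      using \<rho>c[OF g] PQ Pj by (intro assoc_mult_mat_vec[of _ n n _ n])
    finally have "col (R g) j = Q *\<^sub>v (\<rho> g *\<^sub>v col P j)" .
    then have "col (R g) j $ i = 0"
      using zero[OF inv[OF g col[OF j]] i] by simp
    then show ?thesis using i jn R g by (auto simp: hom_GL_iff[OF G])
  qed
  obtain S where S: "S \<in> hom G (general_linear_group (card I))"
    "\<And>g. g \<in> carrier G \<Longrightarrow> mtrace (card I) (S g) = (\<Sum>i\<in>I. R g $$ (i, i))"
    by (rule hom_GL_diagonal_block[OF G R I]) (use low in auto)
  obtain S' where S': "S' \<in> hom G (general_linear_group (card J))"
    "\<And>g. g \<in> carrier G \<Longrightarrow> mtrace (card J) (S' g) = (\<Sum>i\<in>J. R g $$ (i, i))"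
    by (rule hom_GL_diagonal_block[OF G R J(1)]) (use low in \<open>auto simp: J_def\<close>)
  have "mtrace n (\<rho> g) = mtrace (card I) (S g) + mtrace (card J) (S' g)" if g: "g \<in> carrier G" for g
  proof -
    note c = \<rho>c[OF g] PQ(1,2)
    have "mtrace n (R g) = mtrace n (P * (Q * \<rho> g))"
      unfolding R_def using c by (intro mtrace_mult_comm[of _ n n]) auto
    also have "P * (Q * \<rho> g) = \<rho> g"
      using c PQ(3) by (simp add: assoc_mult_mat[of _ n n _ n _ n, symmetric])
    finally have "mtrace n (\<rho> g) = (\<Sum>i<n. R g $$ (i, i))" by (simp add: mtrace_def)
    also have "\<dots> = (\<Sum>i\<in>I. R g $$ (i, i)) + (\<Sum>i\<in>J. R g $$ (i, i))"
      using I by (simp add: J_def sum.subset_diff[of I "{..<n}"] add.commute)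
    finally show ?thesis using S S' g by simp
  qed
  then show ?thesis using that \<open>card I < n\<close> \<open>card J < n\<close> S(1) S'(1) by blast
qed

text \<open>The list is that of the factors of a composition series, found by induction on the dimension.\<close>

lemma trace_sum_of_irreducibles:
  assumes G: "Group.group G" and \<rho>: "\<rho> \<in> hom G (general_linear_group n)"
  shows "\<exists>L. (\<forall>(m, \<sigma>)\<in>set L. irreducible_hom G m \<sigma>) \<and>
    (\<forall>g\<in>carrier G. mtrace n (\<rho> g) = (\<Sum>(m, \<sigma>)\<leftarrow>L. mtrace m (\<sigma> g)))"
  using \<rho>
proof (induction n arbitrary: \<rho> rule: less_induct)
  case (less n)
  show ?case
  proof (cases "n = 0")
    case True
    then show ?thesis by (intro exI[of _ "[]"]) (auto simp: mtrace_def)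
  next
    case n: False
    show ?thesis
    proof (cases "irreducible_hom G n \<rho>")
      case True
      then show ?thesis by (intro exI[of _ "[(n, \<rho>)]"]) auto
    next
      case False
      then obtain W where W: "linear_subspace n W" "W \<noteq> {0\<^sub>v n}" "W \<noteq> carrier_vec n"
        and inv: "\<And>g w. g \<in> carrier G \<Longrightarrow> w \<in> W \<Longrightarrow> \<rho> g *\<^sub>v w \<in> W"
        using less.prems n unfolding irreducible_hom_def by blast
      obtain n1 \<rho>1 n2 \<rho>2 where s: "n1 < n" "\<rho>1 \<in> hom G (general_linear_group n1)"
        "n2 < n" "\<rho>2 \<in> hom G (general_linear_group n2)"
        and tr: "\<And>g. g \<in> carrier G \<Longrightarrow> mtrace n (\<rho> g) = mtrace n1 (\<rho>1 g) + mtrace n2 (\<rho>2 g)"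
        using reducible_trace_splits[OF G less.prems W(1) inv W(2,3)] by metis
      obtain L1 where L1: "\<forall>(m, \<sigma>)\<in>set L1. irreducible_hom G m \<sigma>"
        "\<forall>g\<in>carrier G. mtrace n1 (\<rho>1 g) = (\<Sum>(m, \<sigma>)\<leftarrow>L1. mtrace m (\<sigma> g))"
        using less.IH[OF s(1,2)] by blast
      obtain L2 where L2: "\<forall>(m, \<sigma>)\<in>set L2. irreducible_hom G m \<sigma>"
        "\<forall>g\<in>carrier G. mtrace n2 (\<rho>2 g) = (\<Sum>(m, \<sigma>)\<leftarrow>L2. mtrace m (\<sigma> g))"
        using less.IH[OF s(3,4)] by blast
      show ?thesis
        by (intro exI[of _ "L1 @ L2"]) (use L1 L2 tr in auto)
    qed
  qed
qed

section \<open>Counting commutators in a finite group\<close>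

text \<open>The character of a representation, undefined off the carrier as the elements of \<open>irr_characters\<close> are.\<close>

definition restricted_trace ::
  "('a, 'm) monoid_scheme \<Rightarrow> nat \<Rightarrow> ('a \<Rightarrow> complex mat) \<Rightarrow> 'a \<Rightarrow> complex" where
  "restricted_trace G n \<rho> = (\<lambda>g\<in>carrier G. mtrace n (\<rho> g))"

lemma restricted_trace_eq_iff:
  "restricted_trace G n \<rho> = restricted_trace G m \<sigma> \<longleftrightarrow>
     (\<forall>g\<in>carrier G. mtrace n (\<rho> g) = mtrace m (\<sigma> g))"
  by (auto simp: restricted_trace_def fun_eq_iff restrict_def)

lemma irr_characters_eq:
  "irr_characters G T =
     {restricted_trace G n \<rho> | n \<rho>. matrix_rep G T n \<rho> \<and> irreducible_hom G n \<rho>}"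
  by (simp add: irr_characters_def irreducible_rep_iff restricted_trace_def mtrace_def)

lemma matrix_rep_discrete:
  "matrix_rep G (discrete_topology (carrier G)) n \<rho> \<longleftrightarrow> \<rho> \<in> hom G (general_linear_group n)"
  by (simp add: matrix_rep_def)

lemma irr_characters_discrete_eq:
  "irr_characters G (discrete_topology (carrier G)) =
     {restricted_trace G n \<rho> | n \<rho>. irreducible_hom G n \<rho>}"
  by (auto simp: irr_characters_eq matrix_rep_discrete irreducible_hom_def)

text \<open>Left translations as permutation matrices. A translation has a fixed point only if it is trivial.\<close>

lemma regular_representation:
  assumes G: "Group.group G" and fin: "finite (carrier G)"
  obtains \<rho> where "\<rho> \<in> hom G (general_linear_group (order G))"
    "\<And>g. g \<in> carrier G \<Longrightarrow> mtrace (order G) (\<rho> g) = (if g = \<one>\<^bsub>G\<^esub> then of_nat (order G) else 0)"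
proof -
  interpret G: Group.group G by fact
  let ?n = "order G"
  obtain e where e: "bij_betw e {..<?n} (carrier G)"
    using ex_bij_betw_nat_finite[OF fin] by (auto simp: lessThan_atLeast0 order_def)
  have eG: "e i \<in> carrier G" if "i < ?n" for i using e that by (auto simp: bij_betw_def)
  have einj: "e i = e j \<longleftrightarrow> i = j" if "i < ?n" "j < ?n" for i j
    using e that by (auto simp: bij_betw_def inj_on_def)
  define \<rho> where "\<rho> g = Matrix.mat ?n ?n (\<lambda>(i, j). if e i = g \<otimes>\<^bsub>G\<^esub> e j then 1 else 0 :: complex)" for g
  have "\<rho> \<in> hom G (general_linear_group ?n)"
    unfolding hom_GL_iff[OF G]
  proof (intro conjI ballI)
    show "\<rho> \<one>\<^bsub>G\<^esub> = 1\<^sub>m ?n"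
      using eG einj by (intro eq_matI) (auto simp: \<rho>_def)
  next
    fix g h assume g: "g \<in> carrier G" and h: "h \<in> carrier G"
    show "\<rho> (g \<otimes>\<^bsub>G\<^esub> h) = \<rho> g * \<rho> h"
    proof (rule eq_matI)
      fix i j assume "i < dim_row (\<rho> g * \<rho> h)" "j < dim_col (\<rho> g * \<rho> h)"
      then have ij: "i < ?n" "j < ?n" by (auto simp: \<rho>_def)
      have "(\<rho> g * \<rho> h) $$ (i, j) = (\<Sum>k<?n. \<rho> g $$ (i, k) * \<rho> h $$ (k, j))"
        by (rule mult_mat_entry) (use ij in \<open>auto simp: \<rho>_def\<close>)
      also have "\<dots> = (\<Sum>k<?n. (\<lambda>x. (if e i = g \<otimes>\<^bsub>G\<^esub> x then 1 else 0) *
          (if x = h \<otimes>\<^bsub>G\<^esub> e j then 1 else 0)) (e k))"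
        using ij by (intro sum.cong) (auto simp: \<rho>_def)
      also have "\<dots> = (\<Sum>x\<in>carrier G. (if e i = g \<otimes>\<^bsub>G\<^esub> x then 1 else 0) *
          (if x = h \<otimes>\<^bsub>G\<^esub> e j then 1 else 0))"
        by (rule sum.reindex_bij_betw[OF e])
      also have "\<dots> = (\<Sum>x\<in>carrier G. if x = h \<otimes>\<^bsub>G\<^esub> e j
          then (if e i = g \<otimes>\<^bsub>G\<^esub> (h \<otimes>\<^bsub>G\<^esub> e j) then 1 else 0) else 0)"
        by (intro sum.cong) auto
      also have "\<dots> = \<rho> (g \<otimes>\<^bsub>G\<^esub> h) $$ (i, j)"
        using fin g h ij eG by (simp add: \<rho>_def G.m_assoc)
      finally show "\<rho> (g \<otimes>\<^bsub>G\<^esub> h) $$ (i, j) = (\<rho> g * \<rho> h) $$ (i, j)" by simp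
    qed (auto simp: \<rho>_def)
  qed (auto simp: \<rho>_def)
  moreover have "mtrace ?n (\<rho> g) = (if g = \<one>\<^bsub>G\<^esub> then of_nat ?n else 0)" if g: "g \<in> carrier G" for g
  proof -
    have "e i = g \<otimes>\<^bsub>G\<^esub> e i \<longleftrightarrow> g = \<one>\<^bsub>G\<^esub>" if "i < ?n" for i
      using eG[OF that] g G.l_cancel_one' G.r_cancel_one' by metis
    then have "mtrace ?n (\<rho> g) = (\<Sum>i<?n. if g = \<one>\<^bsub>G\<^esub> then 1 else 0)"
      unfolding mtrace_def by (intro sum.cong) (auto simp: \<rho>_def)
    then show ?thesis by simp
  qed
  ultimately show ?thesis using that by blast
qed

lemma mtrace_hom_one:
  assumes "Group.group G" "\<rho> \<in> hom G (general_linear_group n)"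
  shows "mtrace n (\<rho> \<one>\<^bsub>G\<^esub>) = of_nat n"
  using assms by (simp add: hom_GL_iff mtrace_def)

text \<open>The trace of the regular representation is a finite sum of irreducible characters, in which \<open>\<eta>\<close> occurs
\<open>\<eta> \<one>\<close> times. In particular every irreducible character occurs, so there are finitely many.\<close>

lemma irr_characters_column_orthogonality:
  assumes G: "Group.group G" and fin: "finite (carrier G)"
  shows "finite (irr_characters G (discrete_topology (carrier G)))"
    and "\<And>g. g \<in> carrier G \<Longrightarrow>
      (\<Sum>\<eta>\<in>irr_characters G (discrete_topology (carrier G)). \<eta> \<one>\<^bsub>G\<^esub> * \<eta> g) =
      (if g = \<one>\<^bsub>G\<^esub> then of_nat (order G) else 0)"
proof -
  interpret G: Group.group G by fact
  define Irr where "Irr = irr_characters G (discrete_topology (carrier G))"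
  obtain R where R: "R \<in> hom G (general_linear_group (order G))"
    and trR: "\<And>g. g \<in> carrier G \<Longrightarrow> mtrace (order G) (R g) = (if g = \<one>\<^bsub>G\<^esub> then of_nat (order G) else 0)"
    by (rule regular_representation[OF G fin]) blast
  obtain L where L: "\<And>m \<sigma>. (m, \<sigma>) \<in> set L \<Longrightarrow> irreducible_hom G m \<sigma>"
    and LR: "\<And>g. g \<in> carrier G \<Longrightarrow> mtrace (order G) (R g) = (\<Sum>(m, \<sigma>)\<leftarrow>L. mtrace m (\<sigma> g))"
    using trace_sum_of_irreducibles[OF G R] by fast
  define C where "C = map (\<lambda>(m, \<sigma>). restricted_trace G m \<sigma>) L"
  have LC: "(\<Sum>(m, \<sigma>)\<leftarrow>L. mtrace m (\<sigma> g)) = (\<Sum>\<eta>\<leftarrow>C. \<eta> g)" if "g \<in> carrier G" for g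
    using that by (auto simp: C_def restricted_trace_def comp_def split_beta intro!: arg_cong[of _ _ sum_list])
  have pos: "order G > 0" using fin G.one_closed by (auto simp: order_def card_gt_0_iff)
  have setC: "set C \<subseteq> Irr"
    using L by (auto simp: C_def Irr_def irr_characters_discrete_eq)
  \<comment> \<open>Pairing the trace of the regular representation with an irreducible representation
      of degree \<open>n\<close> counts its multiplicity, which turns out to be \<open>n\<close>.\<close>
  have mult: "of_nat (count_list C \<eta>) = \<eta> \<one>\<^bsub>G\<^esub>" and deg: "\<eta> \<one>\<^bsub>G\<^esub> \<noteq> 0" if \<eta>: "\<eta> \<in> Irr" for \<eta>
  proof -
    obtain n \<rho> where \<rho>: "irreducible_hom G n \<rho>" and \<eta>\<rho>: "\<eta> = restricted_trace G n \<rho>"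
      using \<eta> by (auto simp: Irr_def irr_characters_discrete_eq)
    have hom: "\<rho> \<in> hom G (general_linear_group n)" and n: "n > 0"
      using \<rho> by (auto simp: irreducible_hom_def)
    have \<eta>1: "\<eta> \<one>\<^bsub>G\<^esub> = of_nat n"
      using mtrace_hom_one[OF G hom] by (simp add: \<eta>\<rho> restricted_trace_def)
    then show "\<eta> \<one>\<^bsub>G\<^esub> \<noteq> 0" using n by simp
    have "(\<Sum>g\<in>carrier G. mtrace (order G) (R g) * \<rho> (inv\<^bsub>G\<^esub> g) $$ (0, 0)) =
        (\<Sum>g\<in>carrier G. if g = \<one>\<^bsub>G\<^esub> then of_nat (order G) else 0)"
      using trR hom n by (intro sum.cong) (auto simp: hom_GL_iff[OF G])
    then have 1: "(\<Sum>g\<in>carrier G. mtrace (order G) (R g) * \<rho> (inv\<^bsub>G\<^esub> g) $$ (0, 0)) = of_nat (order G)"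
      using fin by simp
    have "(\<Sum>g\<in>carrier G. mtrace (order G) (R g) * \<rho> (inv\<^bsub>G\<^esub> g) $$ (0, 0)) =
        (\<Sum>g\<in>carrier G. \<Sum>p\<leftarrow>L. mtrace (fst p) (snd p g) * \<rho> (inv\<^bsub>G\<^esub> g) $$ (0, 0))"
      by (intro sum.cong refl) (simp add: LR sum_list_mult_const case_prod_beta')
    also have "\<dots> = (\<Sum>p\<leftarrow>L. \<Sum>g\<in>carrier G. mtrace (fst p) (snd p g) * \<rho> (inv\<^bsub>G\<^esub> g) $$ (0, 0))"
      by (induction L) (auto simp: sum.distrib)
    also have "\<dots> = (\<Sum>p\<leftarrow>L. if restricted_trace G (fst p) (snd p) = \<eta> then of_nat (order G) / of_nat n else 0)"
      using trace_orthogonality[OF G \<rho> L n n]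
      by (intro arg_cong[of _ _ sum_list] map_cong) (auto simp: \<eta>\<rho> restricted_trace_eq_iff)
    also have "\<dots> = (\<Sum>\<chi>\<leftarrow>C. if \<chi> = \<eta> then of_nat (order G) / of_nat n else 0)"
      by (simp add: C_def comp_def split_beta)
    also have "\<dots> = of_nat (count_list C \<eta>) * (of_nat (order G) / of_nat n)"
      by (induction C) (auto simp: algebra_simps add_divide_distrib)
    finally have "of_nat (order G) = of_nat (count_list C \<eta>) * (of_nat (order G) / of_nat n :: complex)"
      using 1 by simp
    then show "of_nat (count_list C \<eta>) = \<eta> \<one>\<^bsub>G\<^esub>"
      using n pos by (simp add: \<eta>1 field_simps)
  qed
  have "Irr \<subseteq> set C"
  proof
    fix \<eta> assume "\<eta> \<in> Irr"
    then show "\<eta> \<in> set C" using mult deg by (metis count_notin of_nat_0)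
  qed
  then have IrrC: "Irr = set C" using setC by blast
  then show "finite (irr_characters G (discrete_topology (carrier G)))" by (simp add: Irr_def)
  show "(\<Sum>\<eta>\<in>irr_characters G (discrete_topology (carrier G)). \<eta> \<one>\<^bsub>G\<^esub> * \<eta> g) =
      (if g = \<one>\<^bsub>G\<^esub> then of_nat (order G) else 0)" if g: "g \<in> carrier G" for g
  proof -
    have "(\<Sum>\<eta>\<in>Irr. \<eta> \<one>\<^bsub>G\<^esub> * \<eta> g) = (\<Sum>\<eta>\<in>set C. of_nat (count_list C \<eta>) * \<eta> g)"
      unfolding IrrC[symmetric] by (intro sum.cong) (auto simp: mult)
    also have "\<dots> = (\<Sum>\<eta>\<leftarrow>C. \<eta> g)"
    proof (induction C)
      case (Cons c C)
      have "(\<Sum>\<eta>\<in>set (c # C). of_nat (count_list (c # C) \<eta>) * \<eta> g) =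
          (\<Sum>\<eta>\<in>insert c (set C). (if \<eta> = c then c g else 0) + of_nat (count_list C \<eta>) * \<eta> g)"
        by (intro sum.cong) (auto simp: algebra_simps)
      also have "\<dots> = c g + (\<Sum>\<eta>\<in>insert c (set C). of_nat (count_list C \<eta>) * \<eta> g)"
        by (simp add: sum.distrib)
      also have "(\<Sum>\<eta>\<in>insert c (set C). of_nat (count_list C \<eta>) * \<eta> g) =
          (\<Sum>\<eta>\<in>set C. of_nat (count_list C \<eta>) * \<eta> g)"
        by (rule sum.mono_neutral_right) (auto simp: count_notin)
      finally show ?case using Cons.IH by simp
    qed simp
    also have "\<dots> = mtrace (order G) (R g)" using LR[OF g] LC[OF g] by simp
    finally show ?thesis using trR[OF g] by (simp add: Irr_def)
  qed
qed

text \<open>The sum of \<open>\<rho>\<close> over all commutators is the scalar matrix \<open>(|G| / n)\<^sup>2\<close>. Summing the conjugates of \<open>b\<close>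
first gives \<open>|G| \<eta>(b) / n\<close>, and then \<open>\<Sum>b. \<eta> b \<cdot> \<rho> (b\<^sup>-\<^sup>1)\<close> is the scalar \<open>|G| / n\<close>.\<close>

lemma frobenius_scalar:
  assumes G: "Group.group G" and fin: "finite (carrier G)" and \<rho>: "irreducible_hom G n \<rho>"
    and c: "c \<in> carrier G"
  shows "(\<Sum>a\<in>carrier G. \<Sum>b\<in>carrier G.
           mtrace n (\<rho> (a \<otimes>\<^bsub>G\<^esub> b \<otimes>\<^bsub>G\<^esub> inv\<^bsub>G\<^esub> a \<otimes>\<^bsub>G\<^esub> inv\<^bsub>G\<^esub> b \<otimes>\<^bsub>G\<^esub> c))) =
         (of_nat (order G) / of_nat n)\<^sup>2 * mtrace n (\<rho> c)"
proof -
  interpret G: Group.group G by fact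
  have hom: "\<rho> \<in> hom G (general_linear_group n)" and n: "n > 0"
    using \<rho> by (auto simp: irreducible_hom_def)
  have \<rho>c: "\<rho> g \<in> carrier_mat n n" if "g \<in> carrier G" for g
    using hom that by (auto simp: hom_GL_iff[OF G])
  have \<rho>m: "\<rho> (g \<otimes>\<^bsub>G\<^esub> h) $$ (i, j) = (\<Sum>k<n. \<rho> g $$ (i, k) * \<rho> h $$ (k, j))"
    if "g \<in> carrier G" "h \<in> carrier G" "i < n" "j < n" for g h i j
    using hom that mult_mat_entry[OF \<rho>c[OF that(1)] \<rho>c[OF that(2)] that(3,4)]
    by (simp add: hom_GL_iff[OF G])
  let ?q = "of_nat (order G) / of_nat n :: complex"
  \<comment> \<open>Averaging over \<open>a\<close> replaces the conjugate of \<open>b\<close> by the scalar with the same trace.\<close>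
  have conj: "(\<Sum>a\<in>carrier G. \<rho> (a \<otimes>\<^bsub>G\<^esub> b \<otimes>\<^bsub>G\<^esub> inv\<^bsub>G\<^esub> a) $$ (i, j)) = (if i = j then ?q * mtrace n (\<rho> b) else 0)"
    if b: "b \<in> carrier G" and ij: "i < n" "j < n" for b i j
  proof -
    have "(\<Sum>a\<in>carrier G. \<rho> (a \<otimes>\<^bsub>G\<^esub> b \<otimes>\<^bsub>G\<^esub> inv\<^bsub>G\<^esub> a) $$ (i, j)) =
        (\<Sum>a\<in>carrier G. \<Sum>l<n. \<Sum>k<n. \<rho> b $$ (k, l) * (\<rho> a $$ (i, k) * \<rho> (inv\<^bsub>G\<^esub> a) $$ (l, j)))"
      using b ij by (intro sum.cong) (auto simp: \<rho>m sum_distrib_right sum_distrib_left mult_ac)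
    also have "\<dots> = (\<Sum>l<n. \<Sum>k<n. \<rho> b $$ (k, l) *
        (\<Sum>a\<in>carrier G. \<rho> a $$ (i, k) * \<rho> (inv\<^bsub>G\<^esub> a) $$ (l, j)))"
      by (simp add: sum_distrib_left sum.swap[of _ "carrier G"])
    also have "\<dots> = (\<Sum>l<n. \<Sum>k<n. if k = l then (if i = j then \<rho> b $$ (l, l) * ?q else 0) else 0)"
      using schur_orthogonality_same[OF G \<rho>] ij by (intro sum.cong refl) auto
    also have "\<dots> = (if i = j then ?q * mtrace n (\<rho> b) else 0)"
      by (simp add: mtrace_def sum_distrib_left mult_ac)
    finally show ?thesis .
  qed
  have "(\<Sum>a\<in>carrier G. \<Sum>b\<in>carrier G.
           mtrace n (\<rho> (a \<otimes>\<^bsub>G\<^esub> b \<otimes>\<^bsub>G\<^esub> inv\<^bsub>G\<^esub> a \<otimes>\<^bsub>G\<^esub> inv\<^bsub>G\<^esub> b \<otimes>\<^bsub>G\<^esub> c))) =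
      (\<Sum>b\<in>carrier G. \<Sum>a\<in>carrier G. \<Sum>i<n. \<Sum>j<n.
         \<rho> (a \<otimes>\<^bsub>G\<^esub> b \<otimes>\<^bsub>G\<^esub> inv\<^bsub>G\<^esub> a) $$ (i, j) * \<rho> (inv\<^bsub>G\<^esub> b \<otimes>\<^bsub>G\<^esub> c) $$ (j, i))"
    unfolding mtrace_def using c
    by (subst sum.swap) (auto intro!: sum.cong simp: \<rho>m[symmetric] G.m_assoc)
  also have "\<dots> = (\<Sum>b\<in>carrier G. \<Sum>i<n. \<Sum>j<n.
         (\<Sum>a\<in>carrier G. \<rho> (a \<otimes>\<^bsub>G\<^esub> b \<otimes>\<^bsub>G\<^esub> inv\<^bsub>G\<^esub> a) $$ (i, j)) * \<rho> (inv\<^bsub>G\<^esub> b \<otimes>\<^bsub>G\<^esub> c) $$ (j, i))"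
    by (intro sum.cong refl) (simp add: sum_distrib_right sum.swap[of _ "carrier G"])
  also have "\<dots> = (\<Sum>b\<in>carrier G. \<Sum>i<n. \<Sum>j<n.
         if j = i then ?q * mtrace n (\<rho> b) * \<rho> (inv\<^bsub>G\<^esub> b \<otimes>\<^bsub>G\<^esub> c) $$ (i, i) else 0)"
    using conj by (intro sum.cong refl) auto
  also have "\<dots> = (\<Sum>b\<in>carrier G. \<Sum>i<n. ?q * mtrace n (\<rho> b) * \<rho> (inv\<^bsub>G\<^esub> b \<otimes>\<^bsub>G\<^esub> c) $$ (i, i))"
    by simp
  also have "\<dots> = (\<Sum>b\<in>carrier G. \<Sum>i<n. \<Sum>j<n.
      ?q * (mtrace n (\<rho> b) * \<rho> (inv\<^bsub>G\<^esub> b) $$ (i, j)) * \<rho> c $$ (j, i))"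
    using c by (intro sum.cong refl) (simp add: \<rho>m sum_distrib_left mult_ac)
  also have "\<dots> = (\<Sum>i<n. \<Sum>j<n.
      ?q * (\<Sum>b\<in>carrier G. mtrace n (\<rho> b) * \<rho> (inv\<^bsub>G\<^esub> b) $$ (i, j)) * \<rho> c $$ (j, i))"
    by (simp add: sum_distrib_left sum_distrib_right sum.swap[of _ "carrier G"])
  also have "\<dots> = (\<Sum>i<n. \<Sum>j<n. if j = i then ?q * ?q * \<rho> c $$ (i, i) else 0)"
    using trace_orthogonality[OF G \<rho> \<rho>] by (intro sum.cong refl) auto
  also have "\<dots> = ?q\<^sup>2 * mtrace n (\<rho> c)"
    by (simp add: mtrace_def sum_distrib_left power2_eq_square)
  finally show ?thesis .
qed

text \<open>Column orthogonality writes the condition \<open>[b, a] c = \<one>\<close> as a sum of character values, and the sum over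
\<open>a\<close> and \<open>b\<close> of each of these is known.\<close>

lemma frobenius_commutator_formula:
  assumes G: "Group.group G" and fin: "finite (carrier G)" and c: "c \<in> carrier G"
  shows "of_nat (card {(a, b). a \<in> carrier G \<and> b \<in> carrier G \<and>
            a \<otimes>\<^bsub>G\<^esub> b \<otimes>\<^bsub>G\<^esub> inv\<^bsub>G\<^esub> a \<otimes>\<^bsub>G\<^esub> inv\<^bsub>G\<^esub> b = c}) =
    of_nat (order G) * (\<Sum>\<eta>\<in>irr_characters G (discrete_topology (carrier G)). \<eta> c / \<eta> \<one>\<^bsub>G\<^esub>)"
    (is "of_nat (card ?A) = _ * (\<Sum>\<eta>\<in>?Irr. _)")
proof -
  interpret G: Group.group G by fact
  let ?C = "\<lambda>a b. a \<otimes>\<^bsub>G\<^esub> b \<otimes>\<^bsub>G\<^esub> inv\<^bsub>G\<^esub> a \<otimes>\<^bsub>G\<^esub> inv\<^bsub>G\<^esub> b"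
  have pos: "order G > 0" using fin G.one_closed by (auto simp: order_def card_gt_0_iff)
  have comm_inv: "inv\<^bsub>G\<^esub> (?C a b) = ?C b a" if "a \<in> carrier G" "b \<in> carrier G" for a b
    using that by (simp add: G.inv_mult_group G.m_assoc)
  \<comment> \<open>Exchanging \<open>a\<close> and \<open>b\<close> inverts the commutator.\<close>
  have "?C a b = c \<longleftrightarrow> ?C b a \<otimes>\<^bsub>G\<^esub> c = \<one>\<^bsub>G\<^esub>" if ab: "a \<in> carrier G" "b \<in> carrier G" for a b
  proof
    assume "?C a b = c"
    then have "?C b a = inv\<^bsub>G\<^esub> c" using comm_inv[OF ab] by simp
    then show "?C b a \<otimes>\<^bsub>G\<^esub> c = \<one>\<^bsub>G\<^esub>" using c by simp
  next
    assume "?C b a \<otimes>\<^bsub>G\<^esub> c = \<one>\<^bsub>G\<^esub>"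
    then have "inv\<^bsub>G\<^esub> c = ?C b a" using ab c by (intro G.inv_equality) auto
    also have "\<dots> = inv\<^bsub>G\<^esub> (?C a b)" using comm_inv[OF ab] by simp
    finally show "?C a b = c" using ab c G.inv_inj by (metis G.inv_inv G.inv_closed G.m_closed)
  qed
  then have A: "(if ?C a b = c then 1 else 0) = (if ?C b a \<otimes>\<^bsub>G\<^esub> c = \<one>\<^bsub>G\<^esub> then 1 else 0 :: complex)"
    if "a \<in> carrier G" "b \<in> carrier G" for a b
    using that by simp
  have Aset: "?A = {p \<in> carrier G \<times> carrier G. ?C (fst p) (snd p) = c}" by auto
  have "of_nat (card ?A) = (\<Sum>p\<in>carrier G \<times> carrier G. if ?C (fst p) (snd p) = c then 1 else 0 :: complex)"
    unfolding Aset using fin by (simp add: sum.If_cases Int_def)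
  also have "\<dots> = (\<Sum>a\<in>carrier G. \<Sum>b\<in>carrier G. if ?C a b = c then 1 else 0)"
    by (simp add: sum.cartesian_product split_beta)
  also have "\<dots> = (\<Sum>b\<in>carrier G. \<Sum>a\<in>carrier G. if ?C b a \<otimes>\<^bsub>G\<^esub> c = \<one>\<^bsub>G\<^esub> then 1 else 0)"
    by (subst sum.swap) (intro sum.cong refl A)
  finally have "of_nat (order G) * of_nat (card ?A) =
      (\<Sum>b\<in>carrier G. \<Sum>a\<in>carrier G. if ?C b a \<otimes>\<^bsub>G\<^esub> c = \<one>\<^bsub>G\<^esub> then of_nat (order G) else 0 :: complex)"
    by (simp add: sum_distrib_left if_distrib cong: if_cong)
  also have "\<dots> = (\<Sum>b\<in>carrier G. \<Sum>a\<in>carrier G. \<Sum>\<eta>\<in>?Irr. \<eta> \<one>\<^bsub>G\<^esub> * \<eta> (?C b a \<otimes>\<^bsub>G\<^esub> c))"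
    using c by (intro sum.cong refl irr_characters_column_orthogonality(2)[OF G fin, symmetric]) auto
  also have "\<dots> = (\<Sum>\<eta>\<in>?Irr. \<eta> \<one>\<^bsub>G\<^esub> * (\<Sum>b\<in>carrier G. \<Sum>a\<in>carrier G. \<eta> (?C b a \<otimes>\<^bsub>G\<^esub> c)))"
    by (simp add: sum_distrib_left sum.swap[of _ "?Irr"])
  also have "\<dots> = (\<Sum>\<eta>\<in>?Irr. (of_nat (order G))\<^sup>2 * (\<eta> c / \<eta> \<one>\<^bsub>G\<^esub>))"
  proof (intro sum.cong refl)
    fix \<eta> assume "\<eta> \<in> ?Irr"
    then obtain n \<rho> where \<rho>: "irreducible_hom G n \<rho>" and \<eta>\<rho>: "\<eta> = restricted_trace G n \<rho>"
      by (auto simp: irr_characters_discrete_eq)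
    have n: "n > 0" and \<eta>1: "\<eta> \<one>\<^bsub>G\<^esub> = of_nat n"
      using \<rho> mtrace_hom_one[OF G] by (auto simp: \<eta>\<rho> restricted_trace_def irreducible_hom_def)
    have "(\<Sum>b\<in>carrier G. \<Sum>a\<in>carrier G. \<eta> (?C b a \<otimes>\<^bsub>G\<^esub> c)) =
        (of_nat (order G) / of_nat n)\<^sup>2 * \<eta> c"
      using frobenius_scalar[OF G fin \<rho> c] c by (simp add: \<eta>\<rho> restricted_trace_def)
    then show "\<eta> \<one>\<^bsub>G\<^esub> * (\<Sum>b\<in>carrier G. \<Sum>a\<in>carrier G. \<eta> (?C b a \<otimes>\<^bsub>G\<^esub> c)) =
        (of_nat (order G))\<^sup>2 * (\<eta> c / \<eta> \<one>\<^bsub>G\<^esub>)"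
      using n by (simp add: \<eta>1 power2_eq_square field_simps)
  qed
  finally have "of_nat (order G) * of_nat (card ?A) =
      (of_nat (order G))\<^sup>2 * (\<Sum>\<eta>\<in>?Irr. \<eta> c / \<eta> \<one>\<^bsub>G\<^esub>)"
    by (simp add: sum_distrib_left)
  then show ?thesis using pos by (simp add: power2_eq_square)
qed

section \<open>Central elements and linear characters\<close>

text \<open>Translation by \<open>h\<close> multiplies the sum by \<open>\<theta> h\<close>, so the sum vanishes if \<open>\<theta> h \<noteq> 1\<close> for some \<open>h\<close>.\<close>

lemma sum_linear_character:
  fixes \<theta> :: "'a \<Rightarrow> complex"
  assumes G: "Group.group G" and fin: "finite (carrier G)"
    and mult: "\<And>g h. g \<in> carrier G \<Longrightarrow> h \<in> carrier G \<Longrightarrow> \<theta> (g \<otimes>\<^bsub>G\<^esub> h) = \<theta> g * \<theta> h"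
  shows "(\<Sum>g\<in>carrier G. \<theta> g) = (if \<forall>g\<in>carrier G. \<theta> g = 1 then of_nat (order G) else 0)"
proof (cases "\<forall>g\<in>carrier G. \<theta> g = 1")
  case True
  then show ?thesis by (simp add: order_def)
next
  case False
  interpret G: Group.group G by fact
  obtain h where h: "h \<in> carrier G" "\<theta> h \<noteq> 1" using False by blast
  have "(\<Sum>g\<in>carrier G. \<theta> g) = (\<Sum>g\<in>carrier G. \<theta> (h \<otimes>\<^bsub>G\<^esub> g))"
    by (rule sum.reindex_bij_witness[of _ "\<lambda>g. h \<otimes>\<^bsub>G\<^esub> g" "\<lambda>g. inv\<^bsub>G\<^esub> h \<otimes>\<^bsub>G\<^esub> g"])
      (use h in \<open>auto simp: G.m_assoc[symmetric]\<close>)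
  also have "\<dots> = \<theta> h * (\<Sum>g\<in>carrier G. \<theta> g)"
    using h mult by (simp add: sum_distrib_left)
  finally have "(1 - \<theta> h) * (\<Sum>g\<in>carrier G. \<theta> g) = 0" by (simp add: algebra_simps)
  then show ?thesis using h False by auto
qed

lemma irreducible_hom_central:
  assumes G: "Group.group G" and \<rho>: "irreducible_hom G n \<rho>" and c: "c \<in> carrier G"
    and central: "\<And>g. g \<in> carrier G \<Longrightarrow> c \<otimes>\<^bsub>G\<^esub> g = g \<otimes>\<^bsub>G\<^esub> c"
  obtains z where "\<rho> c = z \<cdot>\<^sub>m 1\<^sub>m n"
proof -
  have hom: "\<rho> \<in> hom G (general_linear_group n)" using \<rho> by (simp add: irreducible_hom_def)
  have "\<rho> g * \<rho> c = \<rho> c * \<rho> g" if g: "g \<in> carrier G" for g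
    using hom c g central[OF g] unfolding hom_GL_iff[OF G] by metis
  then show ?thesis
    using schur_scalar[OF G \<rho>, of "\<rho> c"] hom c that unfolding hom_GL_iff[OF G] by blast
qed

lemma mtrace_smult: "A \<in> carrier_mat n n \<Longrightarrow> mtrace n (z \<cdot>\<^sub>m A) = z * mtrace n A"
  by (simp add: mtrace_def sum_distrib_left)

lemma scalar_mat_mult:
  fixes A :: "complex mat"
  assumes "A \<in> carrier_mat n n"
  shows "z \<cdot>\<^sub>m 1\<^sub>m n * A = z \<cdot>\<^sub>m A"
  using mult_smult_assoc_mat[of "1\<^sub>m n" n n A n z] left_mult_one_mat[OF assms] assms by simp

lemma smult_smult_mat_assoc: "x \<cdot>\<^sub>m (y \<cdot>\<^sub>m A) = (x * y :: complex) \<cdot>\<^sub>m A"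
  by (intro eq_matI) (simp_all add: mult.assoc)

lemma one_smult_mat: "(1 :: complex) \<cdot>\<^sub>m A = A"
  by (intro eq_matI) simp_all

text \<open>A central element \<open>c\<close> acts by a scalar, which must be \<open>\<eta> c / \<eta> \<one>\<close>.\<close>

lemma central_character_mult:
  assumes G: "Group.group G" and \<eta>: "\<eta> \<in> irr_characters G (discrete_topology (carrier G))"
    and c: "c \<in> carrier G" and central: "\<And>g. g \<in> carrier G \<Longrightarrow> c \<otimes>\<^bsub>G\<^esub> g = g \<otimes>\<^bsub>G\<^esub> c"
    and a: "a \<in> carrier G"
  shows "\<eta> (c \<otimes>\<^bsub>G\<^esub> a) * \<eta> \<one>\<^bsub>G\<^esub> = \<eta> c * \<eta> a"
proof -
  interpret G: Group.group G by fact
  obtain n \<rho> where \<rho>: "irreducible_hom G n \<rho>" and \<eta>\<rho>: "\<eta> = restricted_trace G n \<rho>"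
    using \<eta> by (auto simp: irr_characters_discrete_eq)
  have hom: "\<rho> \<in> hom G (general_linear_group n)" using \<rho> by (simp add: irreducible_hom_def)
  obtain z where z: "\<rho> c = z \<cdot>\<^sub>m 1\<^sub>m n" by (rule irreducible_hom_central[OF G \<rho> c central])
  have \<rho>a: "\<rho> a \<in> carrier_mat n n" using hom a by (simp add: hom_GL_iff[OF G])
  have "\<rho> (c \<otimes>\<^bsub>G\<^esub> a) = z \<cdot>\<^sub>m \<rho> a"
    using hom c a by (simp add: hom_GL_iff[OF G] z scalar_mat_mult[OF \<rho>a])
  then show ?thesis
    using c a z \<rho>a mtrace_hom_one[OF G hom]
    by (simp add: \<eta>\<rho> restricted_trace_def mtrace_smult mtrace_smult_one)
qed

lemma irr_character_one_neq_0:
  assumes G: "Group.group G" and \<eta>: "\<eta> \<in> irr_characters G T"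
  shows "\<eta> \<one>\<^bsub>G\<^esub> \<noteq> 0"
proof -
  interpret G: Group.group G by fact
  obtain n \<rho> where \<rho>: "irreducible_hom G n \<rho>" and \<eta>\<rho>: "\<eta> = restricted_trace G n \<rho>"
    using \<eta> by (auto simp: irr_characters_eq)
  then show ?thesis
    using mtrace_hom_one[OF G, of \<rho> n] by (auto simp: restricted_trace_def irreducible_hom_def)
qed

lemma irr_characters_extensional: "\<eta> \<in> irr_characters G T \<Longrightarrow> \<eta> \<in> extensional (carrier G)"
  by (auto simp: irr_characters_eq restricted_trace_def)

section \<open>Averages of torus characters\<close>

lemma geometric_sum_powi:
  fixes z :: complex
  assumes "z \<noteq> 0"
  shows "(1 - z) * (\<Sum>m\<in>{- int t..int t}. z powi m) = z powi (- int t) - z powi (int t + 1)"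
proof (induction t)
  case 0
  then show ?case by simp
next
  case (Suc t)
  have "{- int (Suc t)..int (Suc t)} = insert (- int t - 1) (insert (int t + 1) {- int t..int t})"
    by auto
  then have "(\<Sum>m\<in>{- int (Suc t)..int (Suc t)}. z powi m) =
      z powi (- int t - 1) + (z powi (int t + 1) + (\<Sum>m\<in>{- int t..int t}. z powi m))"
    by simp
  then have "(1 - z) * (\<Sum>m\<in>{- int (Suc t)..int (Suc t)}. z powi m) =
      (1 - z) * z powi (- int t - 1) + (1 - z) * z powi (int t + 1) +
      (z powi (- int t) - z powi (int t + 1))"
    using Suc by (simp add: distrib_left)
  also have "z * z powi (- int t - 1) = z powi (- int t)"
    using assms power_int_add_1'[of z "- int t - 1"] by simp
  then have "(1 - z) * z powi (- int t - 1) = z powi (- int t - 1) - z powi (- int t)"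
    by (simp add: left_diff_distrib)
  also have "z * z powi (int t + 1) = z powi (int t + 2)"
    using assms power_int_add_1'[of z "int t + 1"] by (simp add: add.assoc)
  then have "(1 - z) * z powi (int t + 1) = z powi (int t + 1) - z powi (int t + 2)"
    by (simp add: left_diff_distrib)
  finally have *: "(1 - z) * (\<Sum>m\<in>{- int (Suc t)..int (Suc t)}. z powi m) =
      z powi (- int t - 1) - z powi (- int t) + (z powi (int t + 1) - z powi (int t + 2)) +
      (z powi (- int t) - z powi (int t + 1))" .
  have e: "- int (Suc t) = - int t - 1" "int (Suc t) + 1 = int t + 2" by simp_all
  have rhs: "z powi (- int t - 1) - z powi (int t + 2) =
      z powi (- int (Suc t)) - z powi (int (Suc t) + 1)" by (simp only: e)
  show ?case unfolding rhs[symmetric] * by simp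
qed

text \<open>For \<open>z \<noteq> 1\<close> the geometric sum is bounded by \<open>2 / |1 - z|\<close>, uniformly in \<open>t\<close>.\<close>

lemma average_powi_tendsto:
  fixes z :: complex
  assumes z: "norm z = 1"
  shows "(\<lambda>t. (\<Sum>m\<in>{- int t..int t}. z powi m) / of_nat (2 * t + 1)) \<longlonglongrightarrow> (if z = 1 then 1 else 0)"
proof (cases "z = 1")
  case True
  have "(\<Sum>m\<in>{- int t..int t}. z powi m) / of_nat (2 * t + 1) = 1" for t
  proof -
    have "(\<Sum>m\<in>{- int t..int t}. z powi m) = of_nat (card {- int t..int t})"
      using True by simp
    also have "card {- int t..int t} = 2 * t + 1" by simp
    finally show ?thesis by (simp del: of_nat_Suc of_nat_add)
  qed
  then have "(\<lambda>t. (\<Sum>m\<in>{- int t..int t}. z powi m) / of_nat (2 * t + 1)) = (\<lambda>t. 1)" by (rule ext)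
  then show ?thesis by (simp only: if_P[OF True] tendsto_const)
next
  case False
  have z0: "z \<noteq> 0" using z by auto
  have bound: "norm ((\<Sum>m\<in>{- int t..int t}. z powi m) / of_nat (2 * t + 1)) \<le>
      2 / norm (1 - z) * inverse (real (Suc t))" for t
  proof -
    have "norm (1 - z) * norm (\<Sum>m\<in>{- int t..int t}. z powi m) =
        norm (z powi (- int t) - z powi (int t + 1))"
      by (simp only: norm_mult[symmetric] geometric_sum_powi[OF z0])
    also have "\<dots> \<le> norm (z powi (- int t)) + norm (z powi (int t + 1))" by (rule norm_triangle_ineq4)
    also have "\<dots> = 2" using z by (simp add: norm_power_int)
    finally have "norm (\<Sum>m\<in>{- int t..int t}. z powi m) \<le> 2 / norm (1 - z)"
      using False by (simp add: field_simps)
    moreover have "inverse (real (2 * t + 1)) \<le> inverse (real (Suc t))"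
      by (rule le_imp_inverse_le) simp_all
    ultimately have "norm (\<Sum>m\<in>{- int t..int t}. z powi m) * inverse (real (2 * t + 1)) \<le>
        2 / norm (1 - z) * inverse (real (Suc t))"
      by (rule mult_mono) simp_all
    moreover have "norm (complex_of_nat (2 * t + 1)) = real (2 * t + 1)" by (rule norm_of_nat)
    ultimately show ?thesis by (simp only: norm_divide divide_inverse norm_mult norm_inverse)
  qed
  have "(\<lambda>t. 2 / norm (1 - z) * inverse (real (Suc t))) \<longlonglongrightarrow> 0"
    by (intro tendsto_mult_right_zero LIMSEQ_inverse_real_of_nat)
  then have "(\<lambda>t. (\<Sum>m\<in>{- int t..int t}. z powi m) / of_nat (2 * t + 1)) \<longlonglongrightarrow> 0"
    by (rule Lim_null_comparison[OF always_eventually[OF allI[OF bound]]])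
  then show ?thesis using False by simp
qed

lemma average_torus_characters_tendsto:
  fixes z :: "nat \<Rightarrow> complex"
  assumes z: "\<And>j. j < k \<Longrightarrow> norm (z j) = 1"
  shows "(\<lambda>t. (\<Sum>m\<in>{..<k} \<rightarrow>\<^sub>E {- int t..int t}. \<Prod>j<k. z j powi m j) / of_nat ((2 * t + 1) ^ k))
    \<longlonglongrightarrow> (if \<forall>j<k. z j = 1 then 1 else 0)"
proof -
  have "(\<Sum>m\<in>{..<k} \<rightarrow>\<^sub>E {- int t..int t}. \<Prod>j<k. z j powi m j) / of_nat ((2 * t + 1) ^ k) =
      (\<Prod>j<k. (\<Sum>m\<in>{- int t..int t}. z j powi m) / of_nat (2 * t + 1))" for t
    using prod_sum_PiE[of "{..<k}" "\<lambda>_. {- int t..int t}" "\<lambda>j m. z j powi m"]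
    by (simp add: prod_dividef del: of_nat_Suc of_nat_add)
  moreover have "(\<lambda>t. \<Prod>j<k. (\<Sum>m\<in>{- int t..int t}. z j powi m) / of_nat (2 * t + 1))
      \<longlonglongrightarrow> (\<Prod>j<k. if z j = 1 then 1 else 0)"
    by (intro tendsto_prod average_powi_tendsto z) simp
  moreover have "(\<Prod>j<k. if z j = 1 then 1 else 0 :: complex) = (if \<forall>j<k. z j = 1 then 1 else 0)"
    by (auto simp: prod_zero_iff)
  ultimately show ?thesis by simp
qed

text \<open>The point with angle \<open>1 / (t + 1)\<close> works: exponents bounded by \<open>t\<close> differ by at most \<open>2 t\<close>, and the
angle \<open>d / (t + 1)\<close> with \<open>0 < d \<le> 2 t\<close> lies strictly between \<open>0\<close> and a full turn.\<close>

lemma circle_point_separating_powi: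
  obtains z :: complex where "norm z = 1"
    "\<And>m m'. \<bar>m\<bar> \<le> int t \<Longrightarrow> \<bar>m'\<bar> \<le> int t \<Longrightarrow> z powi m = z powi m' \<Longrightarrow> m = m'"
proof -
  define z where "z = cis (1 / real (Suc t))"
  have z: "norm z = 1" "z \<noteq> 0" by (auto simp: z_def)
  have le: "\<not> m' < m" if m: "\<bar>m\<bar> \<le> int t" "\<bar>m'\<bar> \<le> int t" and eq: "z powi m = z powi m'" for m m'
  proof
    assume "m' < m"
    define d where "d = nat (m - m')"
    have d: "0 < d" "d \<le> 2 * t" "m = m' + int d" using \<open>m' < m\<close> m by (auto simp: d_def)
    have "z powi m' * z ^ d = z powi m'"
      using eq z(2) by (simp add: d(3) power_int_add)
    then have "z ^ d = 1" using z(2) by (simp add: power_int_not_zero)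
    then have "cis (real d * (1 / real (Suc t))) = 1" unfolding z_def Complex.DeMoivre .
    then have "cos (real d * (1 / real (Suc t))) = 1" by (metis cis.sel(1) one_complex.sel(1))
    moreover have "cos (real d * (1 / real (Suc t))) < cos 0"
    proof (rule cos_monotone_0_pi)
      have "real d * (1 / real (Suc t)) \<le> 2" using d(2) by (simp add: field_simps)
      then show "real d * (1 / real (Suc t)) \<le> pi" using pi_gt3 by linarith
    qed (use d in simp_all)
    ultimately show False by simp
  qed
  then show ?thesis by (intro that[OF z(1)]) (metis linorder_neqE)
qed

lemma continuous_map_complex_mult:
  fixes f g :: "'c \<Rightarrow> complex"
  assumes "continuous_map S euclidean f" "continuous_map S euclidean g"
  shows "continuous_map S euclidean (\<lambda>x. f x * g x)"
  using assms by (simp add: continuous_map_atin tendsto_mult)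

lemma continuous_map_complex_prod:
  fixes f :: "'c \<Rightarrow> 'd \<Rightarrow> complex"
  assumes "\<And>i. i \<in> I \<Longrightarrow> continuous_map S euclidean (\<lambda>x. f x i)"
  shows "continuous_map S euclidean (\<lambda>x. \<Prod>i\<in>I. f x i)"
  using assms by (simp add: continuous_map_atin tendsto_prod)

section \<open>Presentations of the group\<close>

text \<open>A group with a topology on its carrier and a presentation by its identity component and a finite group.\<close>

locale presented_group =
  fixes G :: "'a monoid" and T :: "'a topology" and k :: nat
    and \<phi> :: "'a \<Rightarrow> nat \<Rightarrow> complex"
    and \<Delta> :: "'b monoid" and N :: "'n monoid"
    and \<iota> :: "'n \<Rightarrow> 'a" and \<kappa> :: "'n \<Rightarrow> 'b" and \<Phi> :: "('a \<times> 'b) set \<Rightarrow> 'a"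
  assumes group_G: "Group.group G" and topspace_T: "topspace T = carrier G"
    and pres: "presentation G T k \<phi> \<Delta> N \<iota> \<kappa> \<Phi>"
begin

abbreviation G0 :: "'a monoid" where "G0 \<equiv> id_comp_group G T"
abbreviation T0 :: "'a topology" where "T0 \<equiv> subtopology T (carrier G0)"
abbreviation H :: "('a \<times> 'b) monoid" where "H \<equiv> G0 \<times>\<times> \<Delta>"
abbreviation K :: "('a \<times> 'b) set" where "K \<equiv> antidiagonal N \<Delta> \<iota> \<kappa>"
abbreviation q :: "'a \<times> 'b \<Rightarrow> 'a" where "q \<equiv> presentation_map G T \<Delta> N \<iota> \<kappa> \<Phi>"

lemma central_G0: "central_subgroup (carrier G0) G"
  and \<phi>_iso: "\<phi> \<in> iso G0 (torus_group k)"
  and \<phi>_homeo: "homeomorphic_map T0 (torus_topology k) \<phi>"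
  and group_\<Delta>: "Group.group \<Delta>" and finite_\<Delta>: "finite (carrier \<Delta>)"
  and group_N: "Group.group N" and finite_N: "finite (carrier N)"
  and \<iota>_mon: "\<iota> \<in> mon N G0" and \<kappa>_mon: "\<kappa> \<in> mon N \<Delta>"
  and central_K: "central_subgroup K H"
  and \<Phi>_iso: "\<Phi> \<in> iso (H Mod K) G"
  and \<Phi>_homeo: "homeomorphic_map
        (quotient_group_topology H (prod_topology T0 (discrete_topology (carrier \<Delta>))) K) T \<Phi>"
  and \<Phi>_G0: "x \<in> carrier G0 \<Longrightarrow> \<Phi> (K #>\<^bsub>H\<^esub> (x, \<one>\<^bsub>\<Delta>\<^esub>)) = x"
  using pres unfolding presentation_def Let_def by simp_all

sublocale G: Group.group G by (rule group_G)
sublocale D: Group.group \<Delta> by (rule group_\<Delta>)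
sublocale N: Group.group N by (rule group_N)

lemma subgroup_G0: "subgroup (carrier G0) G"
  using central_G0 by (simp add: central_subgroup_def)

lemma G0_simps [simp]: "x \<otimes>\<^bsub>G0\<^esub> y = x \<otimes>\<^bsub>G\<^esub> y" "\<one>\<^bsub>G0\<^esub> = \<one>\<^bsub>G\<^esub>"
  by (simp_all add: id_comp_group_def)

lemma G0_eq: "G0 = G\<lparr>carrier := carrier G0\<rparr>"
  by (simp add: id_comp_group_def)

sublocale G0: Group.group G0
  by (subst G0_eq) (rule subgroup.subgroup_is_group[OF subgroup_G0 group_G])

sublocale H: Group.group H
  by (rule DirProd_group[OF G0.is_group D.is_group])

lemma G0_closed [simp]: "x \<in> carrier G0 \<Longrightarrow> x \<in> carrier G"
  using subgroup.mem_carrier[OF subgroup_G0] .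

lemma G0_mult_closed [simp]: "x \<in> carrier G0 \<Longrightarrow> y \<in> carrier G0 \<Longrightarrow> x \<otimes>\<^bsub>G\<^esub> y \<in> carrier G0"
  using subgroup.m_closed[OF subgroup_G0] .

lemma G0_one_closed [simp]: "\<one>\<^bsub>G\<^esub> \<in> carrier G0"
  using subgroup.one_closed[OF subgroup_G0] .

lemma G0_inv [simp]: "x \<in> carrier G0 \<Longrightarrow> inv\<^bsub>G0\<^esub> x = inv\<^bsub>G\<^esub> x"
  by (subst G0_eq) (rule G.m_inv_consistent[OF subgroup_G0])

lemma G0_commute: "x \<in> carrier G0 \<Longrightarrow> g \<in> carrier G \<Longrightarrow> x \<otimes>\<^bsub>G\<^esub> g = g \<otimes>\<^bsub>G\<^esub> x"
  using central_G0 by (simp add: central_subgroup_def)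

lemma \<iota>_closed [simp]: "n \<in> carrier N \<Longrightarrow> \<iota> n \<in> carrier G0"
  and \<kappa>_closed [simp]: "n \<in> carrier N \<Longrightarrow> \<kappa> n \<in> carrier \<Delta>"
  using \<iota>_mon \<kappa>_mon by (auto simp: mon_def hom_def)

lemma \<iota>_mult: "n \<in> carrier N \<Longrightarrow> n' \<in> carrier N \<Longrightarrow> \<iota> (n \<otimes>\<^bsub>N\<^esub> n') = \<iota> n \<otimes>\<^bsub>G\<^esub> \<iota> n'"
  and \<kappa>_mult: "n \<in> carrier N \<Longrightarrow> n' \<in> carrier N \<Longrightarrow> \<kappa> (n \<otimes>\<^bsub>N\<^esub> n') = \<kappa> n \<otimes>\<^bsub>\<Delta>\<^esub> \<kappa> n'"
  using \<iota>_mon \<kappa>_mon by (auto simp: mon_def hom_def)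

lemma \<iota>_one [simp]: "\<iota> \<one>\<^bsub>N\<^esub> = \<one>\<^bsub>G\<^esub>" and \<kappa>_one [simp]: "\<kappa> \<one>\<^bsub>N\<^esub> = \<one>\<^bsub>\<Delta>\<^esub>"
  using hom_one[of \<iota> N G0] hom_one[of \<kappa> N \<Delta>] \<iota>_mon \<kappa>_mon N.is_group G0.is_group D.is_group
  by (auto simp: mon_def)

lemma \<iota>_inj: "inj_on \<iota> (carrier N)" and \<kappa>_inj: "inj_on \<kappa> (carrier N)"
  using \<iota>_mon \<kappa>_mon by (auto simp: mon_def)

lemma K_normal: "K \<lhd> H"
proof -
  have sub: "subgroup K H" and cen: "\<And>x y. x \<in> K \<Longrightarrow> y \<in> carrier H \<Longrightarrow> x \<otimes>\<^bsub>H\<^esub> y = y \<otimes>\<^bsub>H\<^esub> x"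
    using central_K by (auto simp: central_subgroup_def)
  show ?thesis
    unfolding H.normal_inv_iff
  proof (intro conjI ballI sub)
    fix x h assume x: "x \<in> carrier H" and hK: "h \<in> K"
    have h: "h \<in> carrier H" by (rule subgroup.mem_carrier[OF sub hK])
    have "x \<otimes>\<^bsub>H\<^esub> h \<otimes>\<^bsub>H\<^esub> inv\<^bsub>H\<^esub> x = h \<otimes>\<^bsub>H\<^esub> x \<otimes>\<^bsub>H\<^esub> inv\<^bsub>H\<^esub> x" by (simp only: cen[OF hK x])
    also have "\<dots> = h \<otimes>\<^bsub>H\<^esub> (x \<otimes>\<^bsub>H\<^esub> inv\<^bsub>H\<^esub> x)" by (rule H.m_assoc[OF h x H.inv_closed[OF x]])
    also have "\<dots> = h" by (simp only: H.r_inv[OF x] H.r_one[OF h])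
    finally show "x \<otimes>\<^bsub>H\<^esub> h \<otimes>\<^bsub>H\<^esub> inv\<^bsub>H\<^esub> x \<in> K" using hK by (simp only:)
  qed
qed

sublocale K: normal K H by (rule K_normal)

lemma q_eq: "q p = \<Phi> (K #>\<^bsub>H\<^esub> p)"
  by (simp add: presentation_map_def)

lemma \<Phi>_bij: "bij_betw \<Phi> (rcosets\<^bsub>H\<^esub> K) (carrier G)"
  using \<Phi>_iso by (simp add: iso_def FactGroup_def)

lemma rcoset_mem: "p \<in> carrier H \<Longrightarrow> K #>\<^bsub>H\<^esub> p \<in> rcosets\<^bsub>H\<^esub> K"
  by (auto simp: RCOSETS_def)

lemma q_closed: "p \<in> carrier H \<Longrightarrow> q p \<in> carrier G"
  using \<Phi>_bij rcoset_mem by (auto simp: q_eq bij_betw_def)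

lemma q_mult: "p \<in> carrier H \<Longrightarrow> p' \<in> carrier H \<Longrightarrow> q (p \<otimes>\<^bsub>H\<^esub> p') = q p \<otimes>\<^bsub>G\<^esub> q p'"
proof -
  assume p: "p \<in> carrier H" "p' \<in> carrier H"
  have "\<Phi> ((K #>\<^bsub>H\<^esub> p) <#>\<^bsub>H\<^esub> (K #>\<^bsub>H\<^esub> p')) = q p \<otimes>\<^bsub>G\<^esub> q p'"
    using \<Phi>_iso rcoset_mem[OF p(1)] rcoset_mem[OF p(2)]
    by (simp add: q_eq iso_def hom_def FactGroup_def)
  then show ?thesis by (simp only: q_eq K.rcos_sum[OF p])
qed

lemma q_surj: "g \<in> carrier G \<Longrightarrow> \<exists>p\<in>carrier H. q p = g"
proof -
  assume "g \<in> carrier G"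
  then have "g \<in> \<Phi> ` (rcosets\<^bsub>H\<^esub> K)" by (simp only: bij_betw_imp_surj_on[OF \<Phi>_bij])
  then obtain A where A: "g = \<Phi> A" "A \<in> rcosets\<^bsub>H\<^esub> K" by (rule imageE)
  then obtain p where p: "p \<in> carrier H" "A = K #>\<^bsub>H\<^esub> p" unfolding RCOSETS_def by blast
  show ?thesis by (rule bexI[OF _ p(1)]) (simp only: q_eq A p)
qed

lemma q_eq_iff:
  assumes "p \<in> carrier H" "p' \<in> carrier H"
  shows "q p = q p' \<longleftrightarrow> p' \<in> K #>\<^bsub>H\<^esub> p"
proof -
  have "q p = q p' \<longleftrightarrow> K #>\<^bsub>H\<^esub> p = K #>\<^bsub>H\<^esub> p'"
    using \<Phi>_bij rcoset_mem[OF assms(1)] rcoset_mem[OF assms(2)]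
    by (auto simp: q_eq bij_betw_def inj_on_def)
  also have "\<dots> \<longleftrightarrow> p' \<in> K #>\<^bsub>H\<^esub> p"
    using H.repr_independence[OF _ assms(1) K.subgroup_axioms, of p']
      H.rcos_self[OF assms(2) K.subgroup_axioms] by blast
  finally show ?thesis .
qed

text \<open>The restriction of the quotient map to the finite factor. It is injective, because the antidiagonal
meets that factor trivially.\<close>

definition \<delta> :: "'b \<Rightarrow> 'a" where "\<delta> a = q (\<one>\<^bsub>G\<^esub>, a)"

lemma q_G0: "x \<in> carrier G0 \<Longrightarrow> q (x, \<one>\<^bsub>\<Delta>\<^esub>) = x"
  by (simp add: q_eq \<Phi>_G0)

lemma q_pair: "x \<in> carrier G0 \<Longrightarrow> a \<in> carrier \<Delta> \<Longrightarrow> q (x, a) = x \<otimes>\<^bsub>G\<^esub> \<delta> a"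
  using q_mult[of "(x, \<one>\<^bsub>\<Delta>\<^esub>)" "(\<one>\<^bsub>G\<^esub>, a)"] by (simp add: \<delta>_def q_G0)

lemma \<delta>_closed [simp]: "a \<in> carrier \<Delta> \<Longrightarrow> \<delta> a \<in> carrier G"
  by (simp add: \<delta>_def q_closed)

lemma \<delta>_mult: "a \<in> carrier \<Delta> \<Longrightarrow> b \<in> carrier \<Delta> \<Longrightarrow> \<delta> (a \<otimes>\<^bsub>\<Delta>\<^esub> b) = \<delta> a \<otimes>\<^bsub>G\<^esub> \<delta> b"
  using q_mult[of "(\<one>\<^bsub>G\<^esub>, a)" "(\<one>\<^bsub>G\<^esub>, b)"] by (simp add: \<delta>_def)

lemma \<delta>_one [simp]: "\<delta> \<one>\<^bsub>\<Delta>\<^esub> = \<one>\<^bsub>G\<^esub>"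
  by (simp add: \<delta>_def q_G0)

lemma \<delta>_inv: "a \<in> carrier \<Delta> \<Longrightarrow> \<delta> (inv\<^bsub>\<Delta>\<^esub> a) = inv\<^bsub>G\<^esub> (\<delta> a)"
  using \<delta>_mult[of "inv\<^bsub>\<Delta>\<^esub> a" a] by (intro G.inv_equality[symmetric]) auto

lemma factorisation:
  assumes "g \<in> carrier G"
  obtains x a where "x \<in> carrier G0" "a \<in> carrier \<Delta>" "g = x \<otimes>\<^bsub>G\<^esub> \<delta> a"
proof -
  obtain p where p: "p \<in> carrier H" "q p = g" using q_surj[OF assms] by blast
  obtain x a where xa: "p = (x, a)" by (rule prod.exhaust)
  have "x \<in> carrier G0" "a \<in> carrier \<Delta>" using p(1) by (simp_all add: xa)
  with q_pair[OF this] p(2) show thesis by (intro that[of x a]) (simp_all only: xa)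
qed

lemma factorisation_mult:
  assumes "x \<in> carrier G0" "a \<in> carrier \<Delta>" "y \<in> carrier G0" "b \<in> carrier \<Delta>"
  shows "(x \<otimes>\<^bsub>G\<^esub> \<delta> a) \<otimes>\<^bsub>G\<^esub> (y \<otimes>\<^bsub>G\<^esub> \<delta> b) = (x \<otimes>\<^bsub>G\<^esub> y) \<otimes>\<^bsub>G\<^esub> \<delta> (a \<otimes>\<^bsub>\<Delta>\<^esub> b)"
  using q_mult[of "(x, a)" "(y, b)"] assms by (simp add: q_pair)

text \<open>The kernel of the quotient map is the antidiagonal copy of \<open>N\<close>, which acts by
\<open>(x, a) \<mapsto> (\<iota> n x, (\<kappa> n)\<^sup>-\<^sup>1 a)\<close>.\<close>

lemma factorisation_eq_iff:
  assumes "x \<in> carrier G0" "a \<in> carrier \<Delta>" "y \<in> carrier G0" "b \<in> carrier \<Delta>"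
  shows "x \<otimes>\<^bsub>G\<^esub> \<delta> a = y \<otimes>\<^bsub>G\<^esub> \<delta> b \<longleftrightarrow>
    (\<exists>n\<in>carrier N. y = \<iota> n \<otimes>\<^bsub>G\<^esub> x \<and> b = inv\<^bsub>\<Delta>\<^esub> (\<kappa> n) \<otimes>\<^bsub>\<Delta>\<^esub> a)"
proof -
  have "(y, b) \<in> K #>\<^bsub>H\<^esub> (x, a) \<longleftrightarrow>
      (\<exists>n\<in>carrier N. y = \<iota> n \<otimes>\<^bsub>G\<^esub> x \<and> b = inv\<^bsub>\<Delta>\<^esub> (\<kappa> n) \<otimes>\<^bsub>\<Delta>\<^esub> a)"
    unfolding r_coset_def antidiagonal_def by auto
  moreover have "q (x, a) = q (y, b) \<longleftrightarrow> (y, b) \<in> K #>\<^bsub>H\<^esub> (x, a)"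
    by (rule q_eq_iff) (use assms in simp_all)
  ultimately show ?thesis using assms by (simp only: q_pair)
qed

lemma \<kappa>_central:
  assumes n: "n \<in> carrier N" and a: "a \<in> carrier \<Delta>"
  shows "inv\<^bsub>\<Delta>\<^esub> (\<kappa> n) \<otimes>\<^bsub>\<Delta>\<^esub> a = a \<otimes>\<^bsub>\<Delta>\<^esub> inv\<^bsub>\<Delta>\<^esub> (\<kappa> n)"
proof -
  have "(\<iota> n, inv\<^bsub>\<Delta>\<^esub> (\<kappa> n)) \<otimes>\<^bsub>H\<^esub> (\<one>\<^bsub>G\<^esub>, a) = (\<one>\<^bsub>G\<^esub>, a) \<otimes>\<^bsub>H\<^esub> (\<iota> n, inv\<^bsub>\<Delta>\<^esub> (\<kappa> n))"
    using central_K n a unfolding central_subgroup_def antidiagonal_def by auto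
  then show ?thesis by simp
qed

text \<open>The factors in the central subgroup \<open>G0\<close> cancel.\<close>

lemma commutator_factorisation:
  assumes "x \<in> carrier G0" "a \<in> carrier \<Delta>" "y \<in> carrier G0" "b \<in> carrier \<Delta>"
  shows "commutator_map G (x \<otimes>\<^bsub>G\<^esub> \<delta> a, y \<otimes>\<^bsub>G\<^esub> \<delta> b) =
    \<delta> (a \<otimes>\<^bsub>\<Delta>\<^esub> b \<otimes>\<^bsub>\<Delta>\<^esub> inv\<^bsub>\<Delta>\<^esub> a \<otimes>\<^bsub>\<Delta>\<^esub> inv\<^bsub>\<Delta>\<^esub> b)"
proof -
  let ?A = "\<delta> a" and ?B = "\<delta> b"
  have c: "?A \<in> carrier G" "?B \<in> carrier G" "x \<in> carrier G" "y \<in> carrier G" using assms by auto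
  have xinv: "inv\<^bsub>G\<^esub> x \<in> carrier G0" "inv\<^bsub>G\<^esub> y \<in> carrier G0"
    using assms G0.inv_closed[of x] G0.inv_closed[of y] by auto
  have "(x \<otimes>\<^bsub>G\<^esub> ?A) \<otimes>\<^bsub>G\<^esub> (y \<otimes>\<^bsub>G\<^esub> ?B) = x \<otimes>\<^bsub>G\<^esub> ((?A \<otimes>\<^bsub>G\<^esub> y) \<otimes>\<^bsub>G\<^esub> ?B)"
    using c by (simp add: G.m_assoc)
  also have "\<dots> = x \<otimes>\<^bsub>G\<^esub> y \<otimes>\<^bsub>G\<^esub> (?A \<otimes>\<^bsub>G\<^esub> ?B)"
    using c by (simp add: G0_commute[OF assms(3) c(1), symmetric] G.m_assoc)
  finally have 1: "(x \<otimes>\<^bsub>G\<^esub> ?A) \<otimes>\<^bsub>G\<^esub> (y \<otimes>\<^bsub>G\<^esub> ?B) = x \<otimes>\<^bsub>G\<^esub> y \<otimes>\<^bsub>G\<^esub> (?A \<otimes>\<^bsub>G\<^esub> ?B)" .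
  have "(y \<otimes>\<^bsub>G\<^esub> ?B) \<otimes>\<^bsub>G\<^esub> (x \<otimes>\<^bsub>G\<^esub> ?A) = y \<otimes>\<^bsub>G\<^esub> ((?B \<otimes>\<^bsub>G\<^esub> x) \<otimes>\<^bsub>G\<^esub> ?A)"
    using c by (simp add: G.m_assoc)
  also have "\<dots> = y \<otimes>\<^bsub>G\<^esub> x \<otimes>\<^bsub>G\<^esub> (?B \<otimes>\<^bsub>G\<^esub> ?A)"
    using c by (simp add: G0_commute[OF assms(1) c(2), symmetric] G.m_assoc)
  finally have 2: "(y \<otimes>\<^bsub>G\<^esub> ?B) \<otimes>\<^bsub>G\<^esub> (x \<otimes>\<^bsub>G\<^esub> ?A) = x \<otimes>\<^bsub>G\<^esub> y \<otimes>\<^bsub>G\<^esub> (?B \<otimes>\<^bsub>G\<^esub> ?A)"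
    by (simp only: G0_commute[OF assms(1) c(4)])
  have "commutator_map G (x \<otimes>\<^bsub>G\<^esub> ?A, y \<otimes>\<^bsub>G\<^esub> ?B) =
      (x \<otimes>\<^bsub>G\<^esub> ?A) \<otimes>\<^bsub>G\<^esub> (y \<otimes>\<^bsub>G\<^esub> ?B) \<otimes>\<^bsub>G\<^esub> inv\<^bsub>G\<^esub> ((y \<otimes>\<^bsub>G\<^esub> ?B) \<otimes>\<^bsub>G\<^esub> (x \<otimes>\<^bsub>G\<^esub> ?A))"
    using c by (simp add: commutator_map_def G.inv_mult_group G.m_assoc)
  also have "\<dots> = x \<otimes>\<^bsub>G\<^esub> y \<otimes>\<^bsub>G\<^esub> (?A \<otimes>\<^bsub>G\<^esub> ?B \<otimes>\<^bsub>G\<^esub> inv\<^bsub>G\<^esub> (?B \<otimes>\<^bsub>G\<^esub> ?A)) \<otimes>\<^bsub>G\<^esub> inv\<^bsub>G\<^esub> (x \<otimes>\<^bsub>G\<^esub> y)"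
    unfolding 1 2 using c by (simp add: G.inv_mult_group G.m_assoc)
  also have "\<dots> = ?A \<otimes>\<^bsub>G\<^esub> ?B \<otimes>\<^bsub>G\<^esub> inv\<^bsub>G\<^esub> (?B \<otimes>\<^bsub>G\<^esub> ?A)"
    using c G0_commute[OF G0_mult_closed[OF assms(1,3)], of "?A \<otimes>\<^bsub>G\<^esub> ?B \<otimes>\<^bsub>G\<^esub> inv\<^bsub>G\<^esub> (?B \<otimes>\<^bsub>G\<^esub> ?A)"]
    by (simp add: G.m_assoc)
  also have "\<dots> = \<delta> (a \<otimes>\<^bsub>\<Delta>\<^esub> b \<otimes>\<^bsub>\<Delta>\<^esub> inv\<^bsub>\<Delta>\<^esub> a \<otimes>\<^bsub>\<Delta>\<^esub> inv\<^bsub>\<Delta>\<^esub> b)"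
    using assms by (simp add: \<delta>_mult \<delta>_inv G.inv_mult_group G.m_assoc)
  finally show ?thesis .
qed

section \<open>Cosets of the identity component\<close>

definition coset :: "'b \<Rightarrow> 'a set" where "coset a = (\<lambda>x. x \<otimes>\<^bsub>G\<^esub> \<delta> a) ` carrier G0"

lemma coset_subset: "a \<in> carrier \<Delta> \<Longrightarrow> coset a \<subseteq> carrier G"
  by (auto simp: coset_def)

lemma coset_one: "coset \<one>\<^bsub>\<Delta>\<^esub> = carrier G0"
  by (auto simp: coset_def image_iff)

text \<open>Indexed by \<open>\<Delta>\<close>, every coset of \<open>G0\<close> occurs \<open>|N|\<close> times. Counting with this multiplicity replaces a
choice of coset representatives.\<close>

lemma card_cosets_containing:
  assumes g: "g \<in> carrier G"
  shows "card {a \<in> carrier \<Delta>. g \<in> coset a} = order N"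
proof -
  obtain x b where xb: "x \<in> carrier G0" "b \<in> carrier \<Delta>" "g = x \<otimes>\<^bsub>G\<^esub> \<delta> b"
    by (rule factorisation[OF g])
  have "{a \<in> carrier \<Delta>. g \<in> coset a} = (\<lambda>n. inv\<^bsub>\<Delta>\<^esub> (\<kappa> n) \<otimes>\<^bsub>\<Delta>\<^esub> b) ` carrier N"
  proof (intro equalityI subsetI)
    fix a assume "a \<in> {a \<in> carrier \<Delta>. g \<in> coset a}"
    then obtain y where "a \<in> carrier \<Delta>" "y \<in> carrier G0" "x \<otimes>\<^bsub>G\<^esub> \<delta> b = y \<otimes>\<^bsub>G\<^esub> \<delta> a"
      using xb by (auto simp: coset_def)
    then show "a \<in> (\<lambda>n. inv\<^bsub>\<Delta>\<^esub> (\<kappa> n) \<otimes>\<^bsub>\<Delta>\<^esub> b) ` carrier N"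
      using factorisation_eq_iff[OF xb(1,2)] by blast
  next
    fix a assume "a \<in> (\<lambda>n. inv\<^bsub>\<Delta>\<^esub> (\<kappa> n) \<otimes>\<^bsub>\<Delta>\<^esub> b) ` carrier N"
    then obtain n where n: "n \<in> carrier N" "a = inv\<^bsub>\<Delta>\<^esub> (\<kappa> n) \<otimes>\<^bsub>\<Delta>\<^esub> b" by blast
    have "x \<otimes>\<^bsub>G\<^esub> \<delta> b = (\<iota> n \<otimes>\<^bsub>G\<^esub> x) \<otimes>\<^bsub>G\<^esub> \<delta> a"
      using factorisation_eq_iff[OF xb(1,2), of "\<iota> n \<otimes>\<^bsub>G\<^esub> x" a] n xb by auto
    then show "a \<in> {a \<in> carrier \<Delta>. g \<in> coset a}"
      using n xb by (auto simp: coset_def)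
  qed
  moreover have "inj_on (\<lambda>n. inv\<^bsub>\<Delta>\<^esub> (\<kappa> n) \<otimes>\<^bsub>\<Delta>\<^esub> b) (carrier N)"
  proof (rule inj_onI)
    fix n n' assume n: "n \<in> carrier N" "n' \<in> carrier N"
      and "inv\<^bsub>\<Delta>\<^esub> (\<kappa> n) \<otimes>\<^bsub>\<Delta>\<^esub> b = inv\<^bsub>\<Delta>\<^esub> (\<kappa> n') \<otimes>\<^bsub>\<Delta>\<^esub> b"
    then have "inv\<^bsub>\<Delta>\<^esub> (\<kappa> n) = inv\<^bsub>\<Delta>\<^esub> (\<kappa> n')" using xb(2) by simp
    then have "\<kappa> n = \<kappa> n'" using n by (metis D.inv_inv \<kappa>_closed)
    then show "n = n'" using \<kappa>_inj n by (auto simp: inj_on_def)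
  qed
  ultimately show ?thesis by (simp add: card_image order_def)
qed

text \<open>The topology of \<open>G\<close> is the quotient topology, since the presentation is a homeomorphism.\<close>

lemma openin_T_iff:
  assumes U: "U \<subseteq> carrier G"
  shows "openin T U \<longleftrightarrow>
    openin (prod_topology T0 (discrete_topology (carrier \<Delta>))) {p \<in> carrier H. q p \<in> U}"
proof -
  let ?S = "prod_topology T0 (discrete_topology (carrier \<Delta>))"
  let ?Q = "quotient_group_topology H ?S K"
  define \<U> where "\<U> = {A \<in> rcosets\<^bsub>H\<^esub> K. \<Phi> A \<in> U}"
  have openQ: "openin ?Q \<V> \<longleftrightarrow> \<V> \<subseteq> rcosets\<^bsub>H\<^esub> K \<and> openin ?S (\<Union>\<V>)" for \<V>
    by (rule openin_quotient_group_topology[OF H.is_group K.subgroup_axioms])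
  have "\<Union>(rcosets\<^bsub>H\<^esub> K) = topspace ?S"
    using H.rcosets_part_G[OF K.subgroup_axioms] topspace_T by (auto simp: DirProd_def)
  then have "openin ?Q (rcosets\<^bsub>H\<^esub> K)" by (simp only: openQ openin_topspace subset_refl)
  then have topQ: "topspace ?Q = rcosets\<^bsub>H\<^esub> K"
    using openQ[of "topspace ?Q"] openin_subset by blast
  have img: "\<Phi> ` \<U> = U"
    using \<Phi>_bij U by (auto simp: \<U>_def bij_betw_def)
  have un: "\<Union>\<U> = {p \<in> carrier H. q p \<in> U}"
  proof (intro equalityI subsetI)
    fix p assume "p \<in> \<Union>\<U>"
    then obtain p' where p': "p' \<in> carrier H" "p \<in> K #>\<^bsub>H\<^esub> p'" "\<Phi> (K #>\<^bsub>H\<^esub> p') \<in> U"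
      by (auto simp: \<U>_def RCOSETS_def)
    have "p \<in> carrier H" using p' H.r_coset_subset_G[OF K.subset] by blast
    moreover have "q p' = q p" using q_eq_iff[of p' p] p' \<open>p \<in> carrier H\<close> by simp
    ultimately show "p \<in> {p \<in> carrier H. q p \<in> U}" using p' by (simp add: q_eq)
  next
    fix p assume p: "p \<in> {p \<in> carrier H. q p \<in> U}"
    then have "K #>\<^bsub>H\<^esub> p \<in> \<U>" using rcoset_mem by (auto simp: \<U>_def q_eq)
    moreover have "p \<in> K #>\<^bsub>H\<^esub> p" using p H.rcos_self[OF _ K.subgroup_axioms] by blast
    ultimately show "p \<in> \<Union>\<U>" by blast
  qed
  have "openin T (\<Phi> ` \<U>) \<longleftrightarrow> openin ?Q \<U>"
  proof (rule homeomorphic_map_openness[OF \<Phi>_homeo])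
    show "\<U> \<subseteq> topspace ?Q" unfolding topQ \<U>_def by blast
  qed
  moreover have "\<U> \<subseteq> rcosets\<^bsub>H\<^esub> K" unfolding \<U>_def by blast
  ultimately show ?thesis by (simp only: img openQ un simp_thms)
qed

lemma topspace_T0: "topspace T0 = carrier G0"
proof -
  have "carrier G0 \<subseteq> carrier G" by (rule subsetI) (rule G0_closed)
  then show ?thesis by (simp only: topspace_subtopology topspace_T Int_absorb1)
qed

text \<open>The preimage of a coset in \<open>G0 \<times> \<Delta>\<close> is the product of \<open>G0\<close> with a subset of the discrete factor.\<close>

lemma openin_coset:
  assumes a: "a \<in> carrier \<Delta>"
  shows "openin T (coset a)"
proof -
  have mem: "x \<otimes>\<^bsub>G\<^esub> \<delta> b \<in> coset a \<longleftrightarrow> \<delta> b \<in> coset a" if "x \<in> carrier G0" "b \<in> carrier \<Delta>" for x b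
  proof
    assume "x \<otimes>\<^bsub>G\<^esub> \<delta> b \<in> coset a"
    then obtain y where y: "y \<in> carrier G0" "x \<otimes>\<^bsub>G\<^esub> \<delta> b = y \<otimes>\<^bsub>G\<^esub> \<delta> a" by (auto simp: coset_def)
    have xi: "inv\<^bsub>G\<^esub> x \<in> carrier G0" using G0.inv_closed[of x] that by simp
    have "\<delta> b = inv\<^bsub>G\<^esub> x \<otimes>\<^bsub>G\<^esub> (x \<otimes>\<^bsub>G\<^esub> \<delta> b)" using that by (simp add: G.m_assoc[symmetric])
    also have "\<dots> = inv\<^bsub>G\<^esub> x \<otimes>\<^bsub>G\<^esub> y \<otimes>\<^bsub>G\<^esub> \<delta> a" using y that a by (simp add: G.m_assoc)
    finally show "\<delta> b \<in> coset a" using xi y by (auto simp: coset_def)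
  next
    assume "\<delta> b \<in> coset a"
    then obtain y where y: "y \<in> carrier G0" "\<delta> b = y \<otimes>\<^bsub>G\<^esub> \<delta> a" by (auto simp: coset_def)
    then have "x \<otimes>\<^bsub>G\<^esub> \<delta> b = x \<otimes>\<^bsub>G\<^esub> y \<otimes>\<^bsub>G\<^esub> \<delta> a" using that a by (simp add: G.m_assoc)
    then show "x \<otimes>\<^bsub>G\<^esub> \<delta> b \<in> coset a" using that y by (auto simp: coset_def)
  qed
  have "{p \<in> carrier H. q p \<in> coset a} = carrier G0 \<times> {b \<in> carrier \<Delta>. \<delta> b \<in> coset a}"
    by (auto simp: q_pair mem)
  moreover have "openin (prod_topology T0 (discrete_topology (carrier \<Delta>)))
      (carrier G0 \<times> {b \<in> carrier \<Delta>. \<delta> b \<in> coset a})"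
    using openin_topspace[of T0] unfolding topspace_T0
    by (auto simp: openin_prod_Times_iff)
  ultimately show ?thesis using openin_T_iff[OF coset_subset[OF a]] by simp
qed

lemma continuous_map_T_if:
  fixes f :: "'a \<Rightarrow> complex"
  assumes f: "\<And>a. a \<in> carrier \<Delta> \<Longrightarrow> continuous_map T0 euclidean (\<lambda>x. f (x \<otimes>\<^bsub>G\<^esub> \<delta> a))"
  shows "continuous_map T euclidean f"
  unfolding continuous_map_def
proof (intro conjI allI impI)
  fix U :: "complex set" assume U: "openin euclidean U"
  let ?S = "prod_topology T0 (discrete_topology (carrier \<Delta>))"
  let ?V = "{g \<in> topspace T. f g \<in> U}"
  have "{p \<in> carrier H. q p \<in> ?V} =
      (\<Union>a\<in>carrier \<Delta>. {x \<in> topspace T0. f (x \<otimes>\<^bsub>G\<^esub> \<delta> a) \<in> U} \<times> {a})"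
    unfolding topspace_T0 by (auto simp: q_pair topspace_T)
  moreover have "openin ?S ({x \<in> topspace T0. f (x \<otimes>\<^bsub>G\<^esub> \<delta> a) \<in> U} \<times> {a})"
    if "a \<in> carrier \<Delta>" for a
    using f[OF that] U that by (auto simp: openin_prod_Times_iff continuous_map_def)
  ultimately have "openin ?S {p \<in> carrier H. q p \<in> ?V}" by auto
  then show "openin T ?V" using openin_T_iff[of ?V] topspace_T by auto
qed simp

section \<open>The measure of a commutator fibre\<close>

abbreviation comm\<Delta> :: "'b \<Rightarrow> 'b \<Rightarrow> 'b" where
  "comm\<Delta> a b \<equiv> a \<otimes>\<^bsub>\<Delta>\<^esub> b \<otimes>\<^bsub>\<Delta>\<^esub> inv\<^bsub>\<Delta>\<^esub> a \<otimes>\<^bsub>\<Delta>\<^esub> inv\<^bsub>\<Delta>\<^esub> b"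

lemma sum_indicator_cosets:
  assumes "g \<in> carrier G"
  shows "(\<Sum>a\<in>carrier \<Delta>. indicator (coset a) g :: real) = of_nat (order N)"
proof -
  have "(\<Sum>a\<in>carrier \<Delta>. indicator (coset a) g :: real) =
      of_nat (card {a \<in> carrier \<Delta>. g \<in> coset a})"
    using finite_\<Delta> by (simp add: indicator_def sum.If_cases Int_def)
  then show ?thesis by (simp add: card_cosets_containing[OF assms])
qed

lemma commutator_in_cosets:
  assumes "a \<in> carrier \<Delta>" "b \<in> carrier \<Delta>" "g \<in> coset a" "h \<in> coset b"
  shows "commutator_map G (g, h) = \<delta> (comm\<Delta> a b)"
proof -
  obtain x y where "x \<in> carrier G0" "g = x \<otimes>\<^bsub>G\<^esub> \<delta> a" "y \<in> carrier G0" "h = y \<otimes>\<^bsub>G\<^esub> \<delta> b"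
    using assms unfolding coset_def by blast
  then show ?thesis using commutator_factorisation[of x a y b] assms by simp
qed

text \<open>By left invariance all cosets have the same measure \<open>m\<close>. They cover \<open>G\<close> exactly \<open>|N|\<close> times, so
\<open>|\<Delta>| m = |N|\<close>. The products of two cosets whose commutator is \<open>g0\<close> cover the fibre exactly \<open>|N|\<^sup>2\<close>
times, so \<open>|N|\<^sup>2\<close> times the measure of the fibre is \<open>m\<^sup>2\<close> times their number.\<close>

lemma measure_commutator_fibre:
  assumes haar: "normalised_haar_measure G T \<mu>"
  shows "measure (\<mu> \<Otimes>\<^sub>M \<mu>) (commutator_map G -` {g0} \<inter> (carrier G \<times> carrier G)) =
    of_nat (card {(a, b). a \<in> carrier \<Delta> \<and> b \<in> carrier \<Delta> \<and> \<delta> (comm\<Delta> a b) = g0}) / (of_nat (order \<Delta>))\<^sup>2"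
proof -
  let ?F = "commutator_map G -` {g0} \<inter> (carrier G \<times> carrier G)"
  define A where "A = {(a, b). a \<in> carrier \<Delta> \<and> b \<in> carrier \<Delta> \<and> \<delta> (comm\<Delta> a b) = g0}"
  have finA: "finite A"
    by (rule finite_subset[of _ "carrier \<Delta> \<times> carrier \<Delta>"]) (auto simp: A_def finite_\<Delta>)
  have Pow: "{U. openin T U} \<subseteq> Pow (topspace T)" by (auto dest: openin_subset)
  have eq: "sets \<mu> = sets (sigma (topspace T) {U. openin T U})"
    using haar by (simp add: normalised_haar_measure_def)
  then have sets: "sets \<mu> = sigma_sets (topspace T) {U. openin T U}"
    by (simp only: sets_measure_of[OF Pow])
  have space: "space \<mu> = carrier G"
    using sets_eq_imp_space_eq[OF eq] space_measure_of[OF Pow] by (simp only: topspace_T)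
  interpret P: prob_space \<mu>
    by (rule prob_spaceI) (use haar in \<open>simp add: normalised_haar_measure_def space topspace_T\<close>)
  interpret PP: pair_prob_space \<mu> \<mu> ..
  have coset_sets: "coset a \<in> sets \<mu>" if "a \<in> carrier \<Delta>" for a
    unfolding sets by (rule sigma_sets.Basic) (use openin_coset[OF that] in simp)
  define m where "m = measure \<mu> (carrier G0)"
  have coset_measure: "measure \<mu> (coset a) = m" if a: "a \<in> carrier \<Delta>" for a
  proof -
    have "\<delta> a <#\<^bsub>G\<^esub> carrier G0 = coset a"
      unfolding l_coset_def coset_def UNION_singleton_eq_range
      by (intro image_cong refl G0_commute[symmetric] \<delta>_closed a)
    moreover have "carrier G0 \<in> sets \<mu>"
      using coset_sets[OF D.one_closed] by (simp only: coset_one)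
    ultimately have "emeasure \<mu> (coset a) = emeasure \<mu> (carrier G0)"
      using haar a unfolding normalised_haar_measure_def by (metis \<delta>_closed)
    then show ?thesis by (simp only: m_def measure_def)
  qed
  have pos: "order \<Delta> > 0" "order N > 0"
    using finite_\<Delta> finite_N D.one_closed N.one_closed by (auto simp: order_def card_gt_0_iff)
  have "of_nat (order \<Delta>) * m = (\<Sum>a\<in>carrier \<Delta>. measure \<mu> (coset a))"
    by (simp add: coset_measure order_def)
  also have "\<dots> = (\<Sum>a\<in>carrier \<Delta>. \<integral>g. indicator (coset a) g \<partial>\<mu>)"
    using coset_sets sets.sets_into_space by (intro sum.cong refl) (simp add: Int_absorb2)
  also have "\<dots> = (\<integral>g. (\<Sum>a\<in>carrier \<Delta>. indicator (coset a) g) \<partial>\<mu>)"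
    using coset_sets
    by (intro Bochner_Integration.integral_sum[symmetric] P.integrable_const_bound[of _ 1])
       (auto simp: indicator_def)
  also have "\<dots> = (\<integral>g. of_nat (order N) \<partial>\<mu>)"
    by (intro Bochner_Integration.integral_cong refl sum_indicator_cosets) (simp add: space)
  also have "\<dots> = of_nat (order N)" by (simp add: P.prob_space)
  finally have m: "of_nat (order \<Delta>) * m = of_nat (order N)" .
  define R where "R i = coset (fst i) \<times> coset (snd i)" for i
  have rect: "R i \<in> sets (\<mu> \<Otimes>\<^sub>M \<mu>)" "measure (\<mu> \<Otimes>\<^sub>M \<mu>) (R i) = m\<^sup>2" if "i \<in> A" for i
  proof -
    have ab: "fst i \<in> carrier \<Delta>" "snd i \<in> carrier \<Delta>" using that by (auto simp: A_def)
    show "R i \<in> sets (\<mu> \<Otimes>\<^sub>M \<mu>)" using coset_sets ab by (simp add: R_def)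
    have "emeasure (\<mu> \<Otimes>\<^sub>M \<mu>) (R i) = emeasure \<mu> (coset (fst i)) * emeasure \<mu> (coset (snd i))"
      unfolding R_def using coset_sets ab by (intro P.emeasure_pair_measure_Times)
    then show "measure (\<mu> \<Otimes>\<^sub>M \<mu>) (R i) = m\<^sup>2"
      using coset_measure[OF ab(1)] coset_measure[OF ab(2)]
      by (simp add: measure_def enn2real_mult power2_eq_square)
  qed
  \<comment> \<open>Every pair lies in exactly \<open>|N|\<^sup>2\<close> of the products of cosets, and whether it lies in the
      fibre is decided by any one of them.\<close>
  have cover: "(\<Sum>i\<in>A. indicator (R i) p :: real) = (of_nat (order N))\<^sup>2 * indicator ?F p"
    if p: "p \<in> carrier G \<times> carrier G" for p
  proof -
    obtain g h where gh: "p = (g, h)" "g \<in> carrier G" "h \<in> carrier G" using p by auto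
    let ?t = "\<lambda>a b. indicator (coset a) g * (indicator (coset b) h * indicator ?F p) :: real"
    have "(\<Sum>i\<in>A. indicator (R i) p :: real) = (\<Sum>i\<in>carrier \<Delta> \<times> carrier \<Delta>. ?t (fst i) (snd i))"
    proof (rule sum.mono_neutral_cong_left)
      show "finite (carrier \<Delta> \<times> carrier \<Delta>)" using finite_\<Delta> by simp
      show "A \<subseteq> carrier \<Delta> \<times> carrier \<Delta>" by (auto simp: A_def)
    next
      show "\<forall>i\<in>carrier \<Delta> \<times> carrier \<Delta> - A. ?t (fst i) (snd i) = 0"
      proof
        fix i assume i: "i \<in> carrier \<Delta> \<times> carrier \<Delta> - A"
        show "?t (fst i) (snd i) = 0"
          using commutator_in_cosets[of "fst i" "snd i" g h] i gh
          by (auto simp: A_def indicator_def)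
      qed
    next
      fix i assume i: "i \<in> A"
      show "indicator (R i) p = ?t (fst i) (snd i)"
        using commutator_in_cosets[of "fst i" "snd i" g h] i gh
        by (auto simp: A_def R_def indicator_def)
    qed
    also have "\<dots> = (\<Sum>a\<in>carrier \<Delta>. \<Sum>b\<in>carrier \<Delta>. ?t a b)"
      by (simp add: sum.cartesian_product split_beta)
    also have "\<dots> = (\<Sum>a\<in>carrier \<Delta>. indicator (coset a) g) *
        ((\<Sum>b\<in>carrier \<Delta>. indicator (coset b) h) * indicator ?F p)"
      by (simp only: flip: sum_distrib_left sum_distrib_right)
    also have "\<dots> = (of_nat (order N))\<^sup>2 * indicator ?F p"
      using gh by (simp add: sum_indicator_cosets power2_eq_square)
    finally show ?thesis .
  qed
  have "?F = (\<Union>i\<in>A. R i)"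
  proof (rule Set.set_eqI)
    fix p
    show "p \<in> ?F \<longleftrightarrow> p \<in> (\<Union>i\<in>A. R i)"
    proof (cases "p \<in> carrier G \<times> carrier G")
      case True
      have "p \<in> ?F \<longleftrightarrow> (\<Sum>i\<in>A. indicator (R i) p :: real) \<noteq> 0"
        unfolding cover[OF True] using pos by (simp add: indicator_def)
      also have "\<dots> \<longleftrightarrow> (\<exists>i\<in>A. p \<in> R i)"
        using finA by (subst sum_nonneg_eq_0_iff) (auto simp: indicator_def)
      finally show ?thesis by (simp only: UN_iff)
    next
      case False
      moreover have "R i \<subseteq> carrier G \<times> carrier G" if "i \<in> A" for i
        using that coset_subset[of "fst i"] coset_subset[of "snd i"] by (auto simp: A_def R_def)
      ultimately show ?thesis by blast
    qed
  qed
  then have F: "?F \<in> sets (\<mu> \<Otimes>\<^sub>M \<mu>)"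
    using finA rect(1) by (simp only: sets.finite_UN)
  have "of_nat (card A) * m\<^sup>2 = (\<Sum>i\<in>A. measure (\<mu> \<Otimes>\<^sub>M \<mu>) (R i))"
    using rect(2) by simp
  also have "\<dots> = (\<Sum>i\<in>A. \<integral>p. indicator (R i) p \<partial>(\<mu> \<Otimes>\<^sub>M \<mu>))"
    using sets.sets_into_space[OF rect(1)]
    by (intro sum.cong refl) (simp add: Int_absorb2)
  also have "\<dots> = (\<integral>p. (\<Sum>i\<in>A. indicator (R i) p) \<partial>(\<mu> \<Otimes>\<^sub>M \<mu>))"
    using rect(1)
    by (intro Bochner_Integration.integral_sum[symmetric] PP.P.integrable_const_bound[of _ 1])
       (auto simp: indicator_def)
  also have "\<dots> = (\<integral>p. (of_nat (order N))\<^sup>2 * indicator ?F p \<partial>(\<mu> \<Otimes>\<^sub>M \<mu>))"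
    by (intro Bochner_Integration.integral_cong refl cover) (simp add: space_pair_measure space)
  also have "\<dots> = (of_nat (order N))\<^sup>2 * measure (\<mu> \<Otimes>\<^sub>M \<mu>) ?F"
    using sets.sets_into_space[OF F] by (simp add: Int_absorb2)
  finally have "(of_nat (order N))\<^sup>2 * measure (\<mu> \<Otimes>\<^sub>M \<mu>) ?F = of_nat (card A) * m\<^sup>2" by simp
  moreover have "m = of_nat (order N) / of_nat (order \<Delta>)" using m pos by (simp add: field_simps)
  ultimately have "measure (\<mu> \<Otimes>\<^sub>M \<mu>) ?F = of_nat (card A) / (of_nat (order \<Delta>))\<^sup>2"
    using pos by (simp add: power_divide field_simps)
  then show ?thesis by (simp only: A_def)
qed

section \<open>Characters of the identity component\<close>

lemma torus_carrier: "carrier (torus_group k) = ({..<k} \<rightarrow>\<^sub>E sphere 0 1)"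
  by (simp add: torus_group_def circle_group_def)

lemma \<phi>_norm: "x \<in> carrier G0 \<Longrightarrow> j < k \<Longrightarrow> norm (\<phi> x j) = 1"
proof -
  assume x: "x \<in> carrier G0" and j: "j < k"
  have "\<phi> x \<in> {..<k} \<rightarrow>\<^sub>E sphere 0 1"
    using \<phi>_iso x by (auto simp: iso_def hom_def torus_carrier)
  then have "\<phi> x j \<in> sphere 0 1" using j by (auto simp: PiE_def Pi_def)
  then show ?thesis by simp
qed

lemma \<phi>_mult: "x \<in> carrier G0 \<Longrightarrow> y \<in> carrier G0 \<Longrightarrow> j < k \<Longrightarrow> \<phi> (x \<otimes>\<^bsub>G\<^esub> y) j = \<phi> x j * \<phi> y j"
proof -
  assume xy: "x \<in> carrier G0" "y \<in> carrier G0" and j: "j < k"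
  have "\<phi> (x \<otimes>\<^bsub>G0\<^esub> y) = \<phi> x \<otimes>\<^bsub>torus_group k\<^esub> \<phi> y"
    using \<phi>_iso xy unfolding iso_def hom_def by blast
  then show ?thesis using j by (simp add: torus_group_def circle_group_def)
qed

lemma \<phi>_one: "j < k \<Longrightarrow> \<phi> \<one>\<^bsub>G\<^esub> j = 1"
proof -
  assume j: "j < k"
  have "\<phi> \<one>\<^bsub>G\<^esub> j * \<phi> \<one>\<^bsub>G\<^esub> j = \<phi> \<one>\<^bsub>G\<^esub> j * 1"
    using \<phi>_mult[of "\<one>\<^bsub>G\<^esub>" "\<one>\<^bsub>G\<^esub>" j] j by simp
  moreover have "\<phi> \<one>\<^bsub>G\<^esub> j \<noteq> 0" using \<phi>_norm[of "\<one>\<^bsub>G\<^esub>" j] j by auto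
  ultimately show ?thesis by (simp only: mult_cancel_left) simp
qed

lemma \<phi>_eq_one_iff:
  assumes x: "x \<in> carrier G0"
  shows "(\<forall>j<k. \<phi> x j = 1) \<longleftrightarrow> x = \<one>\<^bsub>G\<^esub>"
proof
  assume 1: "\<forall>j<k. \<phi> x j = 1"
  have mem: "\<phi> y \<in> {..<k} \<rightarrow>\<^sub>E sphere 0 1" if "y \<in> carrier G0" for y
    using \<phi>_iso that by (auto simp: iso_def hom_def torus_carrier)
  have "\<phi> x = \<phi> \<one>\<^bsub>G\<^esub>"
    by (rule PiE_ext[OF mem[OF x] mem[OF G0_one_closed]]) (use 1 \<phi>_one in simp)
  moreover have "inj_on \<phi> (carrier G0)" using \<phi>_iso by (simp add: iso_def bij_betw_def)
  ultimately show "x = \<one>\<^bsub>G\<^esub>" using x by (simp add: inj_on_eq_iff)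
qed (simp add: \<phi>_one)

lemma \<phi>_surj:
  assumes "z \<in> {..<k} \<rightarrow>\<^sub>E sphere 0 1"
  obtains x where "x \<in> carrier G0" "\<phi> x = z"
proof -
  have "z \<in> \<phi> ` carrier G0"
    using \<phi>_iso assms by (simp add: iso_def bij_betw_def torus_carrier)
  then show ?thesis using that by blast
qed

definition weight_char :: "(nat \<Rightarrow> int) \<Rightarrow> 'a \<Rightarrow> complex" where
  "weight_char m = (\<lambda>x\<in>carrier G0. \<Prod>j<k. \<phi> x j powi m j)"

text \<open>Extensional functions, so that a torus character determines its weight.\<close>

definition weights :: "nat \<Rightarrow> (nat \<Rightarrow> int) set" where
  "weights t = ({..<k} \<rightarrow>\<^sub>E {- int t..int t})"

lemma finite_weights: "finite (weights t)"
  by (simp add: weights_def finite_PiE)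

lemma weight_char_mult:
  "x \<in> carrier G0 \<Longrightarrow> y \<in> carrier G0 \<Longrightarrow> weight_char m (x \<otimes>\<^bsub>G\<^esub> y) = weight_char m x * weight_char m y"
  by (simp add: weight_char_def \<phi>_mult power_int_mult_distrib prod.distrib)

lemma weight_char_one: "weight_char m \<one>\<^bsub>G\<^esub> = 1"
  by (simp add: weight_char_def \<phi>_one)

lemma irr_torus_upto_eq: "irr_torus_upto G0 k \<phi> t = weight_char ` weights t"
proof (intro equalityI subsetI)
  fix \<psi> assume "\<psi> \<in> irr_torus_upto G0 k \<phi> t"
  then obtain m :: "nat \<Rightarrow> int" where m: "\<forall>j<k. \<bar>m j\<bar> \<le> int t" "\<psi> = weight_char m"
    by (auto simp: irr_torus_upto_def weight_char_def)
  have "restrict m {..<k} \<in> weights t" using m by (auto simp: weights_def abs_le_iff)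
  moreover have "\<psi> = weight_char (restrict m {..<k})"
    unfolding m(2) weight_char_def by (intro restrict_ext prod.cong) auto
  ultimately show "\<psi> \<in> weight_char ` weights t" by blast
next
  fix \<psi> assume "\<psi> \<in> weight_char ` weights t"
  then obtain m where m: "m \<in> weights t" "\<psi> = weight_char m" by blast
  have "\<forall>j<k. \<bar>m j\<bar> \<le> int t" using m(1) by (auto simp: weights_def PiE_def Pi_def abs_le_iff)
  then show "\<psi> \<in> irr_torus_upto G0 k \<phi> t"
    unfolding irr_torus_upto_def m(2) weight_char_def by blast
qed

text \<open>A weight is read off from the values at torus points with only one nontrivial coordinate, taken at a
point of the circle that separates the powers up to \<open>t\<close>.\<close>

lemma inj_weight_char: "inj_on weight_char (weights t)"
proof (rule inj_onI)
  fix m m' assume m: "m \<in> weights t" "m' \<in> weights t" and eq: "weight_char m = weight_char m'"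
  obtain z :: complex where z: "norm z = 1"
    and sep: "\<And>a b. \<bar>a\<bar> \<le> int t \<Longrightarrow> \<bar>b\<bar> \<le> int t \<Longrightarrow> z powi a = z powi b \<Longrightarrow> a = b"
    using circle_point_separating_powi[of t] by blast
  have "m i = m' i" if i: "i < k" for i
  proof -
    define e where "e = (\<lambda>j\<in>{..<k}. if j = i then z else 1)"
    have "e \<in> {..<k} \<rightarrow>\<^sub>E sphere 0 1" using z by (auto simp: e_def)
    then obtain x where x: "x \<in> carrier G0" "\<phi> x = e" by (rule \<phi>_surj)
    have val: "weight_char w x = z powi w i" for w
    proof -
      have "weight_char w x = (\<Prod>j<k. e j powi w j)"
        using x by (simp add: weight_char_def)
      also have "\<dots> = (\<Prod>j<k. if j = i then z powi w i else 1)"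
        by (intro prod.cong refl) (auto simp: e_def)
      also have "\<dots> = z powi w i" using i by simp
      finally show ?thesis .
    qed
    have "\<bar>m i\<bar> \<le> int t" "\<bar>m' i\<bar> \<le> int t"
      using m i by (auto simp: weights_def PiE_def Pi_def abs_le_iff)
    moreover have "z powi m i = z powi m' i" by (simp only: val[symmetric] eq)
    ultimately show ?thesis by (rule sep)
  qed
  then show "m = m'" using m unfolding weights_def by (intro PiE_ext) auto
qed

lemma card_irr_torus_upto: "card (irr_torus_upto G0 k \<phi> t) = (2 * t + 1) ^ k"
proof -
  have "card (irr_torus_upto G0 k \<phi> t) = card (weights t)"
    unfolding irr_torus_upto_eq by (rule card_image[OF inj_weight_char])
  also have "\<dots> = (\<Prod>j<k. card {- int t..int t})" by (simp add: weights_def card_PiE)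
  also have "\<dots> = (2 * t + 1) ^ k" by (simp add: Suc_nat_eq_nat_zadd1 nat_add_distrib nat_mult_distrib)
  finally show ?thesis .
qed

lemma weight_char_average_tendsto:
  assumes x: "x \<in> carrier G0"
  shows "(\<lambda>t. (\<Sum>m\<in>weights t. weight_char m x) / of_nat (card (irr_torus_upto G0 k \<phi> t)))
    \<longlonglongrightarrow> (if x = \<one>\<^bsub>G\<^esub> then 1 else 0)"
  using average_torus_characters_tendsto[of k "\<phi> x"] \<phi>_norm[OF x] \<phi>_eq_one_iff[OF x] x
  unfolding weights_def card_irr_torus_upto weight_char_def by simp

lemma continuous_weight_char: "continuous_map T0 euclidean (weight_char m)"
proof -
  have "continuous_map T0 (torus_topology k) \<phi>"
    by (rule homeomorphic_imp_continuous_map[OF \<phi>_homeo])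
  then have coord: "continuous_map T0 (top_of_set (sphere 0 1)) (\<lambda>x. \<phi> x j)" if "j < k" for j
    using that by (simp add: torus_topology_def continuous_map_componentwise)
  have pow: "continuous_map (top_of_set (sphere 0 1)) euclidean (\<lambda>z :: complex. z powi a)" for a
  proof -
    have "\<forall>z\<in>sphere 0 1. (z :: complex) \<noteq> 0" by auto
    then have "continuous_on (sphere 0 1) (\<lambda>z :: complex. z powi a)"
      by (intro continuous_on_power_int[where f = "\<lambda>z. z" and n = a] continuous_on_id disjI2)
    then show ?thesis by (simp only: continuous_map_iff_continuous)
  qed
  have "continuous_map T0 euclidean ((\<lambda>z. z powi m j) \<circ> (\<lambda>x. \<phi> x j))" if "j < k" for j
    by (rule continuous_map_compose[OF coord[OF that] pow])
  then have "continuous_map T0 euclidean (\<lambda>x. \<Prod>j<k. \<phi> x j powi m j)"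
    unfolding comp_def by (intro continuous_map_complex_prod) simp_all
  then show ?thesis
    by (rule continuous_map_eq) (simp only: topspace_T0 weight_char_def restrict_apply if_True)
qed

section \<open>Characters of the presented group\<close>

abbreviation Irr\<Delta> :: "('b \<Rightarrow> complex) set" where
  "Irr\<Delta> \<equiv> irr_characters \<Delta> (discrete_topology (carrier \<Delta>))"

text \<open>The condition that the product of the two characters is trivial on the antidiagonal, hence comes from the
quotient.\<close>

definition compatible :: "(nat \<Rightarrow> int) \<Rightarrow> ('b \<Rightarrow> complex) \<Rightarrow> bool" where
  "compatible m \<eta> \<longleftrightarrow> (\<forall>n\<in>carrier N. weight_char m (\<iota> n) * \<eta> (inv\<^bsub>\<Delta>\<^esub> (\<kappa> n)) = \<eta> \<one>\<^bsub>\<Delta>\<^esub>)"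

text \<open>The pull-back of \<open>ch\<close> to \<open>G0 \<times> \<Delta>\<close> is the product of the two characters given by the pair.\<close>

definition lies_over :: "('a \<Rightarrow> complex) \<Rightarrow> (nat \<Rightarrow> int) \<times> ('b \<Rightarrow> complex) \<Rightarrow> bool" where
  "lies_over ch p \<longleftrightarrow> (\<forall>x\<in>carrier G0. \<forall>a\<in>carrier \<Delta>. ch (x \<otimes>\<^bsub>G\<^esub> \<delta> a) = weight_char (fst p) x * snd p a)"

text \<open>Let \<open>\<rho>\<close> afford \<open>\<eta>\<close>. Then \<open>x \<delta>(a) \<mapsto> \<psi>(x) \<rho>(a)\<close> is well defined by compatibility, and it is irreducible
because it restricts to \<open>\<rho>\<close> on \<open>\<Delta>\<close>. It is continuous because it is so on each open coset of \<open>G0\<close>.\<close>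

lemma compatible_character_descends:
  assumes \<eta>: "\<eta> \<in> Irr\<Delta>" and comp: "compatible m \<eta>"
  obtains ch where "ch \<in> irr_characters G T" "lies_over ch (m, \<eta>)"
proof -
  obtain d \<rho> where \<rho>: "irreducible_hom \<Delta> d \<rho>" and \<eta>\<rho>: "\<eta> = restricted_trace \<Delta> d \<rho>"
    using \<eta> by (auto simp: irr_characters_discrete_eq)
  have hom: "\<rho> \<in> hom \<Delta> (general_linear_group d)" and d: "d > 0"
    using \<rho> by (auto simp: irreducible_hom_def)
  have \<rho>c: "\<rho> a \<in> carrier_mat d d" if "a \<in> carrier \<Delta>" for a
    using hom that by (simp add: hom_GL_iff[OF group_\<Delta>])
  have \<rho>m: "\<rho> (a \<otimes>\<^bsub>\<Delta>\<^esub> b) = \<rho> a * \<rho> b" if "a \<in> carrier \<Delta>" "b \<in> carrier \<Delta>" for a b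
    using hom that by (simp add: hom_GL_iff[OF group_\<Delta>])
  have \<rho>1: "\<rho> \<one>\<^bsub>\<Delta>\<^esub> = 1\<^sub>m d" using hom by (simp add: hom_GL_iff[OF group_\<Delta>])
  \<comment> \<open>By Schur's lemma \<open>\<kappa> n\<close> acts by a scalar, which compatibility identifies.\<close>
  have invariant: "weight_char m (\<iota> n \<otimes>\<^bsub>G\<^esub> x) \<cdot>\<^sub>m \<rho> (inv\<^bsub>\<Delta>\<^esub> (\<kappa> n) \<otimes>\<^bsub>\<Delta>\<^esub> a) = weight_char m x \<cdot>\<^sub>m \<rho> a"
    if n: "n \<in> carrier N" and x: "x \<in> carrier G0" and a: "a \<in> carrier \<Delta>" for n x a
  proof -
    let ?c = "inv\<^bsub>\<Delta>\<^esub> (\<kappa> n)"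
    have c: "?c \<in> carrier \<Delta>" using n by simp
    obtain z where z: "\<rho> ?c = z \<cdot>\<^sub>m 1\<^sub>m d"
      by (rule irreducible_hom_central[OF group_\<Delta> \<rho> c \<kappa>_central[OF n]])
    have "\<eta> ?c = z * of_nat d" using c by (simp add: \<eta>\<rho> restricted_trace_def z mtrace_smult_one)
    moreover have "\<eta> \<one>\<^bsub>\<Delta>\<^esub> = of_nat d"
      using mtrace_hom_one[OF group_\<Delta> hom] by (simp add: \<eta>\<rho> restricted_trace_def)
    ultimately have wz: "weight_char m (\<iota> n) * z = 1"
      using comp n d by (auto simp: compatible_def)
    have "\<rho> (?c \<otimes>\<^bsub>\<Delta>\<^esub> a) = z \<cdot>\<^sub>m \<rho> a" using \<rho>m[OF c a] scalar_mat_mult[OF \<rho>c[OF a]] by (simp add: z)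
    then have "weight_char m (\<iota> n \<otimes>\<^bsub>G\<^esub> x) \<cdot>\<^sub>m \<rho> (?c \<otimes>\<^bsub>\<Delta>\<^esub> a) =
        (weight_char m (\<iota> n) * z * weight_char m x) \<cdot>\<^sub>m \<rho> a"
      using n x by (simp add: weight_char_mult smult_smult_mat_assoc mult_ac)
    then show ?thesis by (simp add: wz)
  qed
  define P where "P g = (SOME p. p \<in> carrier H \<and> q p = g)" for g
  define \<sigma> where "\<sigma> g = weight_char m (fst (P g)) \<cdot>\<^sub>m \<rho> (snd (P g))" for g
  have \<sigma>: "\<sigma> (x \<otimes>\<^bsub>G\<^esub> \<delta> a) = weight_char m x \<cdot>\<^sub>m \<rho> a" if x: "x \<in> carrier G0" and a: "a \<in> carrier \<Delta>" for x a
  proof -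
    let ?g = "x \<otimes>\<^bsub>G\<^esub> \<delta> a"
    have "\<exists>p. p \<in> carrier H \<and> q p = ?g" using q_surj[of ?g] x a by auto
    then have "P ?g \<in> carrier H \<and> q (P ?g) = ?g" unfolding P_def by (rule someI_ex)
    moreover obtain y b where P: "P ?g = (y, b)" by (rule prod.exhaust)
    ultimately have yb: "y \<in> carrier G0" "b \<in> carrier \<Delta>" "y \<otimes>\<^bsub>G\<^esub> \<delta> b = ?g"
      by (auto simp: q_pair)
    then obtain n where n: "n \<in> carrier N" "x = \<iota> n \<otimes>\<^bsub>G\<^esub> y" "a = inv\<^bsub>\<Delta>\<^esub> (\<kappa> n) \<otimes>\<^bsub>\<Delta>\<^esub> b"
      using factorisation_eq_iff[OF yb(1,2) x a] by auto
    have "\<sigma> ?g = weight_char m y \<cdot>\<^sub>m \<rho> b" by (simp only: \<sigma>_def P fst_conv snd_conv)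
    also have "\<dots> = weight_char m x \<cdot>\<^sub>m \<rho> a" using invariant[OF n(1) yb(1,2)] by (simp only: n(2,3))
    finally show ?thesis .
  qed
  have \<sigma>hom: "\<sigma> \<in> hom G (general_linear_group d)"
    unfolding hom_GL_iff[OF group_G]
  proof (intro conjI ballI)
    fix g assume "g \<in> carrier G"
    then obtain x a where "x \<in> carrier G0" "a \<in> carrier \<Delta>" "g = x \<otimes>\<^bsub>G\<^esub> \<delta> a" by (rule factorisation)
    then show "\<sigma> g \<in> carrier_mat d d" using \<rho>c by (simp add: \<sigma>)
  next
    have "\<sigma> \<one>\<^bsub>G\<^esub> = weight_char m \<one>\<^bsub>G\<^esub> \<cdot>\<^sub>m \<rho> \<one>\<^bsub>\<Delta>\<^esub>" using \<sigma>[of "\<one>\<^bsub>G\<^esub>" "\<one>\<^bsub>\<Delta>\<^esub>"] by simp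
    then show "\<sigma> \<one>\<^bsub>G\<^esub> = 1\<^sub>m d" by (simp add: weight_char_one \<rho>1 one_smult_mat)
  next
    fix g h assume gh: "g \<in> carrier G" "h \<in> carrier G"
    obtain x a where xa: "x \<in> carrier G0" "a \<in> carrier \<Delta>" "g = x \<otimes>\<^bsub>G\<^esub> \<delta> a" by (rule factorisation[OF gh(1)])
    obtain y b where yb: "y \<in> carrier G0" "b \<in> carrier \<Delta>" "h = y \<otimes>\<^bsub>G\<^esub> \<delta> b" by (rule factorisation[OF gh(2)])
    have "\<sigma> (g \<otimes>\<^bsub>G\<^esub> h) = (weight_char m x * weight_char m y) \<cdot>\<^sub>m (\<rho> a * \<rho> b)"
      using xa yb by (simp add: factorisation_mult \<sigma> weight_char_mult \<rho>m)
    also have "\<dots> = (weight_char m x \<cdot>\<^sub>m \<rho> a) * (weight_char m y \<cdot>\<^sub>m \<rho> b)"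
      using \<rho>c[OF xa(2)] \<rho>c[OF yb(2)]
      by (simp add: mult_smult_distrib[of _ d d _ d] mult_smult_assoc_mat[of _ d d _ d] smult_smult_mat_assoc mult.commute)
    finally show "\<sigma> (g \<otimes>\<^bsub>G\<^esub> h) = \<sigma> g * \<sigma> h" using xa yb by (simp add: \<sigma>)
  qed
  have cont: "continuous_map T euclidean (\<lambda>g. \<sigma> g $$ (i, j))" if ij: "i < d" "j < d" for i j
  proof (rule continuous_map_T_if)
    fix a assume a: "a \<in> carrier \<Delta>"
    have "continuous_map T0 euclidean (\<lambda>x. weight_char m x * \<rho> a $$ (i, j))"
      by (intro continuous_map_complex_mult continuous_weight_char) simp
    then show "continuous_map T0 euclidean (\<lambda>x. \<sigma> (x \<otimes>\<^bsub>G\<^esub> \<delta> a) $$ (i, j))"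
    proof (rule continuous_map_eq)
      fix x assume "x \<in> topspace T0"
      then have "x \<in> carrier G0" by (simp only: topspace_T0)
      then show "weight_char m x * \<rho> a $$ (i, j) = \<sigma> (x \<otimes>\<^bsub>G\<^esub> \<delta> a) $$ (i, j)"
        using \<rho>c[OF a] ij a by (simp add: \<sigma>)
    qed
  qed
  have "irreducible_hom G d \<sigma>"
    unfolding irreducible_hom_def
  proof (intro conjI allI impI \<sigma>hom d)
    fix W assume W: "linear_subspace d W \<and> (\<forall>g\<in>carrier G. \<forall>w\<in>W. \<sigma> g *\<^sub>v w \<in> W)"
    have "\<rho> a *\<^sub>v w \<in> W" if "a \<in> carrier \<Delta>" "w \<in> W" for a w
    proof -
      have "\<sigma> (\<delta> a) = \<rho> a" using \<sigma>[of "\<one>\<^bsub>G\<^esub>" a] that by (simp add: weight_char_one one_smult_mat)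
      then show ?thesis using W that \<delta>_closed by metis
    qed
    then show "W = {0\<^sub>v d} \<or> W = carrier_vec d" using W \<rho> unfolding irreducible_hom_def by blast
  qed
  moreover have "matrix_rep G T d \<sigma>" using \<sigma>hom cont by (simp add: matrix_rep_def)
  ultimately have "restricted_trace G d \<sigma> \<in> irr_characters G T" by (auto simp: irr_characters_eq)
  moreover have "lies_over (restricted_trace G d \<sigma>) (m, \<eta>)"
    unfolding lies_over_def
  proof (intro ballI)
    fix x a assume "x \<in> carrier G0" "a \<in> carrier \<Delta>"
    then show "restricted_trace G d \<sigma> (x \<otimes>\<^bsub>G\<^esub> \<delta> a) = weight_char (fst (m, \<eta>)) x * snd (m, \<eta>) a"
      using \<rho>c by (simp add: restricted_trace_def \<eta>\<rho> \<sigma> mtrace_smult)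
  qed
  ultimately show ?thesis by (rule that)
qed

lemma lies_over_extensional_unique:
  assumes "lies_over ch p" "lies_over ch' p" "ch \<in> extensional (carrier G)" "ch' \<in> extensional (carrier G)"
  shows "ch = ch'"
proof (rule extensionalityI[OF assms(3,4)])
  fix g assume "g \<in> carrier G"
  then obtain x a where "x \<in> carrier G0" "a \<in> carrier \<Delta>" "g = x \<otimes>\<^bsub>G\<^esub> \<delta> a" by (rule factorisation)
  then show "ch g = ch' g" using assms(1,2) by (simp add: lies_over_def)
qed

lemma lies_over_unique:
  assumes "lies_over ch (m, \<eta>)" "lies_over ch (m', \<eta>')" "m \<in> weights t" "m' \<in> weights t"
    and \<eta>: "\<eta> \<in> Irr\<Delta>" "\<eta>' \<in> Irr\<Delta>"
  shows "m = m'" "\<eta> = \<eta>'"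
proof -
  have at_\<delta>: "w a = ch (\<delta> a)" if "lies_over ch (l, w)" "a \<in> carrier \<Delta>" for l w a
    using that unfolding lies_over_def by (auto dest!: bspec[of _ _ "\<one>\<^bsub>G\<^esub>"] simp: weight_char_one)
  show eq: "\<eta> = \<eta>'"
    by (rule extensionalityI[OF irr_characters_extensional[OF \<eta>(1)] irr_characters_extensional[OF \<eta>(2)]])
      (use at_\<delta> assms(1,2) in metis)
  have at_x: "weight_char l x * \<eta> \<one>\<^bsub>\<Delta>\<^esub> = ch x" if "lies_over ch (l, \<eta>)" "x \<in> carrier G0" for l x
    using that unfolding lies_over_def by (auto dest!: bspec[of _ _ "\<one>\<^bsub>\<Delta>\<^esub>"])
  have "weight_char m = weight_char m'"
  proof (rule extensionalityI)
    fix x assume x: "x \<in> carrier G0"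
    have "weight_char m x * \<eta> \<one>\<^bsub>\<Delta>\<^esub> = weight_char m' x * \<eta> \<one>\<^bsub>\<Delta>\<^esub>"
      using at_x[of m x] at_x[of m' x] assms(1,2) x eq by simp
    then show "weight_char m x = weight_char m' x"
      using irr_character_one_neq_0[OF group_\<Delta> \<eta>(1)] by simp
  qed (simp_all add: weight_char_def)
  then show "m = m'" using inj_weight_char assms(3,4) by (auto simp: inj_on_def)
qed

definition compatible_pairs :: "nat \<Rightarrow> ((nat \<Rightarrow> int) \<times> ('b \<Rightarrow> complex)) set" where
  "compatible_pairs t = {p \<in> weights t \<times> Irr\<Delta>. compatible (fst p) (snd p)}"

lemma irr_prod_upto_iff:
  "f \<in> irr_prod_upto G0 k \<phi> \<Delta> t \<longleftrightarrow>
    (\<exists>m\<in>weights t. \<exists>\<eta>\<in>Irr\<Delta>. f = (\<lambda>(x, a)\<in>carrier H. weight_char m x * \<eta> a))"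
  unfolding irr_prod_upto_def irr_torus_upto_eq by blast

text \<open>A character of \<open>G\<close> that pulls back to a product of two characters forces these to be compatible, because
the antidiagonal is mapped to \<open>\<one>\<close>.\<close>

lemma irr_upto_iff:
  "ch \<in> irr_upto G T k \<phi> \<Delta> q t \<longleftrightarrow>
    ch \<in> irr_characters G T \<and> (\<exists>p\<in>compatible_pairs t. lies_over ch p)"
proof (cases "ch \<in> irr_characters G T")
  case ch: True
  have iff: "(\<lambda>p\<in>carrier H. ch (q p)) = (\<lambda>(x, a)\<in>carrier H. weight_char m x * \<eta> a) \<longleftrightarrow> lies_over ch (m, \<eta>)"
    for m \<eta>
  proof
    assume eq: "(\<lambda>p\<in>carrier H. ch (q p)) = (\<lambda>(x, a)\<in>carrier H. weight_char m x * \<eta> a)"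
    show "lies_over ch (m, \<eta>)"
      unfolding lies_over_def
    proof (intro ballI)
      fix x a assume xa: "x \<in> carrier G0" "a \<in> carrier \<Delta>"
      show "ch (x \<otimes>\<^bsub>G\<^esub> \<delta> a) = weight_char (fst (m, \<eta>)) x * snd (m, \<eta>) a"
        using fun_cong[OF eq, of "(x, a)"] xa by (simp add: q_pair)
    qed
  next
    assume "lies_over ch (m, \<eta>)"
    then show "(\<lambda>p\<in>carrier H. ch (q p)) = (\<lambda>(x, a)\<in>carrier H. weight_char m x * \<eta> a)"
      by (intro restrict_ext) (auto simp: lies_over_def q_pair)
  qed
  have comp: "compatible m \<eta>" if l: "lies_over ch (m, \<eta>)" for m \<eta>
    unfolding compatible_def
  proof
    fix n assume n: "n \<in> carrier N"
    have v: "ch (x \<otimes>\<^bsub>G\<^esub> \<delta> a) = weight_char m x * \<eta> a" if "x \<in> carrier G0" "a \<in> carrier \<Delta>" for x a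
      using l that by (simp add: lies_over_def)
    have e: "\<one>\<^bsub>G\<^esub> \<otimes>\<^bsub>G\<^esub> \<delta> \<one>\<^bsub>\<Delta>\<^esub> = \<iota> n \<otimes>\<^bsub>G\<^esub> \<delta> (inv\<^bsub>\<Delta>\<^esub> (\<kappa> n))"
      using factorisation_eq_iff[of "\<one>\<^bsub>G\<^esub>" "\<one>\<^bsub>\<Delta>\<^esub>" "\<iota> n" "inv\<^bsub>\<Delta>\<^esub> (\<kappa> n)"] n by auto
    have "weight_char m (\<iota> n) * \<eta> (inv\<^bsub>\<Delta>\<^esub> (\<kappa> n)) = ch (\<iota> n \<otimes>\<^bsub>G\<^esub> \<delta> (inv\<^bsub>\<Delta>\<^esub> (\<kappa> n)))"
      by (rule v[symmetric]) (use n in simp_all)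
    also have "\<dots> = ch (\<one>\<^bsub>G\<^esub> \<otimes>\<^bsub>G\<^esub> \<delta> \<one>\<^bsub>\<Delta>\<^esub>)" by (simp only: e)
    also have "\<dots> = weight_char m \<one>\<^bsub>G\<^esub> * \<eta> \<one>\<^bsub>\<Delta>\<^esub>" by (rule v) simp_all
    finally show "weight_char m (\<iota> n) * \<eta> (inv\<^bsub>\<Delta>\<^esub> (\<kappa> n)) = \<eta> \<one>\<^bsub>\<Delta>\<^esub>" by (simp add: weight_char_one)
  qed
  have "ch \<in> irr_upto G T k \<phi> \<Delta> q t \<longleftrightarrow>
      (\<exists>m\<in>weights t. \<exists>\<eta>\<in>Irr\<Delta>. (\<lambda>p\<in>carrier H. ch (q p)) = (\<lambda>(x, a)\<in>carrier H. weight_char m x * \<eta> a))"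
    using ch by (simp only: irr_upto_def mem_Collect_eq simp_thms irr_prod_upto_iff)
  also have "\<dots> \<longleftrightarrow> (\<exists>p\<in>compatible_pairs t. lies_over ch p)"
    unfolding iff
  proof
    assume "\<exists>m\<in>weights t. \<exists>\<eta>\<in>Irr\<Delta>. lies_over ch (m, \<eta>)"
    then obtain m \<eta> where me: "m \<in> weights t" "\<eta> \<in> Irr\<Delta>" "lies_over ch (m, \<eta>)" by (elim bexE)
    then have "(m, \<eta>) \<in> compatible_pairs t" using comp by (simp add: compatible_pairs_def)
    then show "\<exists>p\<in>compatible_pairs t. lies_over ch p" using me(3) by (rule bexI[rotated])
  next
    assume "\<exists>p\<in>compatible_pairs t. lies_over ch p"
    then obtain p where p: "p \<in> compatible_pairs t" "lies_over ch p" by (elim bexE)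
    obtain m \<eta> where me: "p = (m, \<eta>)" by (rule prod.exhaust)
    have "m \<in> weights t" "\<eta> \<in> Irr\<Delta>" using p(1) by (simp_all add: me compatible_pairs_def)
    then show "\<exists>m\<in>weights t. \<exists>\<eta>\<in>Irr\<Delta>. lies_over ch (m, \<eta>)"
      using p(2) unfolding me by (intro bexI)
  qed
  finally show ?thesis using ch by simp
qed (simp add: irr_upto_def)

text \<open>Each compatible pair is the pull-back of exactly one irreducible character of \<open>G\<close>, so the sum can be taken
over pairs.\<close>

lemma sum_irr_upto:
  assumes x: "x \<in> carrier G0" and a: "a \<in> carrier \<Delta>"
  shows "(\<Sum>ch\<in>irr_upto G T k \<phi> \<Delta> q t. ch (x \<otimes>\<^bsub>G\<^esub> \<delta> a) / ch \<one>\<^bsub>G\<^esub>) =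
    (\<Sum>p\<in>compatible_pairs t. weight_char (fst p) x * (snd p a / snd p \<one>\<^bsub>\<Delta>\<^esub>))"
proof -
  define F where "F p = (SOME ch. ch \<in> irr_characters G T \<and> lies_over ch p)" for p
  have F: "F p \<in> irr_characters G T" "lies_over (F p) p" if p: "p \<in> compatible_pairs t" for p
  proof -
    obtain m \<eta> where me: "p = (m, \<eta>)" by (rule prod.exhaust)
    then have "\<eta> \<in> Irr\<Delta>" "compatible m \<eta>" using p by (auto simp: compatible_pairs_def)
    then have "\<exists>ch. ch \<in> irr_characters G T \<and> lies_over ch p"
      unfolding me using compatible_character_descends by metis
    then have "F p \<in> irr_characters G T \<and> lies_over (F p) p" unfolding F_def by (rule someI_ex)
    then show "F p \<in> irr_characters G T" "lies_over (F p) p" by auto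
  qed
  have bij: "bij_betw F (compatible_pairs t) (irr_upto G T k \<phi> \<Delta> q t)"
  proof (rule bij_betw_imageI)
    show "inj_on F (compatible_pairs t)"
    proof (rule inj_onI)
      fix p p' assume p: "p \<in> compatible_pairs t" "p' \<in> compatible_pairs t" and eq: "F p = F p'"
      obtain m \<eta> m' \<eta>' where me: "p = (m, \<eta>)" "p' = (m', \<eta>')" by (metis prod.exhaust)
      have "lies_over (F p) (m, \<eta>)" "lies_over (F p) (m', \<eta>')"
        using F(2)[OF p(1)] F(2)[OF p(2)] eq me by simp_all
      then show "p = p'"
        using lies_over_unique[of "F p" m \<eta> m' \<eta>' t] p unfolding me by (auto simp: compatible_pairs_def)
    qed
    show "F ` compatible_pairs t = irr_upto G T k \<phi> \<Delta> q t"
    proof (intro equalityI subsetI)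
      fix ch assume "ch \<in> F ` compatible_pairs t"
      then obtain p where p: "ch = F p" "p \<in> compatible_pairs t" by (rule imageE)
      show "ch \<in> irr_upto G T k \<phi> \<Delta> q t"
        unfolding irr_upto_iff p(1) using F[OF p(2)] p(2) by (intro conjI bexI)
    next
      fix ch assume "ch \<in> irr_upto G T k \<phi> \<Delta> q t"
      then obtain p where ch: "ch \<in> irr_characters G T" and p: "p \<in> compatible_pairs t" "lies_over ch p"
        unfolding irr_upto_iff by (elim conjE bexE)
      have "ch = F p"
        by (rule lies_over_extensional_unique[OF p(2) F(2)[OF p(1)]])
          (rule irr_characters_extensional[OF ch], rule irr_characters_extensional[OF F(1)[OF p(1)]])
      then show "ch \<in> F ` compatible_pairs t" using p(1) by blast
    qed
  qed
  have "(\<Sum>ch\<in>irr_upto G T k \<phi> \<Delta> q t. ch (x \<otimes>\<^bsub>G\<^esub> \<delta> a) / ch \<one>\<^bsub>G\<^esub>) =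
      (\<Sum>p\<in>compatible_pairs t. F p (x \<otimes>\<^bsub>G\<^esub> \<delta> a) / F p \<one>\<^bsub>G\<^esub>)"
    by (rule sum.reindex_bij_betw[OF bij, symmetric])
  also have "\<dots> = (\<Sum>p\<in>compatible_pairs t. weight_char (fst p) x * (snd p a / snd p \<one>\<^bsub>\<Delta>\<^esub>))"
  proof (intro sum.cong refl)
    fix p assume "p \<in> compatible_pairs t"
    then have l: "lies_over (F p) p" by (rule F(2))
    have "F p \<one>\<^bsub>G\<^esub> = snd p \<one>\<^bsub>\<Delta>\<^esub>"
      using l unfolding lies_over_def
      by (auto dest!: bspec[of _ _ "\<one>\<^bsub>G\<^esub>"] bspec[of _ _ "\<one>\<^bsub>\<Delta>\<^esub>"] simp: weight_char_one)
    moreover have "F p (x \<otimes>\<^bsub>G\<^esub> \<delta> a) = weight_char (fst p) x * snd p a"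
      using l x a by (simp add: lies_over_def)
    ultimately show "F p (x \<otimes>\<^bsub>G\<^esub> \<delta> a) / F p \<one>\<^bsub>G\<^esub> = weight_char (fst p) x * (snd p a / snd p \<one>\<^bsub>\<Delta>\<^esub>)"
      by simp
  qed
  finally show ?thesis .
qed

text \<open>The map \<open>n \<mapsto> \<psi>(\<iota> n) \<eta>((\<kappa> n)\<^sup>-\<^sup>1) / \<eta>(\<one>)\<close> is a linear character of \<open>N\<close>, because \<open>\<kappa> n\<close> is central in
\<open>\<Delta>\<close>. Its average over \<open>N\<close> is \<open>1\<close> or \<open>0\<close> according to whether it is trivial, which is compatibility.\<close>

lemma compatible_indicator:
  assumes \<eta>: "\<eta> \<in> Irr\<Delta>" and x: "x \<in> carrier G0" and a: "a \<in> carrier \<Delta>"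
  shows "(if compatible m \<eta> then weight_char m x * (\<eta> a / \<eta> \<one>\<^bsub>\<Delta>\<^esub>) else 0) =
    (\<Sum>n\<in>carrier N. weight_char m (\<iota> n \<otimes>\<^bsub>G\<^esub> x) * (\<eta> (inv\<^bsub>\<Delta>\<^esub> (\<kappa> n) \<otimes>\<^bsub>\<Delta>\<^esub> a) / \<eta> \<one>\<^bsub>\<Delta>\<^esub>)) / of_nat (order N)"
proof -
  define \<theta> where "\<theta> n = weight_char m (\<iota> n) * (\<eta> (inv\<^bsub>\<Delta>\<^esub> (\<kappa> n)) / \<eta> \<one>\<^bsub>\<Delta>\<^esub>)" for n
  have nz: "\<eta> \<one>\<^bsub>\<Delta>\<^esub> \<noteq> 0" by (rule irr_character_one_neq_0[OF group_\<Delta> \<eta>])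
  have cen: "\<eta> (inv\<^bsub>\<Delta>\<^esub> (\<kappa> n) \<otimes>\<^bsub>\<Delta>\<^esub> b) = \<eta> (inv\<^bsub>\<Delta>\<^esub> (\<kappa> n)) * \<eta> b / \<eta> \<one>\<^bsub>\<Delta>\<^esub>"
    if "n \<in> carrier N" "b \<in> carrier \<Delta>" for n b
    using central_character_mult[OF group_\<Delta> \<eta> _ \<kappa>_central[OF that(1)] that(2)] that nz
    by (simp add: field_simps)
  have mult: "\<theta> (n \<otimes>\<^bsub>N\<^esub> n') = \<theta> n * \<theta> n'" if n: "n \<in> carrier N" "n' \<in> carrier N" for n n'
  proof -
    have "inv\<^bsub>\<Delta>\<^esub> (\<kappa> (n \<otimes>\<^bsub>N\<^esub> n')) = inv\<^bsub>\<Delta>\<^esub> (\<kappa> n) \<otimes>\<^bsub>\<Delta>\<^esub> inv\<^bsub>\<Delta>\<^esub> (\<kappa> n')"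
      using n \<kappa>_central[OF n(1), of "inv\<^bsub>\<Delta>\<^esub> (\<kappa> n')"] by (simp add: \<kappa>_mult D.inv_mult_group)
    then show ?thesis
      using n cen[OF n(1), of "inv\<^bsub>\<Delta>\<^esub> (\<kappa> n')"] by (simp add: \<theta>_def \<iota>_mult weight_char_mult)
  qed
  have pos: "order N > 0" using finite_N N.one_closed by (auto simp: order_def card_gt_0_iff)
  have "compatible m \<eta> \<longleftrightarrow> (\<forall>n\<in>carrier N. \<theta> n = 1)"
    using nz by (simp add: compatible_def \<theta>_def field_simps)
  then have "(if compatible m \<eta> then weight_char m x * (\<eta> a / \<eta> \<one>\<^bsub>\<Delta>\<^esub>) else 0) =
      (\<Sum>n\<in>carrier N. \<theta> n) / of_nat (order N) * (weight_char m x * (\<eta> a / \<eta> \<one>\<^bsub>\<Delta>\<^esub>))"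
    using sum_linear_character[OF group_N finite_N mult] pos by simp
  also have "\<dots> = (\<Sum>n\<in>carrier N. \<theta> n * (weight_char m x * (\<eta> a / \<eta> \<one>\<^bsub>\<Delta>\<^esub>))) / of_nat (order N)"
    by (simp only: times_divide_eq_left sum_distrib_right[symmetric])
  also have "(\<Sum>n\<in>carrier N. \<theta> n * (weight_char m x * (\<eta> a / \<eta> \<one>\<^bsub>\<Delta>\<^esub>))) =
      (\<Sum>n\<in>carrier N. weight_char m (\<iota> n \<otimes>\<^bsub>G\<^esub> x) * (\<eta> (inv\<^bsub>\<Delta>\<^esub> (\<kappa> n) \<otimes>\<^bsub>\<Delta>\<^esub> a) / \<eta> \<one>\<^bsub>\<Delta>\<^esub>))"
    using x a by (intro sum.cong refl) (simp add: \<theta>_def weight_char_mult cen)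
  finally show ?thesis .
qed

text \<open>With compatibility replaced by an average over \<open>N\<close> the two characters vary independently, and the double
sum is a product for each \<open>n\<close>.\<close>

lemma character_sum_factorised:
  assumes x: "x \<in> carrier G0" and a: "a \<in> carrier \<Delta>"
  shows "(\<Sum>ch\<in>irr_upto G T k \<phi> \<Delta> q t. ch (x \<otimes>\<^bsub>G\<^esub> \<delta> a) / ch \<one>\<^bsub>G\<^esub>) =
    (\<Sum>n\<in>carrier N. (\<Sum>m\<in>weights t. weight_char m (\<iota> n \<otimes>\<^bsub>G\<^esub> x)) *
       (\<Sum>\<eta>\<in>Irr\<Delta>. \<eta> (inv\<^bsub>\<Delta>\<^esub> (\<kappa> n) \<otimes>\<^bsub>\<Delta>\<^esub> a) / \<eta> \<one>\<^bsub>\<Delta>\<^esub>)) / of_nat (order N)"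
proof -
  have fin: "finite (weights t \<times> Irr\<Delta>)"
    using finite_weights irr_characters_column_orthogonality(1)[OF group_\<Delta> finite_\<Delta>] by simp
  let ?W = "\<lambda>n m. weight_char m (\<iota> n \<otimes>\<^bsub>G\<^esub> x)"
  let ?E = "\<lambda>n \<eta>. \<eta> (inv\<^bsub>\<Delta>\<^esub> (\<kappa> n) \<otimes>\<^bsub>\<Delta>\<^esub> a) / \<eta> \<one>\<^bsub>\<Delta>\<^esub>"
  have "(\<Sum>p\<in>compatible_pairs t. weight_char (fst p) x * (snd p a / snd p \<one>\<^bsub>\<Delta>\<^esub>)) =
      (\<Sum>p\<in>weights t \<times> Irr\<Delta>. if compatible (fst p) (snd p)
         then weight_char (fst p) x * (snd p a / snd p \<one>\<^bsub>\<Delta>\<^esub>) else 0)"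
    unfolding compatible_pairs_def by (rule sum.inter_filter[OF fin])
  also have "\<dots> = (\<Sum>p\<in>weights t \<times> Irr\<Delta>. (\<Sum>n\<in>carrier N. ?W n (fst p) * ?E n (snd p)) / of_nat (order N))"
    by (intro sum.cong refl compatible_indicator x a) auto
  also have "\<dots> = (\<Sum>p\<in>weights t \<times> Irr\<Delta>. \<Sum>n\<in>carrier N. ?W n (fst p) * ?E n (snd p)) / of_nat (order N)"
    by (simp only: sum_divide_distrib)
  also have "\<dots> = (\<Sum>n\<in>carrier N. \<Sum>p\<in>weights t \<times> Irr\<Delta>. ?W n (fst p) * ?E n (snd p)) / of_nat (order N)"
    by (subst sum.swap) (rule refl)
  also have "\<dots> = (\<Sum>n\<in>carrier N. (\<Sum>m\<in>weights t. ?W n m) * (\<Sum>\<eta>\<in>Irr\<Delta>. ?E n \<eta>)) / of_nat (order N)"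
  proof -
    have "(\<Sum>p\<in>weights t \<times> Irr\<Delta>. ?W n (fst p) * ?E n (snd p)) =
        (\<Sum>m\<in>weights t. ?W n m) * (\<Sum>\<eta>\<in>Irr\<Delta>. ?E n \<eta>)" for n
      by (simp only: sum_product sum.cartesian_product case_prod_beta')
    then show ?thesis by (simp only:)
  qed
  finally show ?thesis unfolding sum_irr_upto[OF x a] .
qed

text \<open>Unfolding \<open>\<delta> d = x \<delta>(a)\<close> with the uniqueness of factorisations yields an \<open>n\<close> with \<open>\<iota> n x = \<one>\<close>, and
there is at most one because \<open>\<iota>\<close> is injective.\<close>

lemma card_commutator_equation:
  assumes x: "x \<in> carrier G0" and a: "a \<in> carrier \<Delta>"
  shows "card {(b, c). b \<in> carrier \<Delta> \<and> c \<in> carrier \<Delta> \<and> \<delta> (comm\<Delta> b c) = x \<otimes>\<^bsub>G\<^esub> \<delta> a} =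
    (\<Sum>n\<in>carrier N. if \<iota> n \<otimes>\<^bsub>G\<^esub> x = \<one>\<^bsub>G\<^esub>
       then card {(b, c). b \<in> carrier \<Delta> \<and> c \<in> carrier \<Delta> \<and> comm\<Delta> b c = inv\<^bsub>\<Delta>\<^esub> (\<kappa> n) \<otimes>\<^bsub>\<Delta>\<^esub> a} else 0)"
proof -
  define B where "B n = {(b, c). b \<in> carrier \<Delta> \<and> c \<in> carrier \<Delta> \<and> comm\<Delta> b c = inv\<^bsub>\<Delta>\<^esub> (\<kappa> n) \<otimes>\<^bsub>\<Delta>\<^esub> a}" for n
  have finB: "finite (B n)" for n
    by (rule finite_subset[of _ "carrier \<Delta> \<times> carrier \<Delta>"]) (auto simp: B_def finite_\<Delta>)
  define M where "M = {n \<in> carrier N. \<iota> n \<otimes>\<^bsub>G\<^esub> x = \<one>\<^bsub>G\<^esub>}"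
  have eq: "\<delta> d = x \<otimes>\<^bsub>G\<^esub> \<delta> a \<longleftrightarrow> (\<exists>n\<in>M. d = inv\<^bsub>\<Delta>\<^esub> (\<kappa> n) \<otimes>\<^bsub>\<Delta>\<^esub> a)" if d: "d \<in> carrier \<Delta>" for d
  proof -
    have "\<delta> d = x \<otimes>\<^bsub>G\<^esub> \<delta> a \<longleftrightarrow> x \<otimes>\<^bsub>G\<^esub> \<delta> a = \<one>\<^bsub>G\<^esub> \<otimes>\<^bsub>G\<^esub> \<delta> d" using d by auto
    also have "\<dots> \<longleftrightarrow> (\<exists>n\<in>carrier N. \<one>\<^bsub>G\<^esub> = \<iota> n \<otimes>\<^bsub>G\<^esub> x \<and> d = inv\<^bsub>\<Delta>\<^esub> (\<kappa> n) \<otimes>\<^bsub>\<Delta>\<^esub> a)"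
      by (rule factorisation_eq_iff[OF x a G0_one_closed d])
    finally show ?thesis
      unfolding M_def by (simp only: Bex_def mem_Collect_eq conj_assoc eq_commute[of "\<one>\<^bsub>G\<^esub>"])
  qed
  have "{(b, c). b \<in> carrier \<Delta> \<and> c \<in> carrier \<Delta> \<and> \<delta> (comm\<Delta> b c) = x \<otimes>\<^bsub>G\<^esub> \<delta> a} = (\<Union>n\<in>M. B n)"
  proof (rule Set.set_eqI)
    fix p :: "'b \<times> 'b"
    obtain b c where p: "p = (b, c)" by (rule prod.exhaust)
    have "\<delta> (comm\<Delta> b c) = x \<otimes>\<^bsub>G\<^esub> \<delta> a \<longleftrightarrow> (\<exists>n\<in>M. comm\<Delta> b c = inv\<^bsub>\<Delta>\<^esub> (\<kappa> n) \<otimes>\<^bsub>\<Delta>\<^esub> a)"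
      if "b \<in> carrier \<Delta>" "c \<in> carrier \<Delta>"
      by (rule eq) (use that in simp)
    then show "p \<in> {(b, c). b \<in> carrier \<Delta> \<and> c \<in> carrier \<Delta> \<and> \<delta> (comm\<Delta> b c) = x \<otimes>\<^bsub>G\<^esub> \<delta> a} \<longleftrightarrow>
        p \<in> (\<Union>n\<in>M. B n)"
      unfolding B_def p UN_iff mem_Collect_eq prod.case by blast
  qed
  also have "card \<dots> = (\<Sum>n\<in>M. card (B n))"
  proof (rule card_UN_disjoint)
    show "\<forall>i\<in>M. \<forall>j\<in>M. i \<noteq> j \<longrightarrow> B i \<inter> B j = {}"
    proof (intro ballI impI)
      fix i j assume "i \<in> M" "j \<in> M" "i \<noteq> j"
      then have ij: "i \<in> carrier N" "j \<in> carrier N" "\<iota> i \<otimes>\<^bsub>G\<^esub> x = \<iota> j \<otimes>\<^bsub>G\<^esub> x" by (auto simp: M_def)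
      then have "\<iota> i = \<iota> j" using x by simp
      then show "B i \<inter> B j = {}" using \<iota>_inj ij \<open>i \<noteq> j\<close> by (auto simp: inj_on_def)
    qed
  qed (use finite_N finB in \<open>auto simp: M_def\<close>)
  also have "\<dots> = (\<Sum>n\<in>carrier N. if \<iota> n \<otimes>\<^bsub>G\<^esub> x = \<one>\<^bsub>G\<^esub> then card (B n) else 0)"
    unfolding M_def by (rule sum.inter_filter[OF finite_N])
  finally show ?thesis by (simp only: B_def)
qed

end

section \<open>The limit formula\<close>

theorem theorem1p2:
  fixes G :: "'a monoid" and T :: "'a topology" and k :: nat
    and \<phi> :: "'a \<Rightarrow> nat \<Rightarrow> complex"
    and \<Delta> :: "'b monoid" and N :: "'n monoid"
    and \<iota> :: "'n \<Rightarrow> 'a" and \<kappa> :: "'n \<Rightarrow> 'b" and \<Phi> :: "('a \<times> 'b) set \<Rightarrow> 'a"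
    and \<mu> :: "'a measure" and g0 :: 'a
  assumes "lie_group G T k" and "compact_space T" and "FC_group G"
    and "presentation G T k \<phi> \<Delta> N \<iota> \<kappa> \<Phi>"
    and "normalised_haar_measure G T \<mu>"
    and "g0 \<in> carrier G"
  shows "\<exists>L :: complex.
     ((\<lambda>t. 1 / of_nat (card (irr_torus_upto (id_comp_group G T) k \<phi> t)) *
           (\<Sum>ch\<in>irr_upto G T k \<phi> \<Delta> (presentation_map G T \<Delta> N \<iota> \<kappa> \<Phi>) t. ch g0 / ch \<one>\<^bsub>G\<^esub>))
        \<longlonglongrightarrow> L) \<and>
     complex_of_real
       (measure (\<mu> \<Otimes>\<^sub>M \<mu>) (commutator_map G -` {g0} \<inter> (carrier G \<times> carrier G)))
       = of_nat (order N) / of_nat (order \<Delta>) * L"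
proof -
  interpret presented_group G T k \<phi> \<Delta> N \<iota> \<kappa> \<Phi>
    by (rule presented_group.intro) (use assms in \<open>simp_all add: lie_group_def\<close>)
  obtain x a where x: "x \<in> carrier G0" and a: "a \<in> carrier \<Delta>" and g0: "g0 = x \<otimes>\<^bsub>G\<^esub> \<delta> a"
    by (rule factorisation[OF assms(6)])
  define C where "C n = {(b, c). b \<in> carrier \<Delta> \<and> c \<in> carrier \<Delta> \<and> comm\<Delta> b c = inv\<^bsub>\<Delta>\<^esub> (\<kappa> n) \<otimes>\<^bsub>\<Delta>\<^esub> a}" for n
  define E where "E n = (\<Sum>\<eta>\<in>Irr\<Delta>. \<eta> (inv\<^bsub>\<Delta>\<^esub> (\<kappa> n) \<otimes>\<^bsub>\<Delta>\<^esub> a) / \<eta> \<one>\<^bsub>\<Delta>\<^esub>)" for n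
  have pos: "order \<Delta> > 0" "order N > 0"
    using finite_\<Delta> finite_N D.one_closed N.one_closed by (auto simp: order_def card_gt_0_iff)
  have frob: "of_nat (card (C n)) = of_nat (order \<Delta>) * E n" if n: "n \<in> carrier N" for n
    unfolding C_def E_def by (rule frobenius_commutator_formula[OF group_\<Delta> finite_\<Delta>]) (use n a in simp)
  define L where "L = (\<Sum>n\<in>carrier N. (if \<iota> n \<otimes>\<^bsub>G\<^esub> x = \<one>\<^bsub>G\<^esub> then 1 else 0) * E n) / of_nat (order N)"
  have "(\<lambda>t. (\<Sum>n\<in>carrier N. (\<Sum>m\<in>weights t. weight_char m (\<iota> n \<otimes>\<^bsub>G\<^esub> x)) /
      of_nat (card (irr_torus_upto G0 k \<phi> t)) * E n) / of_nat (order N)) \<longlonglongrightarrow> L"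
    unfolding L_def
    by (intro tendsto_divide tendsto_sum tendsto_mult tendsto_const weight_char_average_tendsto)
      (use x pos in simp_all)
  also have "(\<lambda>t. (\<Sum>n\<in>carrier N. (\<Sum>m\<in>weights t. weight_char m (\<iota> n \<otimes>\<^bsub>G\<^esub> x)) /
      of_nat (card (irr_torus_upto G0 k \<phi> t)) * E n) / of_nat (order N)) =
    (\<lambda>t. 1 / of_nat (card (irr_torus_upto G0 k \<phi> t)) *
      (\<Sum>ch\<in>irr_upto G T k \<phi> \<Delta> q t. ch g0 / ch \<one>\<^bsub>G\<^esub>))"
  proof (rule ext)
    fix t
    have "(\<Sum>n\<in>S. A n / w * E n) / c = 1 / w * ((\<Sum>n\<in>S. A n * E n) / c)"
      for S and A :: "'n \<Rightarrow> complex" and w c :: complex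
      by (simp add: sum_divide_distrib mult.commute)
    then show "(\<Sum>n\<in>carrier N. (\<Sum>m\<in>weights t. weight_char m (\<iota> n \<otimes>\<^bsub>G\<^esub> x)) /
        of_nat (card (irr_torus_upto G0 k \<phi> t)) * E n) / of_nat (order N) =
      1 / of_nat (card (irr_torus_upto G0 k \<phi> t)) *
        (\<Sum>ch\<in>irr_upto G T k \<phi> \<Delta> q t. ch g0 / ch \<one>\<^bsub>G\<^esub>)"
      unfolding g0 character_sum_factorised[OF x a] E_def[symmetric] .
  qed
  finally have lim: "(\<lambda>t. 1 / of_nat (card (irr_torus_upto G0 k \<phi> t)) *
      (\<Sum>ch\<in>irr_upto G T k \<phi> \<Delta> q t. ch g0 / ch \<one>\<^bsub>G\<^esub>)) \<longlonglongrightarrow> L" .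
  have "of_nat (order N) * L = (\<Sum>n\<in>carrier N. (if \<iota> n \<otimes>\<^bsub>G\<^esub> x = \<one>\<^bsub>G\<^esub> then 1 else 0) * E n)"
    using pos by (simp add: L_def)
  then have "of_nat (order \<Delta>) * (of_nat (order N) * L) =
      (\<Sum>n\<in>carrier N. of_nat (order \<Delta>) * ((if \<iota> n \<otimes>\<^bsub>G\<^esub> x = \<one>\<^bsub>G\<^esub> then 1 else 0) * E n))"
    by (simp only: sum_distrib_left)
  also have "\<dots> = (\<Sum>n\<in>carrier N. of_nat (if \<iota> n \<otimes>\<^bsub>G\<^esub> x = \<one>\<^bsub>G\<^esub> then card (C n) else 0))"
    by (intro sum.cong refl) (simp add: frob)
  also have "\<dots> = of_nat (\<Sum>n\<in>carrier N. if \<iota> n \<otimes>\<^bsub>G\<^esub> x = \<one>\<^bsub>G\<^esub> then card (C n) else 0)"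
    by (simp only: of_nat_sum)
  also have "\<dots> = of_nat (card {(b, c). b \<in> carrier \<Delta> \<and> c \<in> carrier \<Delta> \<and> \<delta> (comm\<Delta> b c) = g0})"
    unfolding g0 C_def card_commutator_equation[OF x a] ..
  finally have card: "of_nat (card {(b, c). b \<in> carrier \<Delta> \<and> c \<in> carrier \<Delta> \<and> \<delta> (comm\<Delta> b c) = g0}) =
      of_nat (order \<Delta>) * (of_nat (order N) * L)" by simp
  have "complex_of_real (measure (\<mu> \<Otimes>\<^sub>M \<mu>) (commutator_map G -` {g0} \<inter> (carrier G \<times> carrier G))) =
      of_nat (card {(b, c). b \<in> carrier \<Delta> \<and> c \<in> carrier \<Delta> \<and> \<delta> (comm\<Delta> b c) = g0}) / (of_nat (order \<Delta>))\<^sup>2"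
    unfolding measure_commutator_fibre[OF assms(5)] by simp
  also have "\<dots> = of_nat (order N) / of_nat (order \<Delta>) * L"
    unfolding card using pos by (simp add: power2_eq_square)
  finally show ?thesis by (intro exI[of _ L] conjI lim)
qed

end
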